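(* Let $\Lambda$ be a $k$-graph, $\mathcal{N}$ a left $\Lambda$-module and $\mathcal{M}$ a right $\Lambda$-module. The categorical homology groups $H_n(\Lambda,\mathcal{N})$ and the categorical cohomology groups $H^n(\Lambda,\mathcal{M})$ are zero for all $n>k$.
   Context: **k-graphs.** A $k$-graph is a countable small category $\Lambda$ with a functor $d\colon\Lambda\to\mathbb{N}^k$ ($0\in\mathbb{N}$; $\mathbb{N}^k$ a one-object category under addition) with the factorization property: if $d(\lambda)=m+n$ there are unique morphisms $\mu,\nu$ with $d(\mu)=m$, $d(\nu)=n$, $\lambda=\mu\nu$. Here $\mu\nu$ is defined iff $s(\mu)=r(\nu)$ ($s$ = source, $r$ = range). **Modules.** A right (left) $\Lambda$-module is a contravariant (covariant) functor from $\Lambda$ to abelian groups; the action is written $m\cdot\lambda$ for $m\in\mathcal{M}(r(\lambda))$ (resp. $\lambda\cdot a$ for $a\in\mathcal{N}(s(\lambda))$). Module maps are natural transformations and form the group $\mathrm{Hom}_\Lambda$; exactness and surjectivity are objectwise; a module $\mathcal{P}$ is projective if every surjective module map onto $\mathcal{P}$ has a right inverse module map. $\mathcal{M}\otimes_\Lambda\mathcal{N}$ is the abelian group generated by $m\otimes a$ with $m\in\mathcal{M}(v)$, $a\in\mathcal{N}(v)$, $v$ an object, subject to biadditivity and $(m\cdot\lambda)\otimes a=m\otimes(\lambda\cdot a)$. $\mathbb{Z}^\Lambda$ is the constant right module with value $\mathbb{Z}$ and all morphisms acting as the identity. **Categorical (co-)homology.** Choose a projective resolution $\cdots\to\mathcal{R}_1\to\mathcal{R}_0\to\mathbb{Z}^\Lambda\to0$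 of right $\Lambda$-modules. $H^n(\Lambda,\mathcal{M})$ is the $n$-th cohomology of $\mathrm{Hom}_\Lambda(\mathcal{R}_*,\mathcal{M})$ and $H_n(\Lambda,\mathcal{N})$ is the $n$-th homology of $\mathcal{R}_*\otimes_\Lambda\mathcal{N}$ (the term $\mathbb{Z}^\Lambda$ is dropped). These do not depend on the choice of resolution up to isomorphism. *)

theory Defs
  imports "HOL-Algebra.Free_Abelian_Groups" "HOL-Library.Countable_Set"
begin

section \<open>Higher-rank graphs\<close>

record ('o, 'm) category =
  obj  :: "'o set"
  mor  :: "'m set"
  src  :: "'m \<Rightarrow> 'o"
  rng  :: "'m \<Rightarrow> 'o"
  idn  :: "'o \<Rightarrow> 'm"
  comp :: "'m \<Rightarrow> 'm \<Rightarrow> 'm"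

text \<open>The composite \<open>comp \<Lambda> \<mu> \<nu>\<close>, written \<open>\<mu>\<nu>\<close> below, is meaningful only if
  \<open>src \<Lambda> \<mu> = rng \<Lambda> \<nu>\<close>.\<close>

locale small_category =
  fixes \<Lambda> :: "('o, 'm) category"
  assumes src_obj: "\<mu> \<in> mor \<Lambda> \<Longrightarrow> src \<Lambda> \<mu> \<in> obj \<Lambda>"
    and rng_obj: "\<mu> \<in> mor \<Lambda> \<Longrightarrow> rng \<Lambda> \<mu> \<in> obj \<Lambda>"
    and idn_mor: "v \<in> obj \<Lambda> \<Longrightarrow> idn \<Lambda> v \<in> mor \<Lambda>"
    and src_idn: "v \<in> obj \<Lambda> \<Longrightarrow> src \<Lambda> (idn \<Lambda> v) = v"
    and rng_idn: "v \<in> obj \<Lambda> \<Longrightarrow> rng \<Lambda> (idn \<Lambda> v) = v"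
    and comp_mor: "\<lbrakk>\<mu> \<in> mor \<Lambda>; \<nu> \<in> mor \<Lambda>; src \<Lambda> \<mu> = rng \<Lambda> \<nu>\<rbrakk> \<Longrightarrow> comp \<Lambda> \<mu> \<nu> \<in> mor \<Lambda>"
    and src_comp: "\<lbrakk>\<mu> \<in> mor \<Lambda>; \<nu> \<in> mor \<Lambda>; src \<Lambda> \<mu> = rng \<Lambda> \<nu>\<rbrakk>
          \<Longrightarrow> src \<Lambda> (comp \<Lambda> \<mu> \<nu>) = src \<Lambda> \<nu>"
    and rng_comp: "\<lbrakk>\<mu> \<in> mor \<Lambda>; \<nu> \<in> mor \<Lambda>; src \<Lambda> \<mu> = rng \<Lambda> \<nu>\<rbrakk>
          \<Longrightarrow> rng \<Lambda> (comp \<Lambda> \<mu> \<nu>) = rng \<Lambda> \<mu>"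
    and comp_idn_left: "\<mu> \<in> mor \<Lambda> \<Longrightarrow> comp \<Lambda> (idn \<Lambda> (rng \<Lambda> \<mu>)) \<mu> = \<mu>"
    and comp_idn_right: "\<mu> \<in> mor \<Lambda> \<Longrightarrow> comp \<Lambda> \<mu> (idn \<Lambda> (src \<Lambda> \<mu>)) = \<mu>"
    and comp_assoc: "\<lbrakk>\<kappa> \<in> mor \<Lambda>; \<mu> \<in> mor \<Lambda>; \<nu> \<in> mor \<Lambda>;
            src \<Lambda> \<kappa> = rng \<Lambda> \<mu>; src \<Lambda> \<mu> = rng \<Lambda> \<nu>\<rbrakk>
          \<Longrightarrow> comp \<Lambda> (comp \<Lambda> \<kappa> \<mu>) \<nu> = comp \<Lambda> \<kappa> (comp \<Lambda> \<mu> \<nu>)"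

text \<open>The monoid \<open>\<nat>\<^sup>k\<close>: finitely supported functions on \<open>\<nat>\<close> supported in \<open>{0, \<dots>, k - 1}\<close>,
  with the pointwise addition of \<^typ>\<open>nat \<Rightarrow>\<^sub>0 nat\<close>.\<close>

definition multidegrees :: "nat \<Rightarrow> (nat \<Rightarrow>\<^sub>0 nat) set"
  where "multidegrees k = {n. Poly_Mapping.keys n \<subseteq> {..<k}}"

locale k_graph = small_category \<Lambda>
  for k :: nat and \<Lambda> :: "('o, 'm) category" and d :: "'m \<Rightarrow> nat \<Rightarrow>\<^sub>0 nat" +
  assumes countable_obj: "countable (obj \<Lambda>)"
    and countable_mor: "countable (mor \<Lambda>)"
    and degree: "\<mu> \<in> mor \<Lambda> \<Longrightarrow> d \<mu> \<in> multidegrees k"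
    and degree_idn: "v \<in> obj \<Lambda> \<Longrightarrow> d (idn \<Lambda> v) = 0"
    and degree_comp: "\<lbrakk>\<mu> \<in> mor \<Lambda>; \<nu> \<in> mor \<Lambda>; src \<Lambda> \<mu> = rng \<Lambda> \<nu>\<rbrakk>
          \<Longrightarrow> d (comp \<Lambda> \<mu> \<nu>) = d \<mu> + d \<nu>"
    and factorization: "\<lbrakk>\<kappa> \<in> mor \<Lambda>; m \<in> multidegrees k; n \<in> multidegrees k; d \<kappa> = m + n\<rbrakk>
          \<Longrightarrow> \<exists>!(\<mu>, \<nu>). \<mu> \<in> mor \<Lambda> \<and> \<nu> \<in> mor \<Lambda> \<and> src \<Lambda> \<mu> = rng \<Lambda> \<nu>
                \<and> d \<mu> = m \<and> d \<nu> = n \<and> \<kappa> = comp \<Lambda> \<mu> \<nu>"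


section \<open>Modules\<close>

text \<open>Abelian groups are the (multiplicatively written) commutative groups of HOL-Algebra.
  A functor to abelian groups consists of a group \<open>grp M v\<close> for every object \<open>v\<close> and
  a homomorphism \<open>act M \<kappa>\<close> for every morphism \<open>\<kappa>\<close>; \<open>act M \<kappa> x\<close> is \<open>x \<cdot> \<kappa>\<close> for
  right modules and \<open>\<kappa> \<cdot> x\<close> for left modules.\<close>

record ('o, 'm, 'a) cat_module =
  grp :: "'o \<Rightarrow> 'a monoid"
  act :: "'m \<Rightarrow> 'a \<Rightarrow> 'a"

definition right_module :: "('o, 'm) category \<Rightarrow> ('o, 'm, 'a) cat_module \<Rightarrow> bool"
  where "right_module \<Lambda> M \<longleftrightarrow>
    (\<forall>v\<in>obj \<Lambda>. comm_group (grp M v)) \<and>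
    (\<forall>\<kappa>\<in>mor \<Lambda>. act M \<kappa> \<in> hom (grp M (rng \<Lambda> \<kappa>)) (grp M (src \<Lambda> \<kappa>))) \<and>
    (\<forall>v\<in>obj \<Lambda>. \<forall>x\<in>carrier (grp M v). act M (idn \<Lambda> v) x = x) \<and>
    (\<forall>\<mu>\<in>mor \<Lambda>. \<forall>\<nu>\<in>mor \<Lambda>. src \<Lambda> \<mu> = rng \<Lambda> \<nu> \<longrightarrow>
      (\<forall>x\<in>carrier (grp M (rng \<Lambda> \<mu>)). act M (comp \<Lambda> \<mu> \<nu>) x = act M \<nu> (act M \<mu> x)))"

definition left_module :: "('o, 'm) category \<Rightarrow> ('o, 'm, 'a) cat_module \<Rightarrow> bool"
  where "left_module \<Lambda> N \<longleftrightarrow>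
    (\<forall>v\<in>obj \<Lambda>. comm_group (grp N v)) \<and>
    (\<forall>\<kappa>\<in>mor \<Lambda>. act N \<kappa> \<in> hom (grp N (src \<Lambda> \<kappa>)) (grp N (rng \<Lambda> \<kappa>))) \<and>
    (\<forall>v\<in>obj \<Lambda>. \<forall>a\<in>carrier (grp N v). act N (idn \<Lambda> v) a = a) \<and>
    (\<forall>\<mu>\<in>mor \<Lambda>. \<forall>\<nu>\<in>mor \<Lambda>. src \<Lambda> \<mu> = rng \<Lambda> \<nu> \<longrightarrow>
      (\<forall>a\<in>carrier (grp N (src \<Lambda> \<nu>)). act N (comp \<Lambda> \<mu> \<nu>) a = act N \<mu> (act N \<nu> a)))"

text \<open>Maps of right modules. Components are taken to be \<^const>\<open>undefined\<close> off their domains, so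
  that equality of module maps is equality in HOL and \<open>Hom\<close> below is a group.\<close>

definition module_maps ::
    "('o, 'm) category \<Rightarrow> ('o, 'm, 'a) cat_module \<Rightarrow> ('o, 'm, 'b) cat_module \<Rightarrow> ('o \<Rightarrow> 'a \<Rightarrow> 'b) set"
  where "module_maps \<Lambda> M M' =
    {f \<in> (\<Pi>\<^sub>E v\<in>obj \<Lambda>. hom (grp M v) (grp M' v) \<inter> extensional (carrier (grp M v))).
      \<forall>\<kappa>\<in>mor \<Lambda>. \<forall>x\<in>carrier (grp M (rng \<Lambda> \<kappa>)).
        f (src \<Lambda> \<kappa>) (act M \<kappa> x) = act M' \<kappa> (f (rng \<Lambda> \<kappa>) x)}"

definition module_surjective ::
    "('o, 'm) category \<Rightarrow> ('o, 'm, 'a) cat_module \<Rightarrow> ('o, 'm, 'b) cat_module \<Rightarrow> ('o \<Rightarrow> 'a \<Rightarrow> 'b) \<Rightarrow> bool"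
  where "module_surjective \<Lambda> M M' f \<longleftrightarrow>
    (\<forall>v\<in>obj \<Lambda>. f v ` carrier (grp M v) = carrier (grp M' v))"

definition epis_split :: "'q itself \<Rightarrow> ('o, 'm) category \<Rightarrow> ('o, 'm, 'a) cat_module \<Rightarrow> bool"
  where "epis_split _ \<Lambda> P \<longleftrightarrow>
    (\<forall>(Q :: ('o, 'm, 'q) cat_module) f.
      right_module \<Lambda> Q \<and> f \<in> module_maps \<Lambda> Q P \<and> module_surjective \<Lambda> Q P f \<longrightarrow>
      (\<exists>g\<in>module_maps \<Lambda> P Q. \<forall>v\<in>obj \<Lambda>. \<forall>x\<in>carrier (grp P v). f v (g v x) = x))"

text \<open>A definition in HOL cannot quantify over all types \<open>'q\<close> of test modules. Fixing
  \<open>'q = ('m \<times> 'a) \<Rightarrow>\<^sub>0 int\<close>, which accommodates the free module on the elements of \<open>P\<close>, loses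
  nothing: lemma \<open>projective_epis_split\<close> below shows that surjections onto \<open>P\<close> from modules over any
  type then split.\<close>

definition projective :: "('o, 'm) category \<Rightarrow> ('o, 'm, 'a) cat_module \<Rightarrow> bool"
  where "projective \<Lambda> P \<longleftrightarrow> right_module \<Lambda> P \<and> epis_split TYPE(('m \<times> 'a) \<Rightarrow>\<^sub>0 int) \<Lambda> P"

text \<open>Adequacy of \<^const>\<open>projective\<close>: surjections from modules over an arbitrary type split.\<close>

lemma module_mapsI:
  assumes "\<And>v. v \<in> obj \<Lambda> \<Longrightarrow> f v \<in> hom (grp M v) (grp M' v)"
    and "\<And>\<mu> x. \<lbrakk>\<mu> \<in> mor \<Lambda>; x \<in> carrier (grp M (rng \<Lambda> \<mu>))\<rbrakk>
          \<Longrightarrow> f (src \<Lambda> \<mu>) (act M \<mu> x) = act M' \<mu> (f (rng \<Lambda> \<mu>) x)"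
    and "small_category \<Lambda>" "right_module \<Lambda> M"
  shows "(\<lambda>v\<in>obj \<Lambda>. \<lambda>x\<in>carrier (grp M v). f v x) \<in> module_maps \<Lambda> M M'"
proof -
  interpret small_category \<Lambda> by fact
  have "(\<lambda>x\<in>carrier (grp M v). f v x) \<in> hom (grp M v) (grp M' v)" if "v \<in> obj \<Lambda>" for v
    using assms(1)[OF that] assms(4) that
    by (auto simp: hom_def right_module_def comm_group_def comm_monoid_def monoid.m_closed)
  moreover have "act M \<mu> x \<in> carrier (grp M (src \<Lambda> \<mu>))"
    if "\<mu> \<in> mor \<Lambda>" "x \<in> carrier (grp M (rng \<Lambda> \<mu>))" for \<mu> x
    using assms(4) that by (auto simp: right_module_def hom_def)
  ultimately show ?thesis
    using assms(2) by (auto simp: module_maps_def src_obj rng_obj)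
qed

definition free_gens :: "('o, 'm) category \<Rightarrow> ('o, 'm, 'a) cat_module \<Rightarrow> 'o \<Rightarrow> ('m \<times> 'a) set"
  where "free_gens \<Lambda> P v = {(\<mu>, x). \<mu> \<in> mor \<Lambda> \<and> src \<Lambda> \<mu> = v \<and> x \<in> carrier (grp P (rng \<Lambda> \<mu>))}"

text \<open>The free right module on the elements of \<open>P\<close>; the generator \<open>(\<mu>, x)\<close> stands for \<open>x \<cdot> \<mu>\<close>.\<close>

definition free_module ::
    "('o, 'm) category \<Rightarrow> ('o, 'm, 'a) cat_module \<Rightarrow> ('o, 'm, ('m \<times> 'a) \<Rightarrow>\<^sub>0 int) cat_module"
  where "free_module \<Lambda> P =
    \<lparr>grp = (\<lambda>v. free_Abelian_group (free_gens \<Lambda> P v)),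
     act = (\<lambda>\<nu>. frag_extend (\<lambda>(\<mu>, x). frag_of (comp \<Lambda> \<mu> \<nu>, x)))\<rparr>"

lemma frag_extend_hom:
  assumes "\<And>x. x \<in> S \<Longrightarrow> Poly_Mapping.keys (f x) \<subseteq> T"
  shows "frag_extend f \<in> hom (free_Abelian_group S) (free_Abelian_group T)"
  using assms keys_frag_extend[of f]
  by (fastforce simp: hom_def frag_extend_add)

lemma hom_free_eq:
  assumes h: "h \<in> hom (free_Abelian_group S) G" and h': "h' \<in> hom (free_Abelian_group S) G"
    and G: "group G"
    and eq: "\<And>x. x \<in> S \<Longrightarrow> h (frag_of x) = h' (frag_of x)"
    and c: "c \<in> carrier (free_Abelian_group S)"
  shows "h c = h' c"
proof -
  have 0: "group_hom (free_Abelian_group S) G h" "group_hom (free_Abelian_group S) G h'"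
    using h h' G by (auto simp: group_hom_def group_hom_axioms_def)
  have c': "Poly_Mapping.keys c \<subseteq> S" using c by simp
  have "Poly_Mapping.keys c \<subseteq> S \<and> h c = h' c"
    using c'
  proof (induction c rule: frag_induction)
    case zero
    then show ?case using group_hom.hom_one[OF 0(1)] group_hom.hom_one[OF 0(2)] by simp
  next
    case (one x)
    then show ?case by (simp add: eq)
  next
    case (diff a b)
    then have "Poly_Mapping.keys (a - b) \<subseteq> S" using keys_diff[of a b] by blast
    have "g (a - b) = g a \<otimes>\<^bsub>G\<^esub> inv\<^bsub>G\<^esub> g b"
      if "group_hom (free_Abelian_group S) G g" for g
      using group_hom.hom_mult[OF that, of a "- b"] group_hom.hom_inv[OF that, of b] diff.IH by simp
    from this[OF 0(1)] this[OF 0(2)] show ?case using diff.IH \<open>Poly_Mapping.keys (a - b) \<subseteq> S\<close> by simp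
  qed
  then show ?thesis by simp
qed

lemma right_module_free_module:
  assumes "small_category \<Lambda>"
  shows "right_module \<Lambda> (free_module \<Lambda> P)"
proof -
  interpret small_category \<Lambda> by fact
  have hom: "frag_extend (\<lambda>(\<mu>, x). frag_of (comp \<Lambda> \<mu> \<nu>, x))
      \<in> hom (free_Abelian_group (free_gens \<Lambda> P (rng \<Lambda> \<nu>))) (free_Abelian_group (free_gens \<Lambda> P (src \<Lambda> \<nu>)))"
    if "\<nu> \<in> mor \<Lambda>" for \<nu>
    using that by (intro frag_extend_hom) (auto simp: free_gens_def comp_mor src_comp rng_comp)
  show ?thesis
    unfolding right_module_def
  proof (intro conjI ballI impI)
    fix v x assume "v \<in> obj \<Lambda>" "x \<in> carrier (grp (free_module \<Lambda> P) v)"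
    then have "frag_extend (\<lambda>(\<mu>, y). frag_of (comp \<Lambda> \<mu> (idn \<Lambda> v), y)) x = frag_extend frag_of x"
      by (intro frag_extend_eq) (auto simp: free_module_def free_gens_def comp_idn_right)
    then show "act (free_module \<Lambda> P) (idn \<Lambda> v) x = x"
      by (simp add: free_module_def flip: frag_expansion)
  next
    fix \<mu> \<nu> x assume A: "\<mu> \<in> mor \<Lambda>" "\<nu> \<in> mor \<Lambda>" "src \<Lambda> \<mu> = rng \<Lambda> \<nu>"
      "x \<in> carrier (grp (free_module \<Lambda> P) (rng \<Lambda> \<mu>))"
    have "frag_extend (\<lambda>(\<kappa>, y). frag_of (comp \<Lambda> \<kappa> \<nu>, y)) (frag_extend (\<lambda>(\<kappa>, y). frag_of (comp \<Lambda> \<kappa> \<mu>, y)) x)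
      = frag_extend ((\<lambda>(\<kappa>, y). frag_of (comp \<Lambda> \<kappa> \<nu>, y)) \<circ> (\<lambda>(\<kappa>, y). (comp \<Lambda> \<kappa> \<mu>, y))) x"
      by (subst frag_extend_compose[symmetric]) (simp add: Fun.comp_def case_prod_unfold)
    also have "\<dots> = frag_extend (\<lambda>(\<kappa>, y). frag_of (comp \<Lambda> \<kappa> (comp \<Lambda> \<mu> \<nu>), y)) x"
      using A by (intro frag_extend_eq) (auto simp: free_module_def free_gens_def comp_assoc)
    finally show "act (free_module \<Lambda> P) (comp \<Lambda> \<mu> \<nu>) x
        = act (free_module \<Lambda> P) \<nu> (act (free_module \<Lambda> P) \<mu> x)"
      by (simp add: free_module_def)
  qed (simp_all add: free_module_def abelian_free_Abelian_group hom)
qed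

lemma free_module_map:
  assumes "small_category \<Lambda>" and Q: "right_module \<Lambda> Q"
    and y: "\<And>v x. \<lbrakk>v \<in> obj \<Lambda>; x \<in> carrier (grp P v)\<rbrakk> \<Longrightarrow> y v x \<in> carrier (grp Q v)"
  obtains q where "q \<in> module_maps \<Lambda> (free_module \<Lambda> P) Q"
    and "\<And>v \<mu> x. \<lbrakk>v \<in> obj \<Lambda>; (\<mu>, x) \<in> free_gens \<Lambda> P v\<rbrakk>
          \<Longrightarrow> q v (frag_of (\<mu>, x)) = act Q \<mu> (y (rng \<Lambda> \<mu>) x)"
proof -
  interpret small_category \<Lambda> by fact
  let ?G = "\<lambda>v. free_Abelian_group (free_gens \<Lambda> P v)"
  have cl: "act Q \<mu> z \<in> carrier (grp Q (src \<Lambda> \<mu>))"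
    if "\<mu> \<in> mor \<Lambda>" "z \<in> carrier (grp Q (rng \<Lambda> \<mu>))" for \<mu> z
    using Q that by (auto simp: right_module_def hom_def)
  have "\<exists>h. v \<in> obj \<Lambda> \<longrightarrow> h \<in> hom (?G v) (grp Q v) \<and>
      (\<forall>z\<in>free_gens \<Lambda> P v. h (frag_of z) = (\<lambda>(\<mu>, x). act Q \<mu> (y (rng \<Lambda> \<mu>) x)) z)" for v
  proof (cases "v \<in> obj \<Lambda>")
    case True
    then have "comm_group (grp Q v)" using Q by (simp add: right_module_def)
    moreover have "(\<lambda>(\<mu>, x). act Q \<mu> (y (rng \<Lambda> \<mu>) x)) ` free_gens \<Lambda> P v \<subseteq> carrier (grp Q v)"
      using cl y rng_obj by (auto simp: free_gens_def)
    ultimately obtain h where "h \<in> hom (?G v) (grp Q v)"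
        "\<And>z. z \<in> free_gens \<Lambda> P v \<Longrightarrow> h (frag_of z) = (\<lambda>(\<mu>, x). act Q \<mu> (y (rng \<Lambda> \<mu>) x)) z"
      using comm_group.free_Abelian_group_universal by blast
    then show ?thesis by blast
  qed auto
  then have "\<exists>h. \<forall>v. v \<in> obj \<Lambda> \<longrightarrow> h v \<in> hom (?G v) (grp Q v) \<and>
      (\<forall>z\<in>free_gens \<Lambda> P v. h v (frag_of z) = (\<lambda>(\<mu>, x). act Q \<mu> (y (rng \<Lambda> \<mu>) x)) z)"
    by (intro choice) blast
  then obtain h where h: "\<And>v. v \<in> obj \<Lambda> \<Longrightarrow> h v \<in> hom (?G v) (grp Q v)"
    and hg: "\<And>v \<mu> x. \<lbrakk>v \<in> obj \<Lambda>; (\<mu>, x) \<in> free_gens \<Lambda> P v\<rbrakk>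
          \<Longrightarrow> h v (frag_of (\<mu>, x)) = act Q \<mu> (y (rng \<Lambda> \<mu>) x)"
    by fastforce
  let ?F = "free_module \<Lambda> P"
  have F: "right_module \<Lambda> ?F" using assms(1) by (rule right_module_free_module)
  have gF: "grp ?F v = ?G v" for v by (simp add: free_module_def)
  have nat: "h (src \<Lambda> \<mu>) (act ?F \<mu> c) = act Q \<mu> (h (rng \<Lambda> \<mu>) c)"
    if m: "\<mu> \<in> mor \<Lambda>" and c: "c \<in> carrier (grp ?F (rng \<Lambda> \<mu>))" for \<mu> c
  proof -
    have a: "act ?F \<mu> \<in> hom (?G (rng \<Lambda> \<mu>)) (?G (src \<Lambda> \<mu>))"
      using F m by (simp add: right_module_def gF)
    have b: "act Q \<mu> \<in> hom (grp Q (rng \<Lambda> \<mu>)) (grp Q (src \<Lambda> \<mu>))"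
      using Q m by (simp add: right_module_def)
    have "(h (src \<Lambda> \<mu>) \<circ> act ?F \<mu>) c = (act Q \<mu> \<circ> h (rng \<Lambda> \<mu>)) c"
    proof (rule hom_free_eq[where G = "grp Q (src \<Lambda> \<mu>)"])
      show "h (src \<Lambda> \<mu>) \<circ> act ?F \<mu> \<in> hom (?G (rng \<Lambda> \<mu>)) (grp Q (src \<Lambda> \<mu>))"
        using Group.hom_compose[OF a h] m by (simp add: src_obj)
      show "act Q \<mu> \<circ> h (rng \<Lambda> \<mu>) \<in> hom (?G (rng \<Lambda> \<mu>)) (grp Q (src \<Lambda> \<mu>))"
        using Group.hom_compose[OF h b] m by (simp add: rng_obj)
      show "group (grp Q (src \<Lambda> \<mu>))"
        using Q m src_obj by (simp add: right_module_def comm_group.axioms)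
      show "c \<in> carrier (?G (rng \<Lambda> \<mu>))" using c by (simp add: gF)
      fix z assume "z \<in> free_gens \<Lambda> P (rng \<Lambda> \<mu>)"
      then obtain \<kappa> x where z: "z = (\<kappa>, x)" "(\<kappa>, x) \<in> free_gens \<Lambda> P (rng \<Lambda> \<mu>)" "\<kappa> \<in> mor \<Lambda>"
        "src \<Lambda> \<kappa> = rng \<Lambda> \<mu>" "x \<in> carrier (grp P (rng \<Lambda> \<kappa>))"
        by (auto simp: free_gens_def)
      have k: "(comp \<Lambda> \<kappa> \<mu>, x) \<in> free_gens \<Lambda> P (src \<Lambda> \<mu>)"
        using z m by (simp add: free_gens_def comp_mor src_comp rng_comp)
      have "h (src \<Lambda> \<mu>) (act ?F \<mu> (frag_of z)) = act Q (comp \<Lambda> \<kappa> \<mu>) (y (rng \<Lambda> \<kappa>) x)"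
        using hg[OF _ k] z m by (simp add: free_module_def src_obj rng_comp)
      also have "\<dots> = act Q \<mu> (act Q \<kappa> (y (rng \<Lambda> \<kappa>) x))"
        using Q z m y rng_obj by (simp add: right_module_def)
      also have "\<dots> = act Q \<mu> (h (rng \<Lambda> \<mu>) (frag_of z))"
        using hg[OF _ z(2)] z m by (simp add: rng_obj)
      finally show "(h (src \<Lambda> \<mu>) \<circ> act ?F \<mu>) (frag_of z) = (act Q \<mu> \<circ> h (rng \<Lambda> \<mu>)) (frag_of z)"
        by simp
    qed
    then show ?thesis by simp
  qed
  show thesis
  proof (rule that)
    show "(\<lambda>v\<in>obj \<Lambda>. \<lambda>c\<in>carrier (grp ?F v). h v c) \<in> module_maps \<Lambda> ?F Q"
      by (rule module_mapsI) (use h nat F assms(1) in \<open>auto simp: gF\<close>)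
  qed (simp add: gF hg)
qed

lemma projective_epis_split:
  fixes P :: "('o, 'm, 'a) cat_module"
  assumes "small_category \<Lambda>" and P: "projective \<Lambda> P"
  shows "epis_split TYPE('q) \<Lambda> P"
  unfolding epis_split_def
proof (intro allI impI, elim conjE)
  fix Q :: "('o, 'm, 'q) cat_module" and f
  assume Q: "right_module \<Lambda> Q" and f: "f \<in> module_maps \<Lambda> Q P" and sf: "module_surjective \<Lambda> Q P f"
  interpret small_category \<Lambda> by fact
  let ?F = "free_module \<Lambda> P"
  have PP: "right_module \<Lambda> P" using P by (simp add: projective_def)
  have F: "right_module \<Lambda> ?F" using assms(1) by (rule right_module_free_module)
  have gF: "grp ?F v = free_Abelian_group (free_gens \<Lambda> P v)" for v by (simp add: free_module_def)
  obtain p where p: "p \<in> module_maps \<Lambda> ?F P"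
    and pg: "\<And>v \<mu> x. \<lbrakk>v \<in> obj \<Lambda>; (\<mu>, x) \<in> free_gens \<Lambda> P v\<rbrakk> \<Longrightarrow> p v (frag_of (\<mu>, x)) = act P \<mu> x"
    using free_module_map[OF assms(1) PP, of P "\<lambda>v x. x"] by metis
  have homD: "g v \<in> hom (grp A v) (grp B v)" if "g \<in> module_maps \<Lambda> A B" "v \<in> obj \<Lambda>"
    for g v and A :: "('o, 'm, 'c) cat_module" and B :: "('o, 'm, 'e) cat_module"
    using that by (auto simp: module_maps_def)
  have "module_surjective \<Lambda> ?F P p"
    unfolding module_surjective_def
  proof (intro ballI equalityI subsetI)
    fix v x assume v: "v \<in> obj \<Lambda>" and x: "x \<in> carrier (grp P v)"
    then have "(idn \<Lambda> v, x) \<in> free_gens \<Lambda> P v"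
      by (simp add: free_gens_def idn_mor src_idn rng_idn)
    then have "frag_of (idn \<Lambda> v, x) \<in> carrier (grp ?F v)" "p v (frag_of (idn \<Lambda> v, x)) = x"
      using pg v x PP by (simp_all add: gF right_module_def)
    then show "x \<in> p v ` carrier (grp ?F v)" by force
  next
    fix v x assume "v \<in> obj \<Lambda>" "x \<in> p v ` carrier (grp ?F v)"
    then show "x \<in> carrier (grp P v)"
      using p by (fastforce simp: module_maps_def hom_def)
  qed
  then obtain s where s: "s \<in> module_maps \<Lambda> P ?F"
    and ps: "\<And>v x. \<lbrakk>v \<in> obj \<Lambda>; x \<in> carrier (grp P v)\<rbrakk> \<Longrightarrow> p v (s v x) = x"
    using P F p unfolding projective_def epis_split_def by blast
  define y where "y v = inv_into (carrier (grp Q v)) (f v)" for v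
  have y: "y v x \<in> carrier (grp Q v)" and fy: "f v (y v x) = x"
    if "v \<in> obj \<Lambda>" "x \<in> carrier (grp P v)" for v x
    using sf that unfolding module_surjective_def y_def
    by (auto intro: inv_into_into f_inv_into_f)
  obtain q where q: "q \<in> module_maps \<Lambda> ?F Q"
    and qg: "\<And>v \<mu> x. \<lbrakk>v \<in> obj \<Lambda>; (\<mu>, x) \<in> free_gens \<Lambda> P v\<rbrakk>
      \<Longrightarrow> q v (frag_of (\<mu>, x)) = act Q \<mu> (y (rng \<Lambda> \<mu>) x)"
    using free_module_map[OF assms(1) Q, of P y] y by metis
  have fq: "f v (q v c) = p v c" if v: "v \<in> obj \<Lambda>" and c: "c \<in> carrier (grp ?F v)" for v c
  proof -
    have "(f v \<circ> q v) c = p v c"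
    proof (rule hom_free_eq[where G = "grp P v"])
      show "f v \<circ> q v \<in> hom (free_Abelian_group (free_gens \<Lambda> P v)) (grp P v)"
        using Group.hom_compose[OF homD[OF q v] homD[OF f v]] by (simp add: gF)
      show "p v \<in> hom (free_Abelian_group (free_gens \<Lambda> P v)) (grp P v)"
        using homD[OF p v] by (simp add: gF)
      show "group (grp P v)" using PP v by (simp add: right_module_def comm_group.axioms)
      show "c \<in> carrier (free_Abelian_group (free_gens \<Lambda> P v))" using c by (simp add: gF)
      fix z assume "z \<in> free_gens \<Lambda> P v"
      then obtain \<mu> x where z: "z = (\<mu>, x)" "(\<mu>, x) \<in> free_gens \<Lambda> P v" "\<mu> \<in> mor \<Lambda>"
        "src \<Lambda> \<mu> = v" "x \<in> carrier (grp P (rng \<Lambda> \<mu>))"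
        by (auto simp: free_gens_def)
      have "f v (act Q \<mu> (y (rng \<Lambda> \<mu>) x)) = act P \<mu> (f (rng \<Lambda> \<mu>) (y (rng \<Lambda> \<mu>) x))"
        using f z y rng_obj unfolding module_maps_def by blast
      then show "(f v \<circ> q v) (frag_of z) = p v (frag_of z)"
        using qg[OF v z(2)] pg[OF v z(2)] fy z rng_obj by simp
    qed
    then show ?thesis by simp
  qed
  let ?g = "\<lambda>v\<in>obj \<Lambda>. \<lambda>x\<in>carrier (grp P v). q v (s v x)"
  have sc: "s v x \<in> carrier (grp ?F v)" if "v \<in> obj \<Lambda>" "x \<in> carrier (grp P v)" for v x
    using homD[OF s that(1)] that(2) by (auto simp: hom_def)
  have "?g \<in> module_maps \<Lambda> P Q"
  proof (rule module_mapsI)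
    show "(\<lambda>x. q v (s v x)) \<in> hom (grp P v) (grp Q v)" if "v \<in> obj \<Lambda>" for v
      using Group.hom_compose[OF homD[OF s that] homD[OF q that]] by (simp add: Fun.comp_def)
    fix \<mu> x assume "\<mu> \<in> mor \<Lambda>" "x \<in> carrier (grp P (rng \<Lambda> \<mu>))"
    then show "q (src \<Lambda> \<mu>) (s (src \<Lambda> \<mu>) (act P \<mu> x)) = act Q \<mu> (q (rng \<Lambda> \<mu>) (s (rng \<Lambda> \<mu>) x))"
      using s q sc[of "rng \<Lambda> \<mu>" x] rng_obj by (simp add: module_maps_def)
  qed (use assms(1) PP in auto)
  moreover have "\<forall>v\<in>obj \<Lambda>. \<forall>x\<in>carrier (grp P v). f v (?g v x) = x"
    using fq sc ps by simp
  ultimately show "\<exists>g\<in>module_maps \<Lambda> P Q. \<forall>v\<in>obj \<Lambda>. \<forall>x\<in>carrier (grp P v). f v (g v x) = x"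
    by blast
qed


definition constant_int_module :: "('o, 'm, int) cat_module"
  where "constant_int_module = \<lparr>grp = (\<lambda>v. integer_group), act = (\<lambda>\<kappa> x. x)\<rparr>"

text \<open>\<open>bd n\<close> is the boundary map from \<open>R (n + 1)\<close> to \<open>R n\<close> and \<open>\<epsilon>\<close> is the augmentation.\<close>

definition projective_resolution ::
    "('o, 'm) category \<Rightarrow> (nat \<Rightarrow> ('o, 'm, 'r) cat_module) \<Rightarrow> (nat \<Rightarrow> 'o \<Rightarrow> 'r \<Rightarrow> 'r)
      \<Rightarrow> ('o \<Rightarrow> 'r \<Rightarrow> 'b) \<Rightarrow> ('o, 'm, 'b) cat_module \<Rightarrow> bool"
  where "projective_resolution \<Lambda> R bd \<epsilon> M \<longleftrightarrow>
    (\<forall>n. projective \<Lambda> (R n)) \<and>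
    (\<forall>n. bd n \<in> module_maps \<Lambda> (R (Suc n)) (R n)) \<and>
    \<epsilon> \<in> module_maps \<Lambda> (R 0) M \<and>
    (\<forall>n. \<forall>v\<in>obj \<Lambda>. bd (Suc n) v ` carrier (grp (R (Suc (Suc n))) v)
        = kernel (grp (R (Suc n)) v) (grp (R n) v) (bd n v)) \<and>
    (\<forall>v\<in>obj \<Lambda>. bd 0 v ` carrier (grp (R (Suc 0)) v) = kernel (grp (R 0) v) (grp M v) (\<epsilon> v)) \<and>
    module_surjective \<Lambda> (R 0) M \<epsilon>"


section \<open>Hom and tensor product\<close>

definition Hom ::
    "('o, 'm) category \<Rightarrow> ('o, 'm, 'a) cat_module \<Rightarrow> ('o, 'm, 'b) cat_module \<Rightarrow> ('o \<Rightarrow> 'a \<Rightarrow> 'b) monoid"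
  where "Hom \<Lambda> M M' =
    \<lparr>carrier = module_maps \<Lambda> M M',
     monoid.mult = (\<lambda>f g. \<lambda>v\<in>obj \<Lambda>. \<lambda>x\<in>carrier (grp M v). f v x \<otimes>\<^bsub>grp M' v\<^esub> g v x),
     one = (\<lambda>v\<in>obj \<Lambda>. \<lambda>x\<in>carrier (grp M v). \<one>\<^bsub>grp M' v\<^esub>)\<rparr>"

text \<open>Composition with \<open>f : M \<rightarrow> M'\<close>, from \<open>Hom \<Lambda> M' L\<close> to \<open>Hom \<Lambda> M L\<close>.\<close>

definition precomp ::
    "('o, 'm) category \<Rightarrow> ('o, 'm, 'a) cat_module \<Rightarrow> ('o \<Rightarrow> 'a \<Rightarrow> 'b) \<Rightarrow> ('o \<Rightarrow> 'b \<Rightarrow> 'c) \<Rightarrow> 'o \<Rightarrow> 'a \<Rightarrow> 'c"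
  where "precomp \<Lambda> M f g = (\<lambda>v\<in>obj \<Lambda>. \<lambda>x\<in>carrier (grp M v). g v (f v x))"

definition tensor_gens ::
    "('o, 'm) category \<Rightarrow> ('o, 'm, 'a) cat_module \<Rightarrow> ('o, 'm, 'b) cat_module \<Rightarrow> ('o \<times> 'a \<times> 'b) set"
  where "tensor_gens \<Lambda> M N = {(v, x, a). v \<in> obj \<Lambda> \<and> x \<in> carrier (grp M v) \<and> a \<in> carrier (grp N v)}"

definition tensor_rels ::
    "('o, 'm) category \<Rightarrow> ('o, 'm, 'a) cat_module \<Rightarrow> ('o, 'm, 'b) cat_module
      \<Rightarrow> (('o \<times> 'a \<times> 'b) \<Rightarrow>\<^sub>0 int) set"
  where "tensor_rels \<Lambda> M N =
    {frag_of (v, x \<otimes>\<^bsub>grp M v\<^esub> y, a) - (frag_of (v, x, a) + frag_of (v, y, a)) | v x y a.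
        v \<in> obj \<Lambda> \<and> x \<in> carrier (grp M v) \<and> y \<in> carrier (grp M v) \<and> a \<in> carrier (grp N v)} \<union>
    {frag_of (v, x, a \<otimes>\<^bsub>grp N v\<^esub> b) - (frag_of (v, x, a) + frag_of (v, x, b)) | v x a b.
        v \<in> obj \<Lambda> \<and> x \<in> carrier (grp M v) \<and> a \<in> carrier (grp N v) \<and> b \<in> carrier (grp N v)} \<union>
    {frag_of (src \<Lambda> \<kappa>, act M \<kappa> x, a) - frag_of (rng \<Lambda> \<kappa>, x, act N \<kappa> a) | \<kappa> x a.
        \<kappa> \<in> mor \<Lambda> \<and> x \<in> carrier (grp M (rng \<Lambda> \<kappa>)) \<and> a \<in> carrier (grp N (src \<Lambda> \<kappa>))}"

definition tensor_null ::
    "('o, 'm) category \<Rightarrow> ('o, 'm, 'a) cat_module \<Rightarrow> ('o, 'm, 'b) cat_module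
      \<Rightarrow> (('o \<times> 'a \<times> 'b) \<Rightarrow>\<^sub>0 int) set"
  where "tensor_null \<Lambda> M N =
    generate (free_Abelian_group (tensor_gens \<Lambda> M N)) (tensor_rels \<Lambda> M N)"

definition tensor ::
    "('o, 'm) category \<Rightarrow> ('o, 'm, 'a) cat_module \<Rightarrow> ('o, 'm, 'b) cat_module
      \<Rightarrow> (('o \<times> 'a \<times> 'b) \<Rightarrow>\<^sub>0 int) set monoid"
  where "tensor \<Lambda> M N = free_Abelian_group (tensor_gens \<Lambda> M N) Mod tensor_null \<Lambda> M N"

definition tensor_class ::
    "('o, 'm) category \<Rightarrow> ('o, 'm, 'a) cat_module \<Rightarrow> ('o, 'm, 'b) cat_module
      \<Rightarrow> (('o \<times> 'a \<times> 'b) \<Rightarrow>\<^sub>0 int) \<Rightarrow> (('o \<times> 'a \<times> 'b) \<Rightarrow>\<^sub>0 int) set"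
  where "tensor_class \<Lambda> M N c =
    tensor_null \<Lambda> M N #>\<^bsub>free_Abelian_group (tensor_gens \<Lambda> M N)\<^esub> c"

text \<open>The map \<open>f \<otimes> id\<close> from \<open>M \<otimes> N\<close> to \<open>M' \<otimes> N\<close>, induced on cosets by
  \<open>(v, x, a) \<mapsto> (v, f v x, a)\<close>. The use of \<^const>\<open>the_elem\<close> is justified by lemma
  \<open>tensor_map_class\<close> below.\<close>

definition tensor_map ::
    "('o, 'm) category \<Rightarrow> ('o, 'm, 'a) cat_module \<Rightarrow> ('o, 'm, 'b) cat_module \<Rightarrow> ('o \<Rightarrow> 'a \<Rightarrow> 'a)
      \<Rightarrow> (('o \<times> 'a \<times> 'b) \<Rightarrow>\<^sub>0 int) set \<Rightarrow> (('o \<times> 'a \<times> 'b) \<Rightarrow>\<^sub>0 int) set"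
  where "tensor_map \<Lambda> M' N f X =
    the_elem ((\<lambda>c. tensor_class \<Lambda> M' N (frag_extend (\<lambda>(v, x, a). frag_of (v, f v x, a)) c)) ` X)"

lemma tensor_rels_subset:
  assumes "small_category \<Lambda>" "right_module \<Lambda> M" "left_module \<Lambda> N"
  shows "tensor_rels \<Lambda> M N \<subseteq> carrier (free_Abelian_group (tensor_gens \<Lambda> M N))"
proof -
  interpret small_category \<Lambda> by fact
  let ?G = "free_Abelian_group (tensor_gens \<Lambda> M N)"
  interpret G: comm_group ?G by (rule abelian_free_Abelian_group)
  have 1: "x \<otimes>\<^bsub>grp M v\<^esub> y \<in> carrier (grp M v)"
    if "v \<in> obj \<Lambda>" "x \<in> carrier (grp M v)" "y \<in> carrier (grp M v)" for v x y
  proof -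
    have "comm_group (grp M v)" using assms(2) that(1) by (simp add: right_module_def)
    then show ?thesis using that(2,3) by (intro monoid.m_closed group.is_monoid comm_group.axioms(2))
  qed
  have 2: "x \<otimes>\<^bsub>grp N v\<^esub> y \<in> carrier (grp N v)"
    if "v \<in> obj \<Lambda>" "x \<in> carrier (grp N v)" "y \<in> carrier (grp N v)" for v x y
  proof -
    have "comm_group (grp N v)" using assms(3) that(1) by (simp add: left_module_def)
    then show ?thesis using that(2,3) by (intro monoid.m_closed group.is_monoid comm_group.axioms(2))
  qed
  have 3: "act M \<mu> x \<in> carrier (grp M (src \<Lambda> \<mu>))"
    if "\<mu> \<in> mor \<Lambda>" "x \<in> carrier (grp M (rng \<Lambda> \<mu>))" for \<mu> x
    using assms(2) that by (auto simp: right_module_def hom_def)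
  have 4: "act N \<mu> x \<in> carrier (grp N (rng \<Lambda> \<mu>))"
    if "\<mu> \<in> mor \<Lambda>" "x \<in> carrier (grp N (src \<Lambda> \<mu>))" for \<mu> x
    using assms(3) that by (auto simp: left_module_def hom_def)
  have g: "frag_of (v, x, a) \<in> carrier ?G"
    if "v \<in> obj \<Lambda>" "x \<in> carrier (grp M v)" "a \<in> carrier (grp N v)" for v x a
    using that by (simp add: tensor_gens_def)
  have add: "p + q \<in> carrier ?G" if "p \<in> carrier ?G" "q \<in> carrier ?G" for p q
    using G.m_closed[OF that] by simp
  have minus: "p - q \<in> carrier ?G" if "p \<in> carrier ?G" "q \<in> carrier ?G" for p q
    using that keys_diff[of p q] by auto
  show ?thesis
    unfolding tensor_rels_def
  proof (intro Un_least subsetI; elim CollectE exE conjE; hypsubst)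
    fix v x y a
    assume "v \<in> obj \<Lambda>" "x \<in> carrier (grp M v)" "y \<in> carrier (grp M v)" "a \<in> carrier (grp N v)"
    then show "frag_of (v, x \<otimes>\<^bsub>grp M v\<^esub> y, a) - (frag_of (v, x, a) + frag_of (v, y, a)) \<in> carrier ?G"
      by (intro minus add g 1)
  next
    fix v x a b
    assume "v \<in> obj \<Lambda>" "x \<in> carrier (grp M v)" "a \<in> carrier (grp N v)" "b \<in> carrier (grp N v)"
    then show "frag_of (v, x, a \<otimes>\<^bsub>grp N v\<^esub> b) - (frag_of (v, x, a) + frag_of (v, x, b)) \<in> carrier ?G"
      by (intro minus add g 2)
  next
    fix \<mu> x a
    assume "\<mu> \<in> mor \<Lambda>" "x \<in> carrier (grp M (rng \<Lambda> \<mu>))" "a \<in> carrier (grp N (src \<Lambda> \<mu>))"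
    then show "frag_of (src \<Lambda> \<mu>, act M \<mu> x, a) - frag_of (rng \<Lambda> \<mu>, x, act N \<mu> a) \<in> carrier ?G"
      by (intro minus g 3 4 src_obj rng_obj)
  qed
qed

lemma tensor_map_class:
  assumes "small_category \<Lambda>" "right_module \<Lambda> M" "left_module \<Lambda> N"
    and M': "right_module \<Lambda> M'"
    and f: "f \<in> module_maps \<Lambda> M M'"
    and c: "c \<in> carrier (free_Abelian_group (tensor_gens \<Lambda> M N))"
  shows "tensor_map \<Lambda> M' N f (tensor_class \<Lambda> M N c)
    = tensor_class \<Lambda> M' N (frag_extend (\<lambda>(v, x, a). frag_of (v, f v x, a)) c)"
proof -
  interpret small_category \<Lambda> by fact
  let ?G = "free_Abelian_group (tensor_gens \<Lambda> M N)"
  let ?G' = "free_Abelian_group (tensor_gens \<Lambda> M' N)"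
  let ?\<phi> = "frag_extend (\<lambda>(v, x, a). frag_of (v, f v x, a))"
  interpret G: comm_group ?G by (rule abelian_free_Abelian_group)
  interpret G': comm_group ?G' by (rule abelian_free_Abelian_group)
  have fc: "f v x \<in> carrier (grp M' v)" if "v \<in> obj \<Lambda>" "x \<in> carrier (grp M v)" for v x
    using f that by (fastforce simp: module_maps_def hom_def)
  have fm: "f v (x \<otimes>\<^bsub>grp M v\<^esub> y) = f v x \<otimes>\<^bsub>grp M' v\<^esub> f v y"
    if "v \<in> obj \<Lambda>" "x \<in> carrier (grp M v)" "y \<in> carrier (grp M v)" for v x y
    using f that by (fastforce simp: module_maps_def hom_def)
  have fa: "f (src \<Lambda> \<mu>) (act M \<mu> x) = act M' \<mu> (f (rng \<Lambda> \<mu>) x)"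
    if "\<mu> \<in> mor \<Lambda>" "x \<in> carrier (grp M (rng \<Lambda> \<mu>))" for \<mu> x
    using f that by (simp add: module_maps_def)
  have hom: "?\<phi> \<in> hom ?G ?G'"
    by (rule frag_extend_hom) (auto simp: tensor_gens_def fc)
  interpret ph: group_hom ?G ?G' ?\<phi>
    using hom by unfold_locales
  have rels: "tensor_rels \<Lambda> M N \<subseteq> carrier ?G"
    using assms(1-3) by (rule tensor_rels_subset)
  have null: "subgroup (tensor_null \<Lambda> M N) ?G"
    unfolding tensor_null_def by (rule G.generate_is_subgroup[OF rels])
  have null': "subgroup (tensor_null \<Lambda> M' N) ?G'"
    unfolding tensor_null_def
    by (rule G'.generate_is_subgroup[OF tensor_rels_subset]) (use assms in auto)
  have rel_img: "?\<phi> ` tensor_rels \<Lambda> M N \<subseteq> tensor_rels \<Lambda> M' N"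
  proof (rule image_subsetI)
    fix z assume "z \<in> tensor_rels \<Lambda> M N"
    then consider
        (1) v x y a where "v \<in> obj \<Lambda>" "x \<in> carrier (grp M v)" "y \<in> carrier (grp M v)"
          "a \<in> carrier (grp N v)"
          "z = frag_of (v, x \<otimes>\<^bsub>grp M v\<^esub> y, a) - (frag_of (v, x, a) + frag_of (v, y, a))"
      | (2) v x a b where "v \<in> obj \<Lambda>" "x \<in> carrier (grp M v)" "a \<in> carrier (grp N v)"
          "b \<in> carrier (grp N v)"
          "z = frag_of (v, x, a \<otimes>\<^bsub>grp N v\<^esub> b) - (frag_of (v, x, a) + frag_of (v, x, b))"
      | (3) \<mu> x a where "\<mu> \<in> mor \<Lambda>" "x \<in> carrier (grp M (rng \<Lambda> \<mu>))"
          "a \<in> carrier (grp N (src \<Lambda> \<mu>))"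
          "z = frag_of (src \<Lambda> \<mu>, act M \<mu> x, a) - frag_of (rng \<Lambda> \<mu>, x, act N \<mu> a)"
      unfolding tensor_rels_def by blast
    then show "?\<phi> z \<in> tensor_rels \<Lambda> M' N"
    proof cases
      case 1
      then have "?\<phi> z = frag_of (v, f v x \<otimes>\<^bsub>grp M' v\<^esub> f v y, a) - (frag_of (v, f v x, a) + frag_of (v, f v y, a))"
        by (simp add: frag_extend_diff frag_extend_add fm)
      with 1 fc show ?thesis unfolding tensor_rels_def by blast
    next
      case 2
      then have "?\<phi> z = frag_of (v, f v x, a \<otimes>\<^bsub>grp N v\<^esub> b) - (frag_of (v, f v x, a) + frag_of (v, f v x, b))"
        by (simp add: frag_extend_diff frag_extend_add)
      with 2 fc show ?thesis unfolding tensor_rels_def by blast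
    next
      case 3
      then have "?\<phi> z = frag_of (src \<Lambda> \<mu>, act M' \<mu> (f (rng \<Lambda> \<mu>) x), a)
          - frag_of (rng \<Lambda> \<mu>, f (rng \<Lambda> \<mu>) x, act N \<mu> a)"
        by (simp add: frag_extend_diff fa)
      with 3 fc rng_obj show ?thesis unfolding tensor_rels_def by blast
    qed
  qed
  have rels': "?\<phi> ` tensor_rels \<Lambda> M N \<subseteq> carrier ?G'"
    using rels ph.hom_closed by blast
  have null_img: "?\<phi> ` tensor_null \<Lambda> M N \<subseteq> tensor_null \<Lambda> M' N"
    unfolding tensor_null_def ph.generate_img[OF rels, symmetric]
    by (rule G'.mono_generate[OF rel_img])
  have "tensor_class \<Lambda> M' N (?\<phi> z) = tensor_class \<Lambda> M' N (?\<phi> c)" if "z \<in> tensor_class \<Lambda> M N c" for z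
  proof -
    obtain r where r: "r \<in> tensor_null \<Lambda> M N" "z = r \<otimes>\<^bsub>?G\<^esub> c"
      using \<open>z \<in> tensor_class \<Lambda> M N c\<close> unfolding tensor_class_def r_coset_def by blast
    have rc: "r \<in> carrier ?G" using r null subgroup.subset by blast
    have "?\<phi> z = ?\<phi> r \<otimes>\<^bsub>?G'\<^esub> ?\<phi> c" using ph.hom_mult[OF rc c] r by simp
    moreover have m: "?\<phi> r \<in> tensor_null \<Lambda> M' N" using r null_img by blast
    moreover have "tensor_null \<Lambda> M' N #>\<^bsub>?G'\<^esub> (?\<phi> r \<otimes>\<^bsub>?G'\<^esub> ?\<phi> c) = tensor_null \<Lambda> M' N #>\<^bsub>?G'\<^esub> ?\<phi> c"
      using G'.coset_mult_assoc[OF subgroup.subset[OF null'] subgroup.mem_carrier[OF null' m] ph.hom_closed[OF c]]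
        subgroup.rcos_const[OF null' G'.is_group m] by simp
    ultimately show ?thesis by (simp add: tensor_class_def)
  qed
  moreover have "c \<in> tensor_class \<Lambda> M N c"
    unfolding tensor_class_def using c null by (rule G.rcos_self)
  ultimately show ?thesis
    unfolding tensor_map_def by (intro the_elem_image_unique) blast+
qed


section \<open>Categorical homology and cohomology\<close>

text \<open>The group \<open>ker g / im f\<close> of a sequence \<open>f : A \<rightarrow> B\<close>, \<open>g : B \<rightarrow> C\<close> with \<open>g \<circ> f = 0\<close>.\<close>

definition homology_at ::
    "'a monoid \<Rightarrow> ('a \<Rightarrow> 'b) \<Rightarrow> 'b monoid \<Rightarrow> ('b \<Rightarrow> 'c) \<Rightarrow> 'c monoid \<Rightarrow> 'b set monoid"
  where "homology_at A f B g C = B\<lparr>carrier := kernel B C g\<rparr> Mod (f ` carrier A)"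

text \<open>Both are relative to a projective resolution \<open>(R, bd)\<close> of the constant module.\<close>

fun cat_homology ::
    "('o, 'm) category \<Rightarrow> (nat \<Rightarrow> ('o, 'm, 'r) cat_module) \<Rightarrow> (nat \<Rightarrow> 'o \<Rightarrow> 'r \<Rightarrow> 'r)
      \<Rightarrow> ('o, 'm, 'b) cat_module \<Rightarrow> nat \<Rightarrow> (('o \<times> 'r \<times> 'b) \<Rightarrow>\<^sub>0 int) set set monoid"
  where
    "cat_homology \<Lambda> R bd N 0 =
      tensor \<Lambda> (R 0) N Mod (tensor_map \<Lambda> (R 0) N (bd 0) ` carrier (tensor \<Lambda> (R (Suc 0)) N))"
  | "cat_homology \<Lambda> R bd N (Suc n) =
      homology_at (tensor \<Lambda> (R (Suc (Suc n))) N) (tensor_map \<Lambda> (R (Suc n)) N (bd (Suc n)))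
        (tensor \<Lambda> (R (Suc n)) N) (tensor_map \<Lambda> (R n) N (bd n)) (tensor \<Lambda> (R n) N)"

fun cat_cohomology ::
    "('o, 'm) category \<Rightarrow> (nat \<Rightarrow> ('o, 'm, 'r) cat_module) \<Rightarrow> (nat \<Rightarrow> 'o \<Rightarrow> 'r \<Rightarrow> 'r)
      \<Rightarrow> ('o, 'm, 'b) cat_module \<Rightarrow> nat \<Rightarrow> ('o \<Rightarrow> 'r \<Rightarrow> 'b) set monoid"
  where
    "cat_cohomology \<Lambda> R bd M 0 =
      (Hom \<Lambda> (R 0) M)\<lparr>carrier :=
          kernel (Hom \<Lambda> (R 0) M) (Hom \<Lambda> (R (Suc 0)) M) (precomp \<Lambda> (R (Suc 0)) (bd 0))\<rparr>
        Mod {\<one>\<^bsub>Hom \<Lambda> (R 0) M\<^esub>}"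
  | "cat_cohomology \<Lambda> R bd M (Suc n) =
      homology_at (Hom \<Lambda> (R n) M) (precomp \<Lambda> (R (Suc n)) (bd n))
        (Hom \<Lambda> (R (Suc n)) M) (precomp \<Lambda> (R (Suc (Suc n))) (bd (Suc n)))
        (Hom \<Lambda> (R (Suc (Suc n))) M)"

end

theory Submission
  imports Defs "HOL.Modules"
begin

text \<open>The constant right module of a \<open>k\<close>-graph has a projective resolution that is zero above degree
  \<open>k\<close>, and homology and cohomology see a resolution only up to chain homotopy.

  The short resolution is cubical. Its \<open>n\<close>-chains at an object \<open>v\<close> are the formal sums of pairs
  \<open>(\<kappa>, I)\<close>, where \<open>\<kappa>\<close> is a morphism with source \<open>v\<close> and \<open>I\<close> a set of \<open>n\<close> colours that all occur in
  the degree of \<open>\<kappa>\<close>. By the factorization property \<open>\<kappa> = x\<lambda>\<close> for a unique \<open>x\<close> of degree \<open>\<Sum>i\<in>I. e\<^sub>i\<close>, so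
  \<open>(\<kappa>, I)\<close> is the translate by \<open>\<lambda>\<close> of the \<open>n\<close>-cube \<open>x\<close>; hence the cubical chains form a free
  module (\<open>projective_cube_module\<close>), and there are none for \<open>n > k\<close>, as there are only \<open>k\<close> colours.
  The boundary of \<open>(\<kappa>, I)\<close> is the alternating sum over \<open>i \<in> I\<close> of \<open>(\<kappa>, I - {i}) - (\<kappa>', I - {i})\<close>, where
  \<open>\<kappa>'\<close> arises from \<open>\<kappa>\<close> by removing an initial edge of colour \<open>i\<close>. In a single colour this is the chain
  complex of a path, contracted by joining \<open>\<kappa>\<close> to the morphism left after removing all edges of that
  colour; removals of different colours commute, so these contractions combine as in a tensor product
  of \<open>k\<close> complexes (\<open>homotopy_formula\<close>). All that survives is the identity of \<open>v\<close>, which says that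
  the cubical chains resolve the constant module (\<open>cube_resolution\<close>).

  Now let \<open>R\<close> be any projective resolution of the constant module. Lifting the identity of the constant
  module gives chain maps from \<open>R\<close> to the cubical resolution and back, whose composite is homotopic to
  the identity of \<open>R\<close> but vanishes above degree \<open>k\<close>. So there are module maps \<open>h\<close> with
  \<open>x = \<partial>(h x) + h(\<partial> x)\<close> in all degrees above \<open>k\<close> (\<open>contraction_above\<close>). This identity survives the
  additive functors \<open>- \<otimes> N\<close> and \<open>Hom(-, M)\<close>, and it makes every cycle and every cocycle in these degrees
  a boundary (\<open>homology_vanishes\<close>, \<open>cohomology_vanishes\<close>).\<close>

section \<open>Natural maps of right modules\<close>

text \<open>Module maps with arbitrary values off their domains: composites, products and inverses of such
  families are given by plain \<open>\<lambda>\<close>-terms, without restrictions.\<close>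

definition natural_hom ::
    "('o, 'm) category \<Rightarrow> ('o, 'm, 'a) cat_module \<Rightarrow> ('o, 'm, 'b) cat_module \<Rightarrow> ('o \<Rightarrow> 'a \<Rightarrow> 'b) \<Rightarrow> bool"
  where "natural_hom \<Lambda> M M' f \<longleftrightarrow>
    (\<forall>v\<in>obj \<Lambda>. f v \<in> hom (grp M v) (grp M' v)) \<and>
    (\<forall>\<kappa>\<in>mor \<Lambda>. \<forall>x\<in>carrier (grp M (rng \<Lambda> \<kappa>)).
        f (src \<Lambda> \<kappa>) (act M \<kappa> x) = act M' \<kappa> (f (rng \<Lambda> \<kappa>) x))"

lemma natural_homD:
  assumes "natural_hom \<Lambda> M M' f"
  shows "v \<in> obj \<Lambda> \<Longrightarrow> f v \<in> hom (grp M v) (grp M' v)"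
    and "\<lbrakk>v \<in> obj \<Lambda>; x \<in> carrier (grp M v)\<rbrakk> \<Longrightarrow> f v x \<in> carrier (grp M' v)"
    and "\<lbrakk>v \<in> obj \<Lambda>; x \<in> carrier (grp M v); y \<in> carrier (grp M v)\<rbrakk>
      \<Longrightarrow> f v (x \<otimes>\<^bsub>grp M v\<^esub> y) = f v x \<otimes>\<^bsub>grp M' v\<^esub> f v y"
    and "\<lbrakk>\<kappa> \<in> mor \<Lambda>; x \<in> carrier (grp M (rng \<Lambda> \<kappa>))\<rbrakk>
      \<Longrightarrow> f (src \<Lambda> \<kappa>) (act M \<kappa> x) = act M' \<kappa> (f (rng \<Lambda> \<kappa>) x)"
  using assms by (auto simp: natural_hom_def hom_def)

lemma module_maps_natural: "f \<in> module_maps \<Lambda> M M' \<Longrightarrow> natural_hom \<Lambda> M M' f"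
  by (auto simp: module_maps_def natural_hom_def)

lemma natural_module_maps:
  assumes "natural_hom \<Lambda> M M' f" "small_category \<Lambda>" "right_module \<Lambda> M"
  shows "(\<lambda>v\<in>obj \<Lambda>. \<lambda>x\<in>carrier (grp M v). f v x) \<in> module_maps \<Lambda> M M'"
  using assms by (intro module_mapsI) (auto simp: natural_hom_def)

lemma right_moduleD:
  assumes "right_module \<Lambda> M"
  shows "v \<in> obj \<Lambda> \<Longrightarrow> comm_group (grp M v)"
    and "v \<in> obj \<Lambda> \<Longrightarrow> group (grp M v)"
    and "\<kappa> \<in> mor \<Lambda> \<Longrightarrow> act M \<kappa> \<in> hom (grp M (rng \<Lambda> \<kappa>)) (grp M (src \<Lambda> \<kappa>))"
    and "\<lbrakk>\<kappa> \<in> mor \<Lambda>; x \<in> carrier (grp M (rng \<Lambda> \<kappa>))\<rbrakk> \<Longrightarrow> act M \<kappa> x \<in> carrier (grp M (src \<Lambda> \<kappa>))"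
    and "\<lbrakk>\<kappa> \<in> mor \<Lambda>; x \<in> carrier (grp M (rng \<Lambda> \<kappa>)); y \<in> carrier (grp M (rng \<Lambda> \<kappa>))\<rbrakk>
      \<Longrightarrow> act M \<kappa> (x \<otimes>\<^bsub>grp M (rng \<Lambda> \<kappa>)\<^esub> y) = act M \<kappa> x \<otimes>\<^bsub>grp M (src \<Lambda> \<kappa>)\<^esub> act M \<kappa> y"
    and "\<lbrakk>v \<in> obj \<Lambda>; x \<in> carrier (grp M v)\<rbrakk> \<Longrightarrow> act M (idn \<Lambda> v) x = x"
    and "\<lbrakk>\<mu> \<in> mor \<Lambda>; \<nu> \<in> mor \<Lambda>; src \<Lambda> \<mu> = rng \<Lambda> \<nu>; x \<in> carrier (grp M (rng \<Lambda> \<mu>))\<rbrakk>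
      \<Longrightarrow> act M (comp \<Lambda> \<mu> \<nu>) x = act M \<nu> (act M \<mu> x)"
  using assms by (auto simp: right_module_def hom_def comm_group.axioms)

lemma group_hom_natural:
  assumes "right_module \<Lambda> M" "right_module \<Lambda> M'" "natural_hom \<Lambda> M M' f" "v \<in> obj \<Lambda>"
  shows "group_hom (grp M v) (grp M' v) (f v)"
  using assms by (simp add: group_hom_def group_hom_axioms_def right_moduleD natural_homD(1))

lemma natural_hom_id: "right_module \<Lambda> M \<Longrightarrow> natural_hom \<Lambda> M M (\<lambda>v x. x)"
  by (auto simp: natural_hom_def hom_def)

lemma natural_hom_compose:
  assumes "small_category \<Lambda>" "natural_hom \<Lambda> A B f" "natural_hom \<Lambda> B C g"
  shows "natural_hom \<Lambda> A C (\<lambda>v x. g v (f v x))"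
proof -
  interpret small_category \<Lambda> by fact
  show ?thesis
    using assms(2,3) unfolding natural_hom_def by (auto simp: hom_def Pi_iff rng_obj)
qed

lemma natural_hom_mult:
  assumes "small_category \<Lambda>" and M': "right_module \<Lambda> M'"
    and f: "natural_hom \<Lambda> M M' f" and g: "natural_hom \<Lambda> M M' g"
  shows "natural_hom \<Lambda> M M' (\<lambda>v x. f v x \<otimes>\<^bsub>grp M' v\<^esub> g v x)"
  unfolding natural_hom_def
proof (intro conjI ballI)
  interpret small_category \<Lambda> by fact
  show "(\<lambda>x. f v x \<otimes>\<^bsub>grp M' v\<^esub> g v x) \<in> hom (grp M v) (grp M' v)" if "v \<in> obj \<Lambda>" for v
    using comm_group.hom_group_mult[OF right_moduleD(1)[OF M' that]] natural_homD(1)[OF f that]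
      natural_homD(1)[OF g that] by blast
  show "f (src \<Lambda> \<kappa>) (act M \<kappa> x) \<otimes>\<^bsub>grp M' (src \<Lambda> \<kappa>)\<^esub> g (src \<Lambda> \<kappa>) (act M \<kappa> x)
      = act M' \<kappa> (f (rng \<Lambda> \<kappa>) x \<otimes>\<^bsub>grp M' (rng \<Lambda> \<kappa>)\<^esub> g (rng \<Lambda> \<kappa>) x)"
    if "\<kappa> \<in> mor \<Lambda>" "x \<in> carrier (grp M (rng \<Lambda> \<kappa>))" for \<kappa> x
    using that by (simp add: right_moduleD(5)[OF M'] natural_homD[OF f] natural_homD[OF g] rng_obj)
qed

lemma natural_hom_inv:
  assumes "small_category \<Lambda>" and M': "right_module \<Lambda> M'" and f: "natural_hom \<Lambda> M M' f"
  shows "natural_hom \<Lambda> M M' (\<lambda>v x. inv\<^bsub>grp M' v\<^esub> f v x)"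
  unfolding natural_hom_def
proof (intro conjI ballI)
  interpret small_category \<Lambda> by fact
  show "(\<lambda>x. inv\<^bsub>grp M' v\<^esub> f v x) \<in> hom (grp M v) (grp M' v)" if "v \<in> obj \<Lambda>" for v
  proof -
    interpret comm_group "grp M' v" using right_moduleD(1)[OF M' that] .
    show ?thesis using natural_homD(2,3)[OF f that] by (auto simp: hom_def inv_mult)
  qed
  show "inv\<^bsub>grp M' (src \<Lambda> \<kappa>)\<^esub> f (src \<Lambda> \<kappa>) (act M \<kappa> x) = act M' \<kappa> (inv\<^bsub>grp M' (rng \<Lambda> \<kappa>)\<^esub> f (rng \<Lambda> \<kappa>) x)"
    if "\<kappa> \<in> mor \<Lambda>" "x \<in> carrier (grp M (rng \<Lambda> \<kappa>))" for \<kappa> x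
  proof -
    interpret group_hom "grp M' (rng \<Lambda> \<kappa>)" "grp M' (src \<Lambda> \<kappa>)" "act M' \<kappa>"
      using that by (simp add: group_hom_def group_hom_axioms_def right_moduleD[OF M'] rng_obj src_obj)
    show ?thesis using that by (simp add: natural_homD[OF f] rng_obj)
  qed
qed

text \<open>The projection to \<open>P\<close> of the pullback of \<open>a\<close> and \<open>b\<close> is surjective because \<open>a\<close> takes values in the
  image of \<open>b\<close>. It splits because \<open>P\<close> is projective, and the second component of a splitting is the lift.
  Surjectivity of \<open>b\<close> itself would be too much to ask: below, \<open>b\<close> is a boundary map.\<close>

lemma projective_lift:
  fixes P :: "('o, 'm, 'a) cat_module" and B :: "('o, 'm, 'b) cat_module"
    and C :: "('o, 'm, 'c) cat_module"
  assumes sc: "small_category \<Lambda>" and P: "projective \<Lambda> P"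
    and B: "right_module \<Lambda> B" and C: "right_module \<Lambda> C"
    and b: "natural_hom \<Lambda> B C b" and a: "natural_hom \<Lambda> P C a"
    and im: "\<And>v x. \<lbrakk>v \<in> obj \<Lambda>; x \<in> carrier (grp P v)\<rbrakk> \<Longrightarrow> a v x \<in> b v ` carrier (grp B v)"
  obtains l where "natural_hom \<Lambda> P B l"
    and "\<And>v x. \<lbrakk>v \<in> obj \<Lambda>; x \<in> carrier (grp P v)\<rbrakk> \<Longrightarrow> b v (l v x) = a v x"
proof -
  interpret small_category \<Lambda> by fact
  have PP: "right_module \<Lambda> P" using P by (simp add: projective_def)
  \<comment> \<open>the pullback module \<open>Q\<close>, with underlying sets \<open>S v\<close>\<close>
  define S where "S v = {z \<in> carrier (grp P v \<times>\<times> grp B v). a v (fst z) = b v (snd z)}" for v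
  define Q where "Q = \<lparr>grp = (\<lambda>v. (grp P v \<times>\<times> grp B v)\<lparr>carrier := S v\<rparr>),
    act = (\<lambda>\<kappa> z. (act P \<kappa> (fst z), act B \<kappa> (snd z)))\<rparr>"
  have car: "carrier (grp Q v) = S v" for v by (simp add: Q_def)
  have Scl: "fst z \<in> carrier (grp P v)" "snd z \<in> carrier (grp B v)" "a v (fst z) = b v (snd z)"
    if "z \<in> S v" for z v using that by (auto simp: S_def)
  have mult: "z \<otimes>\<^bsub>grp Q v\<^esub> w = (fst z \<otimes>\<^bsub>grp P v\<^esub> fst w, snd z \<otimes>\<^bsub>grp B v\<^esub> snd w)" for z w v
    by (cases z; cases w) (simp add: Q_def)
  have sub: "subgroup (S v) (grp P v \<times>\<times> grp B v)" if v: "v \<in> obj \<Lambda>" for v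
  proof -
    interpret p: group_hom "grp P v" "grp C v" "a v" using group_hom_natural[OF PP C a v] .
    interpret q: group_hom "grp B v" "grp C v" "b v" using group_hom_natural[OF B C b v] .
    interpret D: group "grp P v \<times>\<times> grp B v"
      by (simp add: DirProd_group p.G.is_group q.G.is_group)
    have "(\<one>\<^bsub>grp P v\<^esub>, \<one>\<^bsub>grp B v\<^esub>) \<in> S v" by (simp add: S_def)
    then show ?thesis
    proof (intro D.subgroupI)
      show "S v \<noteq> {}" using \<open>_ \<in> S v\<close> by blast
    qed (auto simp: S_def inv_DirProd)
  qed
  have Q: "right_module \<Lambda> Q"
    unfolding right_module_def
  proof (intro conjI ballI impI)
    fix v assume v: "v \<in> obj \<Lambda>"
    interpret p: comm_group "grp P v" using right_moduleD(1)[OF PP v] .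
    interpret q: comm_group "grp B v" using right_moduleD(1)[OF B v] .
    interpret D: group "grp P v \<times>\<times> grp B v"
      by (simp add: DirProd_group p.is_group q.is_group)
    interpret Q: group "grp Q v"
      using subgroup.subgroup_is_group[OF sub[OF v]] D.is_group by (simp add: Q_def)
    show "comm_group (grp Q v)"
      by (rule Q.group_comm_groupI) (auto simp: mult car S_def intro: p.m_comm q.m_comm)
  next
    fix \<kappa> assume k: "\<kappa> \<in> mor \<Lambda>"
    then show "act Q \<kappa> \<in> hom (grp Q (rng \<Lambda> \<kappa>)) (grp Q (src \<Lambda> \<kappa>))"
      using right_moduleD(4,5)[OF PP k] right_moduleD(4,5)[OF B k] natural_homD(4)[OF a k] natural_homD(4)[OF b k]
      by (auto simp: hom_def mult) (auto simp: Q_def S_def)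
  qed (auto simp: Q_def S_def right_moduleD(6)[OF PP] right_moduleD(6)[OF B] right_moduleD(7)[OF PP] right_moduleD(7)[OF B])
  define f where "f = (\<lambda>v\<in>obj \<Lambda>. \<lambda>z\<in>carrier (grp Q v). fst z)"
  have "natural_hom \<Lambda> Q P (\<lambda>v z. fst z)"
    unfolding natural_hom_def by (auto simp: hom_def mult car Scl) (simp add: Q_def)
  then have f: "f \<in> module_maps \<Lambda> Q P"
    unfolding f_def using sc Q by (rule natural_module_maps)
  have "module_surjective \<Lambda> Q P f"
    unfolding module_surjective_def
  proof (intro ballI equalityI subsetI)
    fix v x assume v: "v \<in> obj \<Lambda>" and x: "x \<in> carrier (grp P v)"
    then obtain y where "y \<in> carrier (grp B v)" "a v x = b v y" using im[OF v x] by auto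
    then have "(x, y) \<in> S v" using x by (simp add: S_def)
    then show "x \<in> f v ` carrier (grp Q v)" using v by (force simp: f_def car)
  qed (auto simp: f_def car S_def)
  then obtain g where g: "g \<in> module_maps \<Lambda> P Q"
    and fg: "\<And>v x. \<lbrakk>v \<in> obj \<Lambda>; x \<in> carrier (grp P v)\<rbrakk> \<Longrightarrow> f v (g v x) = x"
    using projective_epis_split[OF sc P] Q f unfolding epis_split_def by blast
  have gS: "g v x \<in> S v" if "v \<in> obj \<Lambda>" "x \<in> carrier (grp P v)" for v x
    using natural_homD(2)[OF module_maps_natural[OF g] that] by (simp add: car)
  have "natural_hom \<Lambda> Q B (\<lambda>v z. snd z)"
    unfolding natural_hom_def by (auto simp: hom_def mult car Scl) (simp add: Q_def)
  then have "natural_hom \<Lambda> P B (\<lambda>v x. snd (g v x))"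
    using natural_hom_compose[OF sc module_maps_natural[OF g]] by blast
  moreover have "b v (snd (g v x)) = a v x" if "v \<in> obj \<Lambda>" "x \<in> carrier (grp P v)" for v x
    using fg[OF that] Scl[OF gS[OF that]] gS[OF that] that by (simp add: f_def car)
  ultimately show thesis using that by blast
qed

section \<open>Comparison of resolutions\<close>

text \<open>The augmentation counts as the boundary map out of degree \<open>0\<close>, so that exactness reads the same in
  all degrees.\<close>

definition cycles ::
    "('o, 'm) category \<Rightarrow> (nat \<Rightarrow> ('o, 'm, 'r) cat_module) \<Rightarrow> (nat \<Rightarrow> 'o \<Rightarrow> 'r \<Rightarrow> 'r)
      \<Rightarrow> ('o \<Rightarrow> 'r \<Rightarrow> 'b) \<Rightarrow> ('o, 'm, 'b) cat_module \<Rightarrow> nat \<Rightarrow> 'o \<Rightarrow> 'r set"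
  where "cycles \<Lambda> R bd \<epsilon> M n v = (case n of
      0 \<Rightarrow> kernel (grp (R 0) v) (grp M v) (\<epsilon> v)
    | Suc m \<Rightarrow> kernel (grp (R (Suc m)) v) (grp (R m) v) (bd m v))"

lemma projective_resolutionD:
  assumes "projective_resolution \<Lambda> R bd \<epsilon> M"
  shows "projective \<Lambda> (R n)" "right_module \<Lambda> (R n)"
    and "natural_hom \<Lambda> (R (Suc n)) (R n) (bd n)" "natural_hom \<Lambda> (R 0) M \<epsilon>"
    and "v \<in> obj \<Lambda> \<Longrightarrow> bd n v ` carrier (grp (R (Suc n)) v) = cycles \<Lambda> R bd \<epsilon> M n v"
    and "v \<in> obj \<Lambda> \<Longrightarrow> \<epsilon> v ` carrier (grp (R 0) v) = carrier (grp M v)"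
  using assms unfolding projective_resolution_def projective_def
  by (auto simp: module_surjective_def cycles_def split: nat.split intro: module_maps_natural)

lemma boundary_is_cycle:
  assumes R: "projective_resolution \<Lambda> R bd \<epsilon> M" and "v \<in> obj \<Lambda>" "x \<in> carrier (grp (R (Suc n)) v)"
  shows "bd n v x \<in> cycles \<Lambda> R bd \<epsilon> M n v"
  using projective_resolutionD(5)[OF R assms(2), of n] assms(3) by blast

lemma boundary_boundary:
  assumes R: "projective_resolution \<Lambda> R bd \<epsilon> M" and "v \<in> obj \<Lambda>"
    and "x \<in> carrier (grp (R (Suc (Suc n))) v)"
  shows "bd n v (bd (Suc n) v x) = \<one>\<^bsub>grp (R n) v\<^esub>"
  using boundary_is_cycle[OF assms] by (simp add: cycles_def kernel_def)

text \<open>Each \<open>f (n + 1)\<close> is a lift of \<open>f n \<circ> bd n\<close> through \<open>bd' n\<close>. By exactness of \<open>P\<close> it exists if \<open>f n \<circ> bd n\<close>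
  takes values in the cycles, so the recursion has to carry along that \<open>f n\<close> maps cycles to cycles.\<close>

lemma comparison_map:
  fixes R :: "nat \<Rightarrow> ('o, 'm, 'r) cat_module" and P :: "nat \<Rightarrow> ('o, 'm, 'p) cat_module"
    and M :: "('o, 'm, 'b) cat_module"
  assumes sc: "small_category \<Lambda>" and M: "right_module \<Lambda> M"
    and R: "projective_resolution \<Lambda> R bd \<epsilon> M" and P: "projective_resolution \<Lambda> P bd' \<epsilon>' M"
  obtains f where "\<And>n. natural_hom \<Lambda> (R n) (P n) (f n)"
    and "\<And>v x. \<lbrakk>v \<in> obj \<Lambda>; x \<in> carrier (grp (R 0) v)\<rbrakk> \<Longrightarrow> \<epsilon>' v (f 0 v x) = \<epsilon> v x"
    and "\<And>n v x. \<lbrakk>v \<in> obj \<Lambda>; x \<in> carrier (grp (R (Suc n)) v)\<rbrakk>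
      \<Longrightarrow> bd' n v (f (Suc n) v x) = f n v (bd n v x)"
proof -
  let ?Z = "cycles \<Lambda> R bd \<epsilon> M" and ?Z' = "cycles \<Lambda> P bd' \<epsilon>' M"
  note Rm = projective_resolutionD(2)[OF R] and Pm = projective_resolutionD(2)[OF P]
  note RD = natural_homD[OF projective_resolutionD(3)[OF R]]
  note PD = natural_homD[OF projective_resolutionD(3)[OF P]]
  define good where "good n f \<longleftrightarrow> natural_hom \<Lambda> (R n) (P n) f \<and>
      (\<forall>v\<in>obj \<Lambda>. f v ` ?Z n v \<subseteq> ?Z' n v) \<and>
      (n = 0 \<longrightarrow> (\<forall>v\<in>obj \<Lambda>. \<forall>x\<in>carrier (grp (R 0) v). \<epsilon>' v (f v x) = \<epsilon> v x))" for n f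
  define step where "step n f f' \<longleftrightarrow>
      (\<forall>v\<in>obj \<Lambda>. \<forall>x\<in>carrier (grp (R (Suc n)) v). bd' n v (f' v x) = f v (bd n v x))" for n f f'
  have "\<exists>f. \<forall>n. good n (f n) \<and> step n (f n) (f (Suc n))"
  proof (rule dependent_nat_choice)
    obtain l where l: "natural_hom \<Lambda> (R 0) (P 0) l"
      and le: "\<And>v x. \<lbrakk>v \<in> obj \<Lambda>; x \<in> carrier (grp (R 0) v)\<rbrakk> \<Longrightarrow> \<epsilon>' v (l v x) = \<epsilon> v x"
    proof (rule projective_lift[OF sc projective_resolutionD(1)[OF R] Pm M
          projective_resolutionD(4)[OF P] projective_resolutionD(4)[OF R]])
      show "\<epsilon> v x \<in> \<epsilon>' v ` carrier (grp (P 0) v)" if "v \<in> obj \<Lambda>" "x \<in> carrier (grp (R 0) v)" for v x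
        using projective_resolutionD(6)[OF P] natural_homD(2)[OF projective_resolutionD(4)[OF R]] that
        by simp
    qed blast
    have "good 0 l"
      unfolding good_def using l le natural_homD(2)[OF l] by (auto simp: cycles_def kernel_def)
    then show "\<exists>f. good 0 f" by blast
  next
    fix f n assume g: "good n f"
    then have f: "natural_hom \<Lambda> (R n) (P n) f" by (simp add: good_def)
    obtain l where l: "natural_hom \<Lambda> (R (Suc n)) (P (Suc n)) l"
      and lb: "\<And>v x. \<lbrakk>v \<in> obj \<Lambda>; x \<in> carrier (grp (R (Suc n)) v)\<rbrakk> \<Longrightarrow> bd' n v (l v x) = f v (bd n v x)"
    proof (rule projective_lift[OF sc projective_resolutionD(1)[OF R] Pm Pm
          projective_resolutionD(3)[OF P] natural_hom_compose[OF sc projective_resolutionD(3)[OF R] f]])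
      fix v x assume v: "v \<in> obj \<Lambda>" and x: "x \<in> carrier (grp (R (Suc n)) v)"
      have "f v (bd n v x) \<in> ?Z' n v"
        using boundary_is_cycle[OF R v x] g v by (auto simp: good_def)
      then show "f v (bd n v x) \<in> bd' n v ` carrier (grp (P (Suc n)) v)"
        using projective_resolutionD(5)[OF P v] by simp
    qed blast
    have "l v x \<in> ?Z' (Suc n) v" if v: "v \<in> obj \<Lambda>" and x: "x \<in> ?Z (Suc n) v" for v x
    proof -
      have "x \<in> carrier (grp (R (Suc n)) v)" "bd n v x = \<one>\<^bsub>grp (R n) v\<^esub>"
        using x by (auto simp: cycles_def kernel_def)
      then show ?thesis
        using natural_homD(2)[OF l v] lb[OF v] group_hom.hom_one[OF group_hom_natural[OF Rm Pm f v]]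
        by (simp add: cycles_def kernel_def)
    qed
    then have "good (Suc n) l" using l by (auto simp: good_def)
    with lb show "\<exists>l. good (Suc n) l \<and> step n f l" unfolding step_def by blast
  qed
  then obtain f where fg: "\<And>n. good n (f n)"
    and fb: "\<And>n v x. \<lbrakk>v \<in> obj \<Lambda>; x \<in> carrier (grp (R (Suc n)) v)\<rbrakk>
      \<Longrightarrow> bd' n v (f (Suc n) v x) = f n v (bd n v x)"
    unfolding step_def by blast
  have "natural_hom \<Lambda> (R n) (P n) (f n)" for n using fg[of n] by (simp add: good_def)
  moreover have "\<epsilon>' v (f 0 v x) = \<epsilon> v x" if "v \<in> obj \<Lambda>" "x \<in> carrier (grp (R 0) v)" for v x
    using fg[of 0] that by (simp add: good_def)
  ultimately show thesis using fb by (rule that)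
qed

text \<open>In additive notation and with \<open>e = id - f\<close>, the map \<open>h (n + 1)\<close> is a lift of \<open>e (n + 1) - h n \<circ> bd n\<close>
  through \<open>bd (n + 1)\<close>. The map to be lifted takes values in the cycles, because \<open>bd n \<circ> h n = e n\<close> holds on boundaries;
  this equation on cycles is what the recursion carries along.\<close>

lemma homotopy_to_identity:
  fixes R :: "nat \<Rightarrow> ('o, 'm, 'r) cat_module" and M :: "('o, 'm, 'b) cat_module"
  assumes sc: "small_category \<Lambda>" and M: "right_module \<Lambda> M"
    and R: "projective_resolution \<Lambda> R bd \<epsilon> M"
    and f: "\<And>n. natural_hom \<Lambda> (R n) (R n) (f n)"
    and f0: "\<And>v x. \<lbrakk>v \<in> obj \<Lambda>; x \<in> carrier (grp (R 0) v)\<rbrakk> \<Longrightarrow> \<epsilon> v (f 0 v x) = \<epsilon> v x"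
    and fb: "\<And>n v x. \<lbrakk>v \<in> obj \<Lambda>; x \<in> carrier (grp (R (Suc n)) v)\<rbrakk>
      \<Longrightarrow> bd n v (f (Suc n) v x) = f n v (bd n v x)"
  obtains h where "\<And>n. natural_hom \<Lambda> (R n) (R (Suc n)) (h n)"
    and "\<And>n v x. \<lbrakk>v \<in> obj \<Lambda>; x \<in> carrier (grp (R (Suc n)) v)\<rbrakk>
      \<Longrightarrow> bd (Suc n) v (h (Suc n) v x)
        = x \<otimes>\<^bsub>grp (R (Suc n)) v\<^esub> inv\<^bsub>grp (R (Suc n)) v\<^esub> f (Suc n) v x
            \<otimes>\<^bsub>grp (R (Suc n)) v\<^esub> inv\<^bsub>grp (R (Suc n)) v\<^esub> h n v (bd n v x)"
proof -
  let ?Z = "cycles \<Lambda> R bd \<epsilon> M"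
  note Rm = projective_resolutionD(2)[OF R] and Rp = projective_resolutionD(1)[OF R]
  note bd = projective_resolutionD(3)[OF R] and eps = projective_resolutionD(4)[OF R]
  define e where "e n v x = x \<otimes>\<^bsub>grp (R n) v\<^esub> inv\<^bsub>grp (R n) v\<^esub> f n v x" for n v x
  have e: "natural_hom \<Lambda> (R n) (R n) (e n)" for n
    unfolding e_def by (intro natural_hom_mult natural_hom_inv natural_hom_id sc Rm f)
  define good where "good n h \<longleftrightarrow> natural_hom \<Lambda> (R n) (R (Suc n)) h \<and>
      (\<forall>v\<in>obj \<Lambda>. \<forall>x\<in>?Z n v. bd n v (h v x) = e n v x)" for n h
  define step where "step n h h' \<longleftrightarrow> (\<forall>v\<in>obj \<Lambda>. \<forall>x\<in>carrier (grp (R (Suc n)) v).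
      bd (Suc n) v (h' v x)
        = e (Suc n) v x \<otimes>\<^bsub>grp (R (Suc n)) v\<^esub> inv\<^bsub>grp (R (Suc n)) v\<^esub> h v (bd n v x))" for n h h'
  have "\<exists>h. \<forall>n. good n (h n) \<and> step n (h n) (h (Suc n))"
  proof (rule dependent_nat_choice)
    obtain l where l: "natural_hom \<Lambda> (R 0) (R (Suc 0)) l"
      and le: "\<And>v x. \<lbrakk>v \<in> obj \<Lambda>; x \<in> carrier (grp (R 0) v)\<rbrakk> \<Longrightarrow> bd 0 v (l v x) = e 0 v x"
    proof (rule projective_lift[OF sc Rp Rm Rm bd e])
      fix v x assume v: "v \<in> obj \<Lambda>" and x: "x \<in> carrier (grp (R 0) v)"
      interpret \<epsilon>: group_hom "grp (R 0) v" "grp M v" "\<epsilon> v" using group_hom_natural[OF Rm M eps v] .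
      have "\<epsilon> v (e 0 v x) = \<one>\<^bsub>grp M v\<^esub>"
        using x f0[OF v x] natural_homD(2)[OF f v x] by (simp add: e_def)
      then show "e 0 v x \<in> bd 0 v ` carrier (grp (R (Suc 0)) v)"
        using projective_resolutionD(5)[OF R v] natural_homD(2)[OF e v x]
        by (simp add: cycles_def kernel_def)
    qed blast
    then have "good 0 l" by (auto simp: good_def cycles_def kernel_def)
    then show "\<exists>l. good 0 l" by blast
  next
    fix h n assume g: "good n h"
    then have h: "natural_hom \<Lambda> (R n) (R (Suc n)) h" by (simp add: good_def)
    let ?a = "\<lambda>v x. e (Suc n) v x \<otimes>\<^bsub>grp (R (Suc n)) v\<^esub> inv\<^bsub>grp (R (Suc n)) v\<^esub> h v (bd n v x)"
    have a: "natural_hom \<Lambda> (R (Suc n)) (R (Suc n)) ?a"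
      by (intro natural_hom_mult natural_hom_inv sc Rm e natural_hom_compose[OF sc bd h])
    obtain l where l: "natural_hom \<Lambda> (R (Suc n)) (R (Suc (Suc n))) l"
      and lb: "\<And>v x. \<lbrakk>v \<in> obj \<Lambda>; x \<in> carrier (grp (R (Suc n)) v)\<rbrakk> \<Longrightarrow> bd (Suc n) v (l v x) = ?a v x"
    proof (rule projective_lift[OF sc Rp Rm Rm bd a])
      fix v x assume v: "v \<in> obj \<Lambda>" and x: "x \<in> carrier (grp (R (Suc n)) v)"
      interpret b: group_hom "grp (R (Suc n)) v" "grp (R n) v" "bd n v"
        using group_hom_natural[OF Rm Rm bd v] .
      note cl = natural_homD(2)[OF bd v x]
      note cl2 = natural_homD(2)[OF f v x] natural_homD(2)[OF f v cl] natural_homD(2)[OF h v cl]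
      have 1: "bd n v (h v (bd n v x)) = e n v (bd n v x)"
        using g boundary_is_cycle[OF R v x] v by (simp add: good_def)
      have "bd n v (?a v x) = \<one>\<^bsub>grp (R n) v\<^esub>"
        using x cl cl2 by (simp add: 1 e_def fb[OF v x])
      then show "?a v x \<in> bd (Suc n) v ` carrier (grp (R (Suc (Suc n))) v)"
        using projective_resolutionD(5)[OF R v] natural_homD(2)[OF a v x]
        by (simp add: cycles_def kernel_def)
    qed blast
    have "bd (Suc n) v (l v x) = e (Suc n) v x" if v: "v \<in> obj \<Lambda>" and x: "x \<in> ?Z (Suc n) v" for v x
    proof -
      interpret h: group_hom "grp (R n) v" "grp (R (Suc n)) v" "h v"
        using group_hom_natural[OF Rm Rm h v] .
      have "x \<in> carrier (grp (R (Suc n)) v)" "bd n v x = \<one>\<^bsub>grp (R n) v\<^esub>"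
        using x by (auto simp: cycles_def kernel_def)
      then show ?thesis using lb[OF v] natural_homD(2)[OF e v] by simp
    qed
    then have "good (Suc n) l" using l by (auto simp: good_def)
    with lb show "\<exists>l. good (Suc n) l \<and> step n h l" unfolding step_def by blast
  qed
  then obtain h where hg: "\<And>n. good n (h n)"
    and hb: "\<And>n v x. \<lbrakk>v \<in> obj \<Lambda>; x \<in> carrier (grp (R (Suc n)) v)\<rbrakk>
      \<Longrightarrow> bd (Suc n) v (h (Suc n) v x)
        = e (Suc n) v x \<otimes>\<^bsub>grp (R (Suc n)) v\<^esub> inv\<^bsub>grp (R (Suc n)) v\<^esub> h n v (bd n v x)"
    unfolding step_def by blast
  have "natural_hom \<Lambda> (R n) (R (Suc n)) (h n)" for n using hg[of n] by (simp add: good_def)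
  then show thesis using hb unfolding e_def by (rule that)
qed

text \<open>The composite \<open>g \<circ> f\<close> of comparison maps from \<open>R\<close> to \<open>P\<close> and back is homotopic to the identity, and in the
  degrees where \<open>P\<close> is zero the homotopy formula loses its term \<open>g \<circ> f\<close>.\<close>

lemma contraction_above:
  fixes R :: "nat \<Rightarrow> ('o, 'm, 'r) cat_module" and P :: "nat \<Rightarrow> ('o, 'm, 'p) cat_module"
    and M :: "('o, 'm, 'b) cat_module"
  assumes sc: "small_category \<Lambda>" and M: "right_module \<Lambda> M"
    and R: "projective_resolution \<Lambda> R bd \<epsilon> M" and P: "projective_resolution \<Lambda> P bd' \<epsilon>' M"
    and k: "\<And>n v. \<lbrakk>k < n; v \<in> obj \<Lambda>\<rbrakk> \<Longrightarrow> carrier (grp (P n) v) = {\<one>\<^bsub>grp (P n) v\<^esub>}"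
  obtains h where "\<And>n. natural_hom \<Lambda> (R n) (R (Suc n)) (h n)"
    and "\<And>n v x. \<lbrakk>k < Suc n; v \<in> obj \<Lambda>; x \<in> carrier (grp (R (Suc n)) v)\<rbrakk>
      \<Longrightarrow> bd (Suc n) v (h (Suc n) v x) \<otimes>\<^bsub>grp (R (Suc n)) v\<^esub> h n v (bd n v x) = x"
proof -
  note Rm = projective_resolutionD(2)[OF R] and Pm = projective_resolutionD(2)[OF P]
  note bd = projective_resolutionD(3)[OF R]
  obtain f where f: "\<And>n. natural_hom \<Lambda> (R n) (P n) (f n)"
    and f0: "\<And>v x. \<lbrakk>v \<in> obj \<Lambda>; x \<in> carrier (grp (R 0) v)\<rbrakk> \<Longrightarrow> \<epsilon>' v (f 0 v x) = \<epsilon> v x"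
    and fb: "\<And>n v x. \<lbrakk>v \<in> obj \<Lambda>; x \<in> carrier (grp (R (Suc n)) v)\<rbrakk>
      \<Longrightarrow> bd' n v (f (Suc n) v x) = f n v (bd n v x)"
    using comparison_map[OF sc M R P] by blast
  obtain g where g: "\<And>n. natural_hom \<Lambda> (P n) (R n) (g n)"
    and g0: "\<And>v x. \<lbrakk>v \<in> obj \<Lambda>; x \<in> carrier (grp (P 0) v)\<rbrakk> \<Longrightarrow> \<epsilon> v (g 0 v x) = \<epsilon>' v x"
    and gb: "\<And>n v x. \<lbrakk>v \<in> obj \<Lambda>; x \<in> carrier (grp (P (Suc n)) v)\<rbrakk>
      \<Longrightarrow> bd n v (g (Suc n) v x) = g n v (bd' n v x)"
    using comparison_map[OF sc M P R] by blast
  have gf: "natural_hom \<Lambda> (R n) (R n) (\<lambda>v x. g n v (f n v x))" for n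
    using natural_hom_compose[OF sc f g] .
  obtain h where h: "\<And>n. natural_hom \<Lambda> (R n) (R (Suc n)) (h n)"
    and hb: "\<And>n v x. \<lbrakk>v \<in> obj \<Lambda>; x \<in> carrier (grp (R (Suc n)) v)\<rbrakk>
      \<Longrightarrow> bd (Suc n) v (h (Suc n) v x)
        = x \<otimes>\<^bsub>grp (R (Suc n)) v\<^esub> inv\<^bsub>grp (R (Suc n)) v\<^esub> g (Suc n) v (f (Suc n) v x)
            \<otimes>\<^bsub>grp (R (Suc n)) v\<^esub> inv\<^bsub>grp (R (Suc n)) v\<^esub> h n v (bd n v x)"
    using homotopy_to_identity[OF sc M R gf] f0 fb g0 gb natural_homD(2)[OF f] by metis
  have "bd (Suc n) v (h (Suc n) v x) \<otimes>\<^bsub>grp (R (Suc n)) v\<^esub> h n v (bd n v x) = x"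
    if n: "k < Suc n" and v: "v \<in> obj \<Lambda>" and x: "x \<in> carrier (grp (R (Suc n)) v)" for n v x
  proof -
    interpret g: group_hom "grp (P (Suc n)) v" "grp (R (Suc n)) v" "g (Suc n) v"
      using group_hom_natural[OF Pm Rm g v] .
    have "f (Suc n) v x = \<one>\<^bsub>grp (P (Suc n)) v\<^esub>"
      using natural_homD(2)[OF f v x] k[OF n v] by simp
    moreover have "h n v (bd n v x) \<in> carrier (grp (R (Suc n)) v)"
      using natural_homD(2)[OF h v] natural_homD(2)[OF bd v x] by blast
    ultimately show ?thesis using hb[OF v x] x by (simp add: g.H.m_assoc)
  qed
  with h show thesis by (rule that)
qed

section \<open>Vanishing of homology and cohomology\<close>

lemma trivial_homology_at:
  assumes "group B" "group C" "g \<in> hom B C" "f ` carrier A = kernel B C g"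
  shows "trivial_group (homology_at A f B g C)"
proof -
  let ?H = "kernel B C g" and ?K = "B\<lparr>carrier := kernel B C g\<rparr>"
  interpret g: group_hom B C g using assms(1-3) by (simp add: group_hom_def group_hom_axioms_def)
  interpret K: group ?K
    using subgroup.subgroup_is_group[OF g.subgroup_kernel assms(1)] .
  have "carrier ?K \<lhd> ?K"
    by (rule K.normal_invI[OF K.subgroup_self]) (intro K.m_closed K.inv_closed)
  then have "?H \<lhd> ?K" by simp
  then have "group (?K Mod ?H)" by (rule normal.factorgroup_is_group)
  moreover have "?H #>\<^bsub>?K\<^esub> x = ?H" if "x \<in> ?H" for x
    using K.coset_join2[OF _ K.subgroup_self] that by simp
  then have "carrier (?K Mod ?H) = {?H}"
    using K.one_closed by (force simp: FactGroup_def RCOSETS_def)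
  ultimately show ?thesis
    unfolding homology_at_def assms(4) by (simp add: group.trivial_group)
qed

lemma tensor_null_subgroup:
  assumes "small_category \<Lambda>" "right_module \<Lambda> M" "left_module \<Lambda> N"
  shows "subgroup (tensor_null \<Lambda> M N) (free_Abelian_group (tensor_gens \<Lambda> M N))"
  unfolding tensor_null_def
  by (rule group.generate_is_subgroup[OF group_free_Abelian_group tensor_rels_subset[OF assms]])

lemma tensor_null_normal:
  assumes "small_category \<Lambda>" "right_module \<Lambda> M" "left_module \<Lambda> N"
  shows "tensor_null \<Lambda> M N \<lhd> free_Abelian_group (tensor_gens \<Lambda> M N)"
  using comm_group.subgroup_imp_normal[OF abelian_free_Abelian_group tensor_null_subgroup[OF assms]] .

lemma comm_group_tensor:
  assumes "small_category \<Lambda>" "right_module \<Lambda> M" "left_module \<Lambda> N"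
  shows "comm_group (tensor \<Lambda> M N)"
  unfolding tensor_def
  using comm_group.abelian_FactGroup[OF abelian_free_Abelian_group tensor_null_subgroup[OF assms]] .

lemma tensor_class_hom:
  assumes "small_category \<Lambda>" "right_module \<Lambda> M" "left_module \<Lambda> N"
  shows "tensor_class \<Lambda> M N \<in> hom (free_Abelian_group (tensor_gens \<Lambda> M N)) (tensor \<Lambda> M N)"
  using normal.r_coset_hom_Mod[OF tensor_null_normal[OF assms]]
  by (simp add: tensor_class_def[abs_def] tensor_def)

lemma carrier_tensor:
  "carrier (tensor \<Lambda> M N) = tensor_class \<Lambda> M N ` carrier (free_Abelian_group (tensor_gens \<Lambda> M N))"
  by (auto simp: tensor_def FactGroup_def RCOSETS_def tensor_class_def)

lemma tensor_class_rel:
  assumes "small_category \<Lambda>" "right_module \<Lambda> M" "left_module \<Lambda> N"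
    and p: "p \<in> carrier (free_Abelian_group (tensor_gens \<Lambda> M N))"
    and q: "q \<in> carrier (free_Abelian_group (tensor_gens \<Lambda> M N))"
    and r: "p - q \<in> tensor_rels \<Lambda> M N"
  shows "tensor_class \<Lambda> M N p = tensor_class \<Lambda> M N q"
proof -
  let ?G = "free_Abelian_group (tensor_gens \<Lambda> M N)"
  interpret G: group ?G by simp
  note S = tensor_null_subgroup[OF assms(1-3)]
  have "p - q \<in> tensor_null \<Lambda> M N"
    unfolding tensor_null_def using r by (rule generate.incl)
  then have "(p - q) \<otimes>\<^bsub>?G\<^esub> q \<in> tensor_null \<Lambda> M N #>\<^bsub>?G\<^esub> q"
    unfolding r_coset_def by blast
  then show ?thesis
    unfolding tensor_class_def using G.repr_independence[OF _ _ S] q by simp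
qed

lemma tensor_class_add:
  assumes "small_category \<Lambda>" and M: "right_module \<Lambda> M" and N: "left_module \<Lambda> N"
    and "v \<in> obj \<Lambda>" "x \<in> carrier (grp M v)" "y \<in> carrier (grp M v)" "a \<in> carrier (grp N v)"
  shows "tensor_class \<Lambda> M N (frag_of (v, x, a)) \<otimes>\<^bsub>tensor \<Lambda> M N\<^esub> tensor_class \<Lambda> M N (frag_of (v, y, a))
    = tensor_class \<Lambda> M N (frag_of (v, x \<otimes>\<^bsub>grp M v\<^esub> y, a))"
proof -
  let ?G = "free_Abelian_group (tensor_gens \<Lambda> M N)"
  interpret M: group "grp M v" using right_moduleD(2)[OF M] assms(4) .
  have g: "frag_of (v, x, a) \<in> carrier ?G" "frag_of (v, y, a) \<in> carrier ?G"
      "frag_of (v, x \<otimes>\<^bsub>grp M v\<^esub> y, a) \<in> carrier ?G"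
    using assms(4-) by (simp_all add: tensor_gens_def)
  have "tensor_class \<Lambda> M N (frag_of (v, x \<otimes>\<^bsub>grp M v\<^esub> y, a))
      = tensor_class \<Lambda> M N (frag_of (v, x, a) \<otimes>\<^bsub>?G\<^esub> frag_of (v, y, a))"
  proof (rule tensor_class_rel[OF assms(1-3) g(3)])
    show "frag_of (v, x, a) \<otimes>\<^bsub>?G\<^esub> frag_of (v, y, a) \<in> carrier ?G"
      using g by (intro monoid.m_closed group.is_monoid) auto
    show "frag_of (v, x \<otimes>\<^bsub>grp M v\<^esub> y, a) - frag_of (v, x, a) \<otimes>\<^bsub>?G\<^esub> frag_of (v, y, a)
        \<in> tensor_rels \<Lambda> M N"
      using assms(4-) unfolding tensor_rels_def by auto
  qed
  then show ?thesis using hom_mult[OF tensor_class_hom[OF assms(1-3)] g(1,2)] by simp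
qed

lemma tensor_class_one:
  assumes "small_category \<Lambda>" and M: "right_module \<Lambda> M" and N: "left_module \<Lambda> N"
    and v: "v \<in> obj \<Lambda>" and a: "a \<in> carrier (grp N v)"
  shows "tensor_class \<Lambda> M N (frag_of (v, \<one>\<^bsub>grp M v\<^esub>, a)) = \<one>\<^bsub>tensor \<Lambda> M N\<^esub>"
proof -
  interpret M: group "grp M v" using right_moduleD(2)[OF M v] .
  interpret T: comm_group "tensor \<Lambda> M N" using comm_group_tensor[OF assms(1-3)] .
  have "tensor_class \<Lambda> M N (frag_of (v, \<one>\<^bsub>grp M v\<^esub>, a)) \<in> carrier (tensor \<Lambda> M N)"
    using v a by (intro hom_in_carrier[OF tensor_class_hom[OF assms(1-3)]]) (simp add: tensor_gens_def)
  then show ?thesis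
    using tensor_class_add[OF assms(1-4) M.one_closed M.one_closed a] by simp
qed

context
  fixes \<Lambda> :: "('o, 'm) category" and N :: "('o, 'm, 'b) cat_module"
  assumes sc: "small_category \<Lambda>" and N: "left_module \<Lambda> N"
begin

lemma tensor_map_gen:
  assumes "right_module \<Lambda> M" "right_module \<Lambda> M'" "f \<in> module_maps \<Lambda> M M'"
    and "z \<in> tensor_gens \<Lambda> M N"
  shows "tensor_map \<Lambda> M' N f (tensor_class \<Lambda> M N (frag_of z))
    = tensor_class \<Lambda> M' N (frag_of (fst z, f (fst z) (fst (snd z)), snd (snd z)))"
  using tensor_map_class[OF sc assms(1) N assms(2,3), of "frag_of z"] assms(4)
  by (simp add: case_prod_unfold)

lemma tensor_map_hom:
  assumes M: "right_module \<Lambda> M" and M': "right_module \<Lambda> M'" and f: "f \<in> module_maps \<Lambda> M M'"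
  shows "tensor_map \<Lambda> M' N f \<in> hom (tensor \<Lambda> M N) (tensor \<Lambda> M' N)"
proof -
  let ?G = "free_Abelian_group (tensor_gens \<Lambda> M N)" and ?G' = "free_Abelian_group (tensor_gens \<Lambda> M' N)"
  let ?f = "frag_extend (\<lambda>(v, x, a). frag_of (v, f v x, a))"
  have "?f \<in> hom ?G ?G'"
    by (rule frag_extend_hom) (auto simp: tensor_gens_def natural_homD(2)[OF module_maps_natural[OF f]])
  then have h: "tensor_class \<Lambda> M' N \<circ> ?f \<in> hom ?G (tensor \<Lambda> M' N)"
    by (rule Group.hom_compose[OF _ tensor_class_hom[OF sc M' N]])
  note c = tensor_map_class[OF sc M N M' f]
  have m: "tensor_class \<Lambda> M N p \<otimes>\<^bsub>tensor \<Lambda> M N\<^esub> tensor_class \<Lambda> M N q = tensor_class \<Lambda> M N (p \<otimes>\<^bsub>?G\<^esub> q)"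
    if "p \<in> carrier ?G" "q \<in> carrier ?G" for p q
    using hom_mult[OF tensor_class_hom[OF sc M N] that] by simp
  show ?thesis
  proof (rule homI)
    fix X assume "X \<in> carrier (tensor \<Lambda> M N)"
    then show "tensor_map \<Lambda> M' N f X \<in> carrier (tensor \<Lambda> M' N)"
      unfolding carrier_tensor[of _ M] using c hom_in_carrier[OF h] by auto
  next
    fix X Y assume "X \<in> carrier (tensor \<Lambda> M N)" "Y \<in> carrier (tensor \<Lambda> M N)"
    then obtain p q where X: "X = tensor_class \<Lambda> M N p" and p: "p \<in> carrier ?G"
      and Y: "Y = tensor_class \<Lambda> M N q" and q: "q \<in> carrier ?G"
      unfolding carrier_tensor by blast
    have "p \<otimes>\<^bsub>?G\<^esub> q \<in> carrier ?G"
      using p q by (intro monoid.m_closed group.is_monoid) auto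
    then show "tensor_map \<Lambda> M' N f (X \<otimes>\<^bsub>tensor \<Lambda> M N\<^esub> Y)
        = tensor_map \<Lambda> M' N f X \<otimes>\<^bsub>tensor \<Lambda> M' N\<^esub> tensor_map \<Lambda> M' N f Y"
      using hom_mult[OF h p q] by (simp only: X Y m[OF p q] c p q o_def)
  qed
qed

text \<open>Homomorphisms on a tensor product are determined by their values on elementary tensors.\<close>

lemma tensor_hom_eq:
  assumes M: "right_module \<Lambda> M"
    and h: "h \<in> hom (tensor \<Lambda> M N) G" and h': "h' \<in> hom (tensor \<Lambda> M N) G" and G: "group G"
    and eq: "\<And>z. z \<in> tensor_gens \<Lambda> M N
      \<Longrightarrow> h (tensor_class \<Lambda> M N (frag_of z)) = h' (tensor_class \<Lambda> M N (frag_of z))"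
    and X: "X \<in> carrier (tensor \<Lambda> M N)"
  shows "h X = h' X"
proof -
  let ?G = "free_Abelian_group (tensor_gens \<Lambda> M N)"
  note cl = tensor_class_hom[OF sc M N]
  obtain c where c: "c \<in> carrier ?G" "X = tensor_class \<Lambda> M N c"
    using X unfolding carrier_tensor by blast
  have "(h \<circ> tensor_class \<Lambda> M N) c = (h' \<circ> tensor_class \<Lambda> M N) c"
    by (rule hom_free_eq[OF Group.hom_compose[OF cl h] Group.hom_compose[OF cl h'] G _ c(1)])
      (simp add: eq)
  then show ?thesis using c(2) by simp
qed

text \<open>Tensoring \<open>x = \<partial>(h x) + h'(\<partial> x)\<close> with \<open>N\<close> gives the same identity in \<open>R \<otimes> N\<close>, where it writes
  a cycle \<open>X\<close> as the boundary of \<open>(h \<otimes> id) X\<close>.\<close>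

lemma homology_vanishes:
  fixes R :: "nat \<Rightarrow> ('o, 'm, 'r) cat_module"
  assumes R: "projective_resolution \<Lambda> R bd \<epsilon> M"
    and h: "natural_hom \<Lambda> (R (Suc n)) (R (Suc (Suc n))) h" and h': "natural_hom \<Lambda> (R n) (R (Suc n)) h'"
    and hh': "\<And>v x. \<lbrakk>v \<in> obj \<Lambda>; x \<in> carrier (grp (R (Suc n)) v)\<rbrakk>
      \<Longrightarrow> bd (Suc n) v (h v x) \<otimes>\<^bsub>grp (R (Suc n)) v\<^esub> h' v (bd n v x) = x"
  shows "trivial_group (cat_homology \<Lambda> R bd N (Suc n))"
proof -
  note Rm = projective_resolutionD(2)[OF R]
  have bd: "bd n \<in> module_maps \<Lambda> (R (Suc n)) (R n)" for n
    using R by (simp add: projective_resolution_def)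
  let ?T = "\<lambda>n. tensor \<Lambda> (R n) N" and ?b = "\<lambda>n. tensor_map \<Lambda> (R n) N (bd n)"
  have T: "comm_group (?T n)" "group (?T n)" for n
    using comm_group_tensor[OF sc Rm N] by (auto simp: comm_group.axioms)
  note b = tensor_map_hom[OF Rm Rm bd]
  note s = natural_module_maps[OF h sc Rm] natural_module_maps[OF h' sc Rm]
  let ?s = "tensor_map \<Lambda> (R (Suc (Suc n))) N (\<lambda>v\<in>obj \<Lambda>. \<lambda>x\<in>carrier (grp (R (Suc n)) v). h v x)"
  let ?s' = "tensor_map \<Lambda> (R (Suc n)) N (\<lambda>v\<in>obj \<Lambda>. \<lambda>x\<in>carrier (grp (R n) v). h' v x)"
  note sh = tensor_map_hom[OF Rm Rm s(1)] tensor_map_hom[OF Rm Rm s(2)]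
  note bs = Group.hom_compose[OF sh(1) b] and sb = Group.hom_compose[OF b sh(2)]
  have split: "?b (Suc n) (?s X) \<otimes>\<^bsub>?T (Suc n)\<^esub> ?s' (?b n X) = X" if X: "X \<in> carrier (?T (Suc n))" for X
  proof (rule tensor_hom_eq[OF Rm _ _ T(2) _ X])
    show "(\<lambda>X. ?b (Suc n) (?s X) \<otimes>\<^bsub>?T (Suc n)\<^esub> ?s' (?b n X)) \<in> hom (?T (Suc n)) (?T (Suc n))"
      using comm_group.hom_group_mult[OF T(1) bs sb] by simp
    show "(\<lambda>X. X) \<in> hom (?T (Suc n)) (?T (Suc n))" by (simp add: hom_def)
    fix z assume "z \<in> tensor_gens \<Lambda> (R (Suc n)) N"
    then obtain v x a where z: "z = (v, x, a)" and v: "v \<in> obj \<Lambda>"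
      and x: "x \<in> carrier (grp (R (Suc n)) v)" and a: "a \<in> carrier (grp N v)"
      by (auto simp: tensor_gens_def)
    note cl = natural_homD(2)[OF projective_resolutionD(3)[OF R] v] natural_homD(2)[OF h v]
      natural_homD(2)[OF h' v]
    show "?b (Suc n) (?s (tensor_class \<Lambda> (R (Suc n)) N (frag_of z))) \<otimes>\<^bsub>?T (Suc n)\<^esub>
        ?s' (?b n (tensor_class \<Lambda> (R (Suc n)) N (frag_of z))) = tensor_class \<Lambda> (R (Suc n)) N (frag_of z)"
      using v x a cl hh'[OF v x]
      by (simp add: z tensor_gens_def tensor_map_gen[OF Rm Rm bd] tensor_map_gen[OF Rm Rm s(1)]
          tensor_map_gen[OF Rm Rm s(2)] tensor_class_add[OF sc Rm N v])
  qed
  have bb: "?b n (?b (Suc n) X) = \<one>\<^bsub>?T n\<^esub>" if X: "X \<in> carrier (?T (Suc (Suc n)))" for X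
  proof (rule tensor_hom_eq[OF Rm _ _ T(2) _ X])
    show "(\<lambda>X. ?b n (?b (Suc n) X)) \<in> hom (?T (Suc (Suc n))) (?T n)"
      using Group.hom_compose[OF b b] by (simp add: o_def)
    show "(\<lambda>X. \<one>\<^bsub>?T n\<^esub>) \<in> hom (?T (Suc (Suc n))) (?T n)"
      using T(2) by (simp add: hom_def group.is_monoid)
    fix z assume "z \<in> tensor_gens \<Lambda> (R (Suc (Suc n))) N"
    then obtain v x a where z: "z = (v, x, a)" and v: "v \<in> obj \<Lambda>"
      and x: "x \<in> carrier (grp (R (Suc (Suc n))) v)" and a: "a \<in> carrier (grp N v)"
      by (auto simp: tensor_gens_def)
    then show "?b n (?b (Suc n) (tensor_class \<Lambda> (R (Suc (Suc n))) N (frag_of z))) = \<one>\<^bsub>?T n\<^esub>"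
      using natural_homD(2)[OF projective_resolutionD(3)[OF R] v]
      by (simp add: tensor_gens_def tensor_map_gen[OF Rm Rm bd] boundary_boundary[OF R]
          tensor_class_one[OF sc Rm N])
  qed
  have "?b (Suc n) ` carrier (?T (Suc (Suc n))) = kernel (?T (Suc n)) (?T n) (?b n)"
  proof (intro equalityI subsetI)
    fix X assume "X \<in> kernel (?T (Suc n)) (?T n) (?b n)"
    then have X: "X \<in> carrier (?T (Suc n))" "?b n X = \<one>\<^bsub>?T n\<^esub>" by (auto simp: kernel_def)
    interpret G: group "?T (Suc n)" by (rule T)
    have sX: "?s X \<in> carrier (?T (Suc (Suc n)))" using hom_in_carrier[OF sh(1) X(1)] .
    have "?s' (\<one>\<^bsub>?T n\<^esub>) = \<one>\<^bsub>?T (Suc n)\<^esub>" using hom_one[OF sh(2) T(2) T(2)] .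
    then have "X = ?b (Suc n) (?s X)"
      using split[OF X(1)] hom_in_carrier[OF b sX] by (simp add: X(2))
    then show "X \<in> ?b (Suc n) ` carrier (?T (Suc (Suc n)))" using sX by blast
  qed (auto simp: kernel_def bb hom_in_carrier[OF b])
  then show ?thesis
    using trivial_homology_at[OF T(2) T(2) b] by simp
qed

end

lemma module_maps_eqI:
  assumes "f \<in> module_maps \<Lambda> M M'" "g \<in> module_maps \<Lambda> M M'"
    and "\<And>v x. \<lbrakk>v \<in> obj \<Lambda>; x \<in> carrier (grp M v)\<rbrakk> \<Longrightarrow> f v x = g v x"
  shows "f = g"
proof (rule extensionalityI[where A = "obj \<Lambda>"])
  show "f v = g v" if "v \<in> obj \<Lambda>" for v
    by (rule extensionalityI[where A = "carrier (grp M v)"])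
      (use assms that in \<open>auto simp: module_maps_def PiE_iff\<close>)
qed (use assms in \<open>auto simp: module_maps_def PiE_def\<close>)

lemma group_Hom:
  assumes sc: "small_category \<Lambda>" and M: "right_module \<Lambda> M" and M': "right_module \<Lambda> M'"
  shows "group (Hom \<Lambda> M M')"
proof (rule groupI)
  let ?H = "Hom \<Lambda> M M'"
  have car: "carrier ?H = module_maps \<Lambda> M M'" by (simp add: Hom_def)
  note G = right_moduleD(2)[OF M']
  have cl: "f v x \<in> carrier (grp M' v)"
    if "f \<in> carrier ?H" "v \<in> obj \<Lambda>" "x \<in> carrier (grp M v)" for f v x
    using natural_homD(2)[OF module_maps_natural that(2,3)] that(1) by (simp add: car)
  have app: "(f \<otimes>\<^bsub>?H\<^esub> g) v x = f v x \<otimes>\<^bsub>grp M' v\<^esub> g v x" "\<one>\<^bsub>?H\<^esub> v x = \<one>\<^bsub>grp M' v\<^esub>"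
    if "v \<in> obj \<Lambda>" "x \<in> carrier (grp M v)" for f g v x
    using that by (simp_all add: Hom_def)
  have ex: "f = g" if "f \<in> carrier ?H" "g \<in> carrier ?H"
      "\<And>v x. \<lbrakk>v \<in> obj \<Lambda>; x \<in> carrier (grp M v)\<rbrakk> \<Longrightarrow> f v x = g v x" for f g
    using module_maps_eqI[of f \<Lambda> M M' g] that by (simp add: car)
  show mult: "f \<otimes>\<^bsub>?H\<^esub> g \<in> carrier ?H" if "f \<in> carrier ?H" "g \<in> carrier ?H" for f g
    using natural_module_maps[OF natural_hom_mult[OF sc M'] sc M] that
    by (simp add: Hom_def module_maps_natural)
  have "natural_hom \<Lambda> M M' (\<lambda>v x. \<one>\<^bsub>grp M' v\<^esub>)"
    unfolding natural_hom_def
  proof (intro conjI ballI)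
    fix v assume "v \<in> obj \<Lambda>"
    then interpret group "grp M' v" by (rule G)
    show "(\<lambda>x. \<one>\<^bsub>grp M' v\<^esub>) \<in> hom (grp M v) (grp M' v)" by (simp add: hom_def)
  next
    fix \<kappa> x assume k: "\<kappa> \<in> mor \<Lambda>"
    show "\<one>\<^bsub>grp M' (src \<Lambda> \<kappa>)\<^esub> = act M' \<kappa> \<one>\<^bsub>grp M' (rng \<Lambda> \<kappa>)\<^esub>"
      using hom_one[OF right_moduleD(3)[OF M' k] G G] k sc
      by (simp add: small_category.rng_obj small_category.src_obj)
  qed
  then show one: "\<one>\<^bsub>?H\<^esub> \<in> carrier ?H"
    using natural_module_maps[OF _ sc M] by (simp add: Hom_def)
  show "f \<otimes>\<^bsub>?H\<^esub> g \<otimes>\<^bsub>?H\<^esub> h = f \<otimes>\<^bsub>?H\<^esub> (g \<otimes>\<^bsub>?H\<^esub> h)"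
    if "f \<in> carrier ?H" "g \<in> carrier ?H" "h \<in> carrier ?H" for f g h
    by (rule ex) (use that G in \<open>auto simp: mult app cl intro!: monoid.m_assoc group.is_monoid\<close>)
  show "\<one>\<^bsub>?H\<^esub> \<otimes>\<^bsub>?H\<^esub> f = f" if "f \<in> carrier ?H" for f
    by (rule ex) (use that G in \<open>auto simp: one mult app cl intro!: monoid.l_one group.is_monoid\<close>)
  show "\<exists>g\<in>carrier ?H. g \<otimes>\<^bsub>?H\<^esub> f = \<one>\<^bsub>?H\<^esub>" if f: "f \<in> carrier ?H" for f
  proof
    let ?g = "\<lambda>v\<in>obj \<Lambda>. \<lambda>x\<in>carrier (grp M v). inv\<^bsub>grp M' v\<^esub> f v x"
    show g: "?g \<in> carrier ?H"
      using natural_module_maps[OF natural_hom_inv[OF sc M'] sc M] f by (simp add: car module_maps_natural)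
    show "?g \<otimes>\<^bsub>?H\<^esub> f = \<one>\<^bsub>?H\<^esub>"
      by (rule ex) (use f g G in \<open>auto simp: one mult app cl intro!: group.l_inv\<close>)
  qed
qed

lemma precomp_module_maps:
  assumes sc: "small_category \<Lambda>" and A: "right_module \<Lambda> A"
    and f: "natural_hom \<Lambda> A B f" and g: "g \<in> module_maps \<Lambda> B L"
  shows "precomp \<Lambda> A f g \<in> module_maps \<Lambda> A L"
  unfolding precomp_def
  by (rule natural_module_maps[OF natural_hom_compose[OF sc f module_maps_natural[OF g]] sc A])

lemma precomp_hom:
  assumes sc: "small_category \<Lambda>" and A: "right_module \<Lambda> A" and L: "right_module \<Lambda> L"
    and f: "natural_hom \<Lambda> A B f"
  shows "precomp \<Lambda> A f \<in> hom (Hom \<Lambda> B L) (Hom \<Lambda> A L)"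
proof (rule homI)
  show "precomp \<Lambda> A f g \<in> carrier (Hom \<Lambda> A L)" if "g \<in> carrier (Hom \<Lambda> B L)" for g
    using precomp_module_maps[OF sc A f] that by (simp add: Hom_def)
  show "precomp \<Lambda> A f (g \<otimes>\<^bsub>Hom \<Lambda> B L\<^esub> h) = precomp \<Lambda> A f g \<otimes>\<^bsub>Hom \<Lambda> A L\<^esub> precomp \<Lambda> A f h" for g h
    by (auto simp: Hom_def precomp_def natural_homD(2)[OF f] intro!: restrict_ext)
qed

text \<open>A cocycle \<open>g\<close> satisfies \<open>g(\<partial>(h x)) = 0\<close>, so applying it to \<open>x = \<partial>(h x) + h'(\<partial> x)\<close> leaves
  \<open>g x = (g \<circ> h')(\<partial> x)\<close>: it is the coboundary of \<open>g \<circ> h'\<close>.\<close>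

lemma cohomology_vanishes:
  fixes R :: "nat \<Rightarrow> ('o, 'm, 'r) cat_module" and L :: "('o, 'm, 'c) cat_module"
  assumes sc: "small_category \<Lambda>" and R: "projective_resolution \<Lambda> R bd \<epsilon> M" and L: "right_module \<Lambda> L"
    and h: "natural_hom \<Lambda> (R (Suc n)) (R (Suc (Suc n))) h" and h': "natural_hom \<Lambda> (R n) (R (Suc n)) h'"
    and hh': "\<And>v x. \<lbrakk>v \<in> obj \<Lambda>; x \<in> carrier (grp (R (Suc n)) v)\<rbrakk>
      \<Longrightarrow> bd (Suc n) v (h v x) \<otimes>\<^bsub>grp (R (Suc n)) v\<^esub> h' v (bd n v x) = x"
  shows "trivial_group (cat_cohomology \<Lambda> R bd L (Suc n))"
proof -
  note Rm = projective_resolutionD(2)[OF R] and bd = projective_resolutionD(3)[OF R]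
  let ?H = "\<lambda>n. Hom \<Lambda> (R n) L" and ?b = "\<lambda>n. precomp \<Lambda> (R (Suc n)) (bd n)"
  note H = group_Hom[OF sc Rm L] and b = precomp_hom[OF sc Rm L bd]
  have car: "carrier (?H n) = module_maps \<Lambda> (R n) L" for n by (simp add: Hom_def)
  have "?b n ` carrier (?H n) = kernel (?H (Suc n)) (?H (Suc (Suc n))) (?b (Suc n))"
  proof (intro equalityI subsetI)
    fix g assume "g \<in> kernel (?H (Suc n)) (?H (Suc (Suc n))) (?b (Suc n))"
    then have g: "g \<in> module_maps \<Lambda> (R (Suc n)) L" and gb: "?b (Suc n) g = \<one>\<^bsub>?H (Suc (Suc n))\<^esub>"
      by (auto simp: kernel_def car)
    let ?g = "precomp \<Lambda> (R n) h' g"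
    have g': "?g \<in> carrier (?H n)" using precomp_module_maps[OF sc Rm h' g] by (simp add: car)
    have "g = ?b n ?g"
    proof (rule module_maps_eqI[OF g])
      show "?b n ?g \<in> module_maps \<Lambda> (R (Suc n)) L" using hom_in_carrier[OF b g'] by (simp add: car)
      fix v x assume v: "v \<in> obj \<Lambda>" and x: "x \<in> carrier (grp (R (Suc n)) v)"
      interpret g: group_hom "grp (R (Suc n)) v" "grp L v" "g v"
        using group_hom_natural[OF Rm L module_maps_natural[OF g] v] .
      note cl = natural_homD(2)[OF bd v] natural_homD(2)[OF h v] natural_homD(2)[OF h' v]
      have hx: "h v x \<in> carrier (grp (R (Suc (Suc n))) v)" using cl x by blast
      then have "g v (bd (Suc n) v (h v x)) = \<one>\<^bsub>grp L v\<^esub>"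
        using fun_cong[OF fun_cong[OF gb], of v "h v x"] v by (simp add: precomp_def Hom_def)
      then have "g v x = g v (h' v (bd n v x))"
        using g.hom_mult[of "bd (Suc n) v (h v x)" "h' v (bd n v x)"] hh'[OF v x] cl x hx by simp
      then show "g v x = ?b n ?g v x" using v x cl by (simp add: precomp_def)
    qed
    with g' show "g \<in> ?b n ` carrier (?H n)" by blast
  next
    fix g assume "g \<in> ?b n ` carrier (?H n)"
    then obtain f where f: "f \<in> module_maps \<Lambda> (R n) L" and g: "g = ?b n f" by (auto simp: car)
    have "f v (bd n v (bd (Suc n) v x)) = \<one>\<^bsub>grp L v\<^esub>"
      if "v \<in> obj \<Lambda>" "x \<in> carrier (grp (R (Suc (Suc n))) v)" for v x
      using boundary_boundary[OF R that]
        group_hom.hom_one[OF group_hom_natural[OF Rm L module_maps_natural[OF f] that(1)]] by simp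
    then have "?b (Suc n) g = \<one>\<^bsub>?H (Suc (Suc n))\<^esub>"
      by (auto simp: g precomp_def Hom_def natural_homD(2)[OF bd] intro!: restrict_ext)
    moreover have "g \<in> carrier (?H (Suc n))" using hom_in_carrier[OF b] f by (simp add: g car)
    ultimately show "g \<in> kernel (?H (Suc n)) (?H (Suc (Suc n))) (?b (Suc n))" by (simp add: kernel_def)
  qed
  then show ?thesis using trivial_homology_at[OF H H b] by simp
qed

section \<open>Tensor products of contractions\<close>

primrec partial_boundary :: "(nat \<Rightarrow> 'x \<Rightarrow> 'x) \<Rightarrow> nat \<Rightarrow> 'x \<Rightarrow> 'x::ab_group_add"
  where
    "partial_boundary D 0 c = 0"
  | "partial_boundary D (Suc j) c = partial_boundary D j c + D j c"

primrec partial_collapse :: "(nat \<Rightarrow> 'x \<Rightarrow> 'x) \<Rightarrow> nat \<Rightarrow> 'x \<Rightarrow> 'x::ab_group_add"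
  where
    "partial_collapse Q 0 c = c"
  | "partial_collapse Q (Suc j) c = partial_collapse Q j (Q j c)"

text \<open>The contraction of a tensor product: contract direction \<open>0\<close>, then contract direction \<open>1\<close> on what the
  first contraction leaves over, and so on.\<close>

primrec partial_homotopy :: "(nat \<Rightarrow> 'x \<Rightarrow> 'x) \<Rightarrow> (nat \<Rightarrow> 'x \<Rightarrow> 'x) \<Rightarrow> nat \<Rightarrow> 'x \<Rightarrow> 'x::ab_group_add"
  where
    "partial_homotopy S Q 0 c = 0"
  | "partial_homotopy S Q (Suc j) c = partial_homotopy S Q j c + partial_collapse Q j (S j c)"

text \<open>The total complex of a complex with one boundary map \<open>D i\<close> and one homotopy \<open>S i\<close> for each
  direction \<open>i\<close>, the signs of a tensor product being built into \<open>D\<close> and \<open>S\<close>. Within one direction, \<open>S i\<close> is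
  a homotopy from the identity to the projection \<open>Q i\<close>, which lives in degree \<open>0\<close> of that direction;
  this is what \<open>DQ\<close> and \<open>QD\<close> express. The laws are required on \<open>A\<close> only, for the operators are defined on more
  elements than the chains that are meant.\<close>

locale multicomplex =
  fixes A :: "'x::ab_group_add set" and D S Q :: "nat \<Rightarrow> 'x \<Rightarrow> 'x"
  assumes additive_ops: "additive (D i)" "additive (S i)" "additive (Q i)"
    and closed: "c \<in> A \<Longrightarrow> D i c \<in> A" "c \<in> A \<Longrightarrow> S i c \<in> A" "c \<in> A \<Longrightarrow> Q i c \<in> A"
    and zero_closed: "0 \<in> A"
    and add_closed: "\<lbrakk>a \<in> A; b \<in> A\<rbrakk> \<Longrightarrow> a + b \<in> A"
    and DD: "c \<in> A \<Longrightarrow> D i (D i c) = 0"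
    and DQ: "c \<in> A \<Longrightarrow> D i (Q i c) = 0"
    and QD: "c \<in> A \<Longrightarrow> Q i (D i c) = 0"
    and DS: "c \<in> A \<Longrightarrow> D i (S i c) + S i (D i c) = c - Q i c"
    and DD': "\<lbrakk>c \<in> A; i \<noteq> j\<rbrakk> \<Longrightarrow> D i (D j c) = - D j (D i c)"
    and DS': "\<lbrakk>c \<in> A; i \<noteq> j\<rbrakk> \<Longrightarrow> D i (S j c) = - S j (D i c)"
    and DQ': "\<lbrakk>c \<in> A; i \<noteq> j\<rbrakk> \<Longrightarrow> D i (Q j c) = Q j (D i c)"
begin

abbreviation (input) \<beta> where "\<beta> \<equiv> partial_boundary D"
abbreviation (input) \<pi> where "\<pi> \<equiv> partial_collapse Q"
abbreviation (input) H where "H \<equiv> partial_homotopy S Q"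

lemmas op_simps = additive.add[OF additive_ops(1)] additive.add[OF additive_ops(2)] additive.add[OF additive_ops(3)]
  additive.zero[OF additive_ops(1)] additive.zero[OF additive_ops(2)] additive.zero[OF additive_ops(3)]
  additive.minus[OF additive_ops(1)] additive.minus[OF additive_ops(2)] additive.minus[OF additive_ops(3)]
  additive.diff[OF additive_ops(1)] additive.diff[OF additive_ops(2)] additive.diff[OF additive_ops(3)]

lemma additive_boundary: "additive (\<beta> j)"
  by (induction j) (simp_all add: additive_def op_simps algebra_simps)

lemma additive_collapse: "additive (\<pi> j)"
proof (induction j)
  case (Suc j)
  then show ?case by (simp add: additive_def op_simps)
qed (simp add: additive_def)

lemma additive_homotopy: "additive (H j)"
  by (induction j) (simp_all add: additive_def op_simps additive.add[OF additive_collapse] algebra_simps)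

lemmas partial_simps = additive.add[OF additive_boundary] additive.add[OF additive_collapse]
  additive.add[OF additive_homotopy]
  additive.zero[OF additive_boundary] additive.zero[OF additive_collapse] additive.zero[OF additive_homotopy]
  additive.minus[OF additive_boundary] additive.minus[OF additive_collapse] additive.minus[OF additive_homotopy]
  additive.diff[OF additive_boundary] additive.diff[OF additive_collapse] additive.diff[OF additive_homotopy]

lemma partial_closed:
  assumes "c \<in> A" shows "\<beta> j c \<in> A" "\<pi> j c \<in> A" "H j c \<in> A"
proof -
  show 1: "\<beta> j c \<in> A" using assms by (induction j) (auto simp: zero_closed add_closed closed)
  have 2: "\<pi> j a \<in> A" if "a \<in> A" for j a
    using that by (induction j arbitrary: a) (auto simp: closed)
  then show "\<pi> j c \<in> A" using assms .
  show "H j c \<in> A" using assms by (induction j) (auto simp: zero_closed add_closed closed 2)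
qed

lemma boundary_anticommute:
  assumes "c \<in> A" "j \<le> i"
  shows "D i (\<beta> j c) = - \<beta> j (D i c)" "S i (\<beta> j c) = - \<beta> j (S i c)" "Q i (\<beta> j c) = \<beta> j (Q i c)"
  using assms(2)
proof (induction j)
  case (Suc j)
  { case 1 with Suc show ?case using assms(1) DD'[of c i j] by (simp add: op_simps) }
  { case 2 with Suc show ?case using assms(1) DS'[of c j i] by (simp add: op_simps) }
  { case 3 with Suc show ?case using assms(1) DQ'[of c j i] by (simp add: op_simps) }
qed (simp_all add: op_simps)

lemma collapse_commute:
  assumes "c \<in> A" "j \<le> i"
  shows "D i (\<pi> j c) = \<pi> j (D i c)"
  using assms
proof (induction j arbitrary: c)
  case (Suc j)
  then show ?case using DQ'[of c i j] by (simp add: closed)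
qed simp

lemma homotopy_anticommute:
  assumes "c \<in> A" "j \<le> i"
  shows "D i (H j c) = - H j (D i c)"
  using assms(2)
proof (induction j)
  case (Suc j)
  then show ?case
    using assms(1) DS'[of c i j] by (simp add: op_simps collapse_commute closed partial_simps)
qed (simp add: op_simps)

lemma boundary_collapse:
  assumes "c \<in> A"
  shows "\<beta> j (\<pi> j c) = 0" "\<pi> j (\<beta> j c) = 0"
  using assms
proof (induction j arbitrary: c)
  case (Suc j)
  { case 1 with Suc show ?case
      by (simp add: closed collapse_commute DQ partial_simps) }
  { case 2 with Suc show ?case
      by (simp add: closed op_simps boundary_anticommute QD partial_simps partial_closed) }
qed simp_all

lemma boundary_squared:
  assumes "c \<in> A"
  shows "\<beta> j (\<beta> j c) = 0"
  using assms
proof (induction j)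
  case (Suc j)
  then show ?case
    by (simp add: op_simps partial_simps boundary_anticommute DD)
qed simp

text \<open>Passing from \<open>j\<close> to \<open>j + 1\<close> directions adds \<open>D j\<close> to the boundary and \<open>\<pi> j \<circ> S j\<close> to the homotopy. The mixed
  terms cancel, since operators in different directions anticommute and \<open>\<pi> j\<close> annihilates the boundaries
  in the first \<open>j\<close> directions. What is left is \<open>\<pi> j\<close> applied to the homotopy formula of direction \<open>j\<close>.\<close>

lemma homotopy_formula:
  assumes "c \<in> A"
  shows "\<beta> j (H j c) + H j (\<beta> j c) = c - \<pi> j c"
  using assms
proof (induction j arbitrary: c)
  case (Suc j)
  note c = Suc.prems
  have "\<beta> (Suc j) (H (Suc j) c) + H (Suc j) (\<beta> (Suc j) c)
      = (\<beta> j (H j c) + H j (\<beta> j c)) + (D j (H j c) + H j (D j c))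
        + \<beta> j (\<pi> j (S j c)) + \<pi> j (S j (\<beta> j c)) + \<pi> j (D j (S j c) + S j (D j c))"
    using c by (simp add: op_simps partial_simps collapse_commute closed)
  also have "\<dots> = c - \<pi> j (Q j c)"
    using c by (simp only: Suc.IH DS)
      (simp add: homotopy_anticommute boundary_collapse boundary_anticommute closed partial_simps)
  finally show ?case by simp
qed simp

end

section \<open>Factorization in higher-rank graphs\<close>

context k_graph
begin

text \<open>Spelled out, since the order relation on \<open>nat \<Rightarrow>\<^sub>0 nat\<close> is the lexicographic one.\<close>

definition fits :: "(nat \<Rightarrow>\<^sub>0 nat) \<Rightarrow> 'm \<Rightarrow> bool"
  where "fits m \<kappa> \<longleftrightarrow> \<kappa> \<in> mor \<Lambda> \<and> (\<forall>i. Poly_Mapping.lookup m i \<le> Poly_Mapping.lookup (d \<kappa>) i)"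

definition head :: "(nat \<Rightarrow>\<^sub>0 nat) \<Rightarrow> 'm \<Rightarrow> 'm"
  where "head m \<kappa> = (SOME \<mu>. \<mu> \<in> mor \<Lambda> \<and> d \<mu> = m \<and>
    (\<exists>\<nu>\<in>mor \<Lambda>. src \<Lambda> \<mu> = rng \<Lambda> \<nu> \<and> \<kappa> = comp \<Lambda> \<mu> \<nu>))"

definition tail :: "(nat \<Rightarrow>\<^sub>0 nat) \<Rightarrow> 'm \<Rightarrow> 'm"
  where "tail m \<kappa> = (SOME \<nu>. \<nu> \<in> mor \<Lambda> \<and>
    (\<exists>\<mu>\<in>mor \<Lambda>. d \<mu> = m \<and> src \<Lambda> \<mu> = rng \<Lambda> \<nu> \<and> \<kappa> = comp \<Lambda> \<mu> \<nu>))"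

lemma factorization_unique:
  assumes "\<mu> \<in> mor \<Lambda>" "\<nu> \<in> mor \<Lambda>" "src \<Lambda> \<mu> = rng \<Lambda> \<nu>"
    and "\<mu>' \<in> mor \<Lambda>" "\<nu>' \<in> mor \<Lambda>" "src \<Lambda> \<mu>' = rng \<Lambda> \<nu>'"
    and "comp \<Lambda> \<mu> \<nu> = comp \<Lambda> \<mu>' \<nu>'" "d \<mu> = d \<mu>'"
  shows "\<mu> = \<mu>'" "\<nu> = \<nu>'"
proof -
  have "d \<mu> + d \<nu> = d \<mu> + d \<nu>'"
    using degree_comp[OF assms(1-3)] degree_comp[OF assms(4-6)] assms(7,8) by simp
  then have n: "d \<nu> = d \<nu>'" by simp
  let ?P = "\<lambda>(\<alpha>, \<beta>). \<alpha> \<in> mor \<Lambda> \<and> \<beta> \<in> mor \<Lambda> \<and> src \<Lambda> \<alpha> = rng \<Lambda> \<beta> \<and> d \<alpha> = d \<mu> \<and> d \<beta> = d \<nu>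
    \<and> comp \<Lambda> \<mu> \<nu> = comp \<Lambda> \<alpha> \<beta>"
  have "\<exists>!p. ?P p"
    using factorization[OF comp_mor[OF assms(1-3)] degree[OF assms(1)] degree[OF assms(2)]
        degree_comp[OF assms(1-3)]] .
  moreover have "?P (\<mu>, \<nu>)" "?P (\<mu>', \<nu>')" using assms n by simp_all
  ultimately have "(\<mu>, \<nu>) = (\<mu>', \<nu>')" by blast
  then show "\<mu> = \<mu>'" "\<nu> = \<nu>'" by simp_all
qed

lemma head_tail_comp:
  assumes "\<mu> \<in> mor \<Lambda>" "\<nu> \<in> mor \<Lambda>" "src \<Lambda> \<mu> = rng \<Lambda> \<nu>" "d \<mu> = m"
  shows "head m (comp \<Lambda> \<mu> \<nu>) = \<mu>" "tail m (comp \<Lambda> \<mu> \<nu>) = \<nu>"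
proof -
  show "head m (comp \<Lambda> \<mu> \<nu>) = \<mu>"
    unfolding head_def
    by (rule some_equality) (use assms in blast, metis assms factorization_unique(1))
  show "tail m (comp \<Lambda> \<mu> \<nu>) = \<nu>"
    unfolding tail_def
    by (rule some_equality) (use assms in blast, metis assms factorization_unique(2))
qed

lemma fitsE:
  assumes "fits m \<kappa>"
  obtains \<mu> \<nu> where "\<mu> \<in> mor \<Lambda>" "\<nu> \<in> mor \<Lambda>" "src \<Lambda> \<mu> = rng \<Lambda> \<nu>" "d \<mu> = m"
    "\<kappa> = comp \<Lambda> \<mu> \<nu>" "head m \<kappa> = \<mu>" "tail m \<kappa> = \<nu>"
proof -
  have k: "\<kappa> \<in> mor \<Lambda>" and le: "\<And>i. Poly_Mapping.lookup m i \<le> Poly_Mapping.lookup (d \<kappa>) i"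
    using assms by (auto simp: fits_def)
  let ?n = "d \<kappa> - m"
  have s: "d \<kappa> = m + ?n" by (rule poly_mapping_eqI) (simp add: lookup_add lookup_minus le)
  have "Poly_Mapping.keys m \<subseteq> Poly_Mapping.keys (d \<kappa>)" "Poly_Mapping.keys ?n \<subseteq> Poly_Mapping.keys (d \<kappa>)"
    using le by (auto simp: in_keys_iff lookup_minus) (meson le less_le_trans)
  then have "m \<in> multidegrees k" "?n \<in> multidegrees k"
    using degree[OF k] by (auto simp: multidegrees_def)
  from factorization[OF k this s] obtain \<mu> \<nu> where "\<mu> \<in> mor \<Lambda>" "\<nu> \<in> mor \<Lambda>" "src \<Lambda> \<mu> = rng \<Lambda> \<nu>"
    "d \<mu> = m" "\<kappa> = comp \<Lambda> \<mu> \<nu>" by blast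
  then show thesis using that head_tail_comp by blast
qed

lemma fits_factor:
  assumes "fits m \<kappa>"
  shows "head m \<kappa> \<in> mor \<Lambda>" "tail m \<kappa> \<in> mor \<Lambda>" "src \<Lambda> (head m \<kappa>) = rng \<Lambda> (tail m \<kappa>)"
    "d (head m \<kappa>) = m" "comp \<Lambda> (head m \<kappa>) (tail m \<kappa>) = \<kappa>" "src \<Lambda> (tail m \<kappa>) = src \<Lambda> \<kappa>"
    "d (tail m \<kappa>) = d \<kappa> - m"
  by (rule fitsE[OF assms], simp add: src_comp degree_comp)+

lemma fits_comp:
  assumes "fits m \<kappa>" "\<mu> \<in> mor \<Lambda>" "src \<Lambda> \<kappa> = rng \<Lambda> \<mu>"
  shows "fits m (comp \<Lambda> \<kappa> \<mu>)" "head m (comp \<Lambda> \<kappa> \<mu>) = head m \<kappa>"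
    "tail m (comp \<Lambda> \<kappa> \<mu>) = comp \<Lambda> (tail m \<kappa>) \<mu>"
proof -
  note f = fits_factor[OF assms(1)]
  have k: "\<kappa> \<in> mor \<Lambda>" using assms(1) by (simp add: fits_def)
  show "fits m (comp \<Lambda> \<kappa> \<mu>)"
    using assms k by (auto simp: fits_def comp_mor degree_comp lookup_add trans_le_add1)
  have e: "comp \<Lambda> \<kappa> \<mu> = comp \<Lambda> (head m \<kappa>) (comp \<Lambda> (tail m \<kappa>) \<mu>)"
    using comp_assoc[OF f(1,2) assms(2) f(3)] f assms(3) by simp
  show "head m (comp \<Lambda> \<kappa> \<mu>) = head m \<kappa>" "tail m (comp \<Lambda> \<kappa> \<mu>) = comp \<Lambda> (tail m \<kappa>) \<mu>"
    unfolding e using f assms by (auto intro!: head_tail_comp simp: comp_mor rng_comp)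
qed

text \<open>Uniqueness of factorizations: the two successive heads compose to a head of degree \<open>m + n\<close>.\<close>

lemma tail_tail:
  assumes "fits (m + n) \<kappa>"
  shows "tail n (tail m \<kappa>) = tail (m + n) \<kappa>"
proof -
  have le: "Poly_Mapping.lookup m i + Poly_Mapping.lookup n i \<le> Poly_Mapping.lookup (d \<kappa>) i" for i
    using assms by (simp add: fits_def lookup_add)
  have m: "fits m \<kappa>" using assms add_leD1[OF le] by (simp add: fits_def)
  note f = fits_factor[OF m]
  have "fits n (tail m \<kappa>)"
    unfolding fits_def
  proof (intro conjI allI)
    show "Poly_Mapping.lookup n i \<le> Poly_Mapping.lookup (d (tail m \<kappa>)) i" for i
      using le[of i] by (simp add: f lookup_minus)
  qed (rule f)
  note g = fits_factor[OF this]
  have r: "src \<Lambda> (head m \<kappa>) = rng \<Lambda> (head n (tail m \<kappa>))"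
    using rng_comp[OF g(1,2,3)] f(3) g(5) by simp
  have "\<kappa> = comp \<Lambda> (comp \<Lambda> (head m \<kappa>) (head n (tail m \<kappa>))) (tail n (tail m \<kappa>))"
    using comp_assoc[OF f(1) g(1,2) r g(3)] by (simp add: g(5) f(5))
  with r show ?thesis
    using f(1,4) g(1-4) head_tail_comp(2)[of "comp \<Lambda> (head m \<kappa>) (head n (tail m \<kappa>))" "tail n (tail m \<kappa>)" "m + n"]
    by (simp add: comp_mor src_comp degree_comp)
qed

lemma tail_0: "\<kappa> \<in> mor \<Lambda> \<Longrightarrow> tail 0 \<kappa> = \<kappa>"
  using head_tail_comp(2)[of "idn \<Lambda> (rng \<Lambda> \<kappa>)" \<kappa> 0]
  by (simp add: comp_idn_left idn_mor src_idn degree_idn rng_obj)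

lemma tail_degree: "\<kappa> \<in> mor \<Lambda> \<Longrightarrow> tail (d \<kappa>) \<kappa> = idn \<Lambda> (src \<Lambda> \<kappa>)"
  using head_tail_comp(2)[of \<kappa> "idn \<Lambda> (src \<Lambda> \<kappa>)" "d \<kappa>"]
  by (simp add: comp_idn_right idn_mor rng_idn src_obj)

end

section \<open>Cubes and their contraction in one colour\<close>

definition position_sign :: "nat \<Rightarrow> nat set \<Rightarrow> int"
  where "position_sign i I = (-1) ^ card {l \<in> I. l < i}"

lemma position_sign_square [simp]: "position_sign i I * position_sign i I = 1"
  by (cases "even (card {l \<in> I. l < i})") (simp_all add: position_sign_def)

lemma position_sign_remove:
  assumes "finite I" "j \<in> I"
  shows "position_sign i (I - {j}) = (if j < i then - position_sign i I else position_sign i I)"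
proof (cases "j < i")
  case True
  have "card {l \<in> I. l < i} = Suc (card ({l \<in> I. l < i} - {j}))"
    using assms True by (intro card.remove) auto
  moreover have "{l \<in> I - {j}. l < i} = {l \<in> I. l < i} - {j}" by auto
  ultimately show ?thesis using True by (simp add: position_sign_def)
next
  case False
  then have "{l \<in> I - {j}. l < i} = {l \<in> I. l < i}" by auto
  then show ?thesis using False by (simp add: position_sign_def)
qed

lemma position_sign_insert:
  assumes "finite I" "j \<notin> I"
  shows "position_sign i (insert j I) = (if j < i then - position_sign i I else position_sign i I)"
  using position_sign_remove[of "insert j I" j i] assms by (simp split: if_splits)

lemma frag_cmul_diff: "frag_cmul c (a - b) = frag_cmul c a - frag_cmul c b"
  by (rule poly_mapping_eqI) (simp add: lookup_minus algebra_simps)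

lemma additive_frag_extend: "additive (frag_extend f)"
  by (simp add: additive_def frag_extend_add)

lemma additive_eq_on_frags:
  assumes "additive f" "additive g" "Poly_Mapping.keys c \<subseteq> S"
    and "\<And>z. z \<in> S \<Longrightarrow> f (frag_of z) = g (frag_of z)"
  shows "f c = g c"
  using assms(3)
  by (induction c rule: frag_induction)
    (simp_all add: additive.zero[OF assms(1)] additive.zero[OF assms(2)]
      additive.diff[OF assms(1)] additive.diff[OF assms(2)] assms(4))

lemma keys_frag_extend_subset:
  assumes "\<And>z. z \<in> S \<Longrightarrow> Poly_Mapping.keys (f z) \<subseteq> T" "Poly_Mapping.keys c \<subseteq> S"
  shows "Poly_Mapping.keys (frag_extend f c) \<subseteq> T"
  by (rule order_trans[OF keys_frag_extend UN_least]) (use assms in auto)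

lemma keys_cmul_subset: "Poly_Mapping.keys c \<subseteq> T \<Longrightarrow> Poly_Mapping.keys (frag_cmul n c) \<subseteq> T"
  by (rule order_trans[OF keys_cmul])

lemma keys_diff_subset:
  "\<lbrakk>Poly_Mapping.keys a \<subseteq> T; Poly_Mapping.keys b \<subseteq> T\<rbrakk> \<Longrightarrow> Poly_Mapping.keys (a - b) \<subseteq> T"
  by (rule order_trans[OF keys_diff Un_least])

lemma keys_sum_subset:
  "(\<And>x. x \<in> X \<Longrightarrow> Poly_Mapping.keys (f x) \<subseteq> T) \<Longrightarrow> Poly_Mapping.keys (sum f X) \<subseteq> T"
  by (rule order_trans[OF keys_sum UN_least])

context k_graph
begin

abbreviation deg :: "'m \<Rightarrow> nat \<Rightarrow> nat"
  where "deg \<kappa> \<equiv> Poly_Mapping.lookup (d \<kappa>)"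

text \<open>Removal of an initial path of \<open>t\<close> edges of colour \<open>i\<close>.\<close>

definition strip :: "nat \<Rightarrow> nat \<Rightarrow> 'm \<Rightarrow> 'm"
  where "strip i t = tail (Poly_Mapping.single i t)"

lemma fits_single: "\<lbrakk>\<kappa> \<in> mor \<Lambda>; t \<le> deg \<kappa> i\<rbrakk> \<Longrightarrow> fits (Poly_Mapping.single i t) \<kappa>"
  by (auto simp: fits_def lookup_single when_def)

lemma strip_mor:
  assumes "\<kappa> \<in> mor \<Lambda>" "t \<le> deg \<kappa> i"
  shows "strip i t \<kappa> \<in> mor \<Lambda>" "src \<Lambda> (strip i t \<kappa>) = src \<Lambda> \<kappa>"
    "deg (strip i t \<kappa>) j = (if j = i then deg \<kappa> i - t else deg \<kappa> j)"
  using fits_factor[OF fits_single[OF assms]]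
  by (auto simp: strip_def lookup_minus lookup_single when_def)

lemma strip_0: "\<kappa> \<in> mor \<Lambda> \<Longrightarrow> strip i 0 \<kappa> = \<kappa>"
  by (simp add: strip_def tail_0)

lemma strip_strip:
  assumes "\<kappa> \<in> mor \<Lambda>" "t + s \<le> deg \<kappa> i"
  shows "strip i s (strip i t \<kappa>) = strip i (t + s) \<kappa>"
  using tail_tail[of "Poly_Mapping.single i t" "Poly_Mapping.single i s" \<kappa>] fits_single[OF assms]
  by (simp add: strip_def single_add)

text \<open>Both sides remove the head of degree \<open>s e\<^sub>i + t e\<^sub>j\<close>. The commuting squares of a higher-rank graph enter the
  proof here.\<close>

lemma strip_commute:
  assumes "\<kappa> \<in> mor \<Lambda>" "s \<le> deg \<kappa> i" "t \<le> deg \<kappa> j" "i \<noteq> j"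
  shows "strip i s (strip j t \<kappa>) = strip j t (strip i s \<kappa>)"
proof -
  have "fits (Poly_Mapping.single j t + Poly_Mapping.single i s) \<kappa>"
    using assms by (auto simp: fits_def lookup_add lookup_single when_def)
  then show ?thesis
    using tail_tail[of "Poly_Mapping.single j t" "Poly_Mapping.single i s" \<kappa>]
      tail_tail[of "Poly_Mapping.single i s" "Poly_Mapping.single j t" \<kappa>]
    by (simp add: strip_def add.commute)
qed

lemma strip_comp:
  assumes "\<kappa> \<in> mor \<Lambda>" "t \<le> deg \<kappa> i" "\<mu> \<in> mor \<Lambda>" "src \<Lambda> \<kappa> = rng \<Lambda> \<mu>"
  shows "strip i t (comp \<Lambda> \<kappa> \<mu>) = comp \<Lambda> (strip i t \<kappa>) \<mu>"
  using fits_comp(3)[OF fits_single[OF assms(1,2)] assms(3,4)] by (simp add: strip_def)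

text \<open>The pair \<open>(\<kappa>, I)\<close> encodes a cube with edges of the colours \<open>I\<close>, namely the head \<open>x\<close> of \<open>\<kappa>\<close> with
  one edge of each of these colours, together with the morphism \<open>\<lambda>\<close> by which it is translated, where
  \<open>\<kappa> = x\<lambda>\<close>. In this encoding translation is composition of \<open>\<kappa>\<close> with a morphism, and
  a face either keeps \<open>\<kappa>\<close> or removes its initial edge.\<close>

definition cells :: "'o \<Rightarrow> ('m \<times> nat set) set"
  where "cells v = {(\<kappa>, I). \<kappa> \<in> mor \<Lambda> \<and> src \<Lambda> \<kappa> = v \<and> I \<subseteq> Poly_Mapping.keys (d \<kappa>)}"

definition cubes :: "nat \<Rightarrow> 'o \<Rightarrow> ('m \<times> nat set) set"
  where "cubes n v = {z \<in> cells v. card (snd z) = n}"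

text \<open>The difference of the two opposite faces of a cube in direction \<open>i\<close>: the first removes the final
  edge of colour \<open>i\<close> from the cube and hands it over to the translating morphism, so that \<open>\<kappa>\<close> remains; the
  second removes the initial one.\<close>

definition face :: "nat \<Rightarrow> (('m \<times> nat set) \<Rightarrow>\<^sub>0 int) \<Rightarrow> (('m \<times> nat set) \<Rightarrow>\<^sub>0 int)"
  where "face i = frag_extend (\<lambda>(\<kappa>, I). if i \<in> I
    then frag_cmul (position_sign i I) (frag_of (\<kappa>, I - {i}) - frag_of (strip i 1 \<kappa>, I - {i})) else 0)"

text \<open>The path of cubes that leads from \<open>\<kappa>\<close>, by removing edges of colour \<open>i\<close> one at a time, to the end
  described by \<open>collapse\<close>.\<close>

definition fill :: "nat \<Rightarrow> (('m \<times> nat set) \<Rightarrow>\<^sub>0 int) \<Rightarrow> (('m \<times> nat set) \<Rightarrow>\<^sub>0 int)"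
  where "fill i = frag_extend (\<lambda>(\<kappa>, I). if i \<in> I then 0
    else frag_cmul (position_sign i I) (\<Sum>t<deg \<kappa> i. frag_of (strip i t \<kappa>, insert i I)))"

definition collapse :: "nat \<Rightarrow> (('m \<times> nat set) \<Rightarrow>\<^sub>0 int) \<Rightarrow> (('m \<times> nat set) \<Rightarrow>\<^sub>0 int)"
  where "collapse i = frag_extend (\<lambda>(\<kappa>, I). if i \<in> I then 0 else frag_of (strip i (deg \<kappa> i) \<kappa>, I))"

lemma face_of:
  "i \<in> I \<Longrightarrow> face i (frag_of (\<kappa>, I))
    = frag_cmul (position_sign i I) (frag_of (\<kappa>, I - {i}) - frag_of (strip i 1 \<kappa>, I - {i}))"
  "i \<notin> I \<Longrightarrow> face i (frag_of (\<kappa>, I)) = 0"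
  by (simp_all add: face_def)

lemma fill_of:
  "i \<in> I \<Longrightarrow> fill i (frag_of (\<kappa>, I)) = 0"
  "i \<notin> I \<Longrightarrow> fill i (frag_of (\<kappa>, I))
    = frag_cmul (position_sign i I) (\<Sum>t<deg \<kappa> i. frag_of (strip i t \<kappa>, insert i I))"
  by (simp_all add: fill_def)

lemma collapse_of:
  "i \<in> I \<Longrightarrow> collapse i (frag_of (\<kappa>, I)) = 0"
  "i \<notin> I \<Longrightarrow> collapse i (frag_of (\<kappa>, I)) = frag_of (strip i (deg \<kappa> i) \<kappa>, I)"
  by (simp_all add: collapse_def)

lemma additive_cube_ops: "additive (face i)" "additive (fill i)" "additive (collapse i)"
  by (simp_all add: face_def fill_def collapse_def additive_frag_extend)

lemma cube_ops_linear:
  "face i 0 = 0" "fill i 0 = 0" "collapse i 0 = 0"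
  "face i (- a) = - face i a" "fill i (- a) = - fill i a" "collapse i (- a) = - collapse i a"
  "face i (a - b) = face i a - face i b" "fill i (a - b) = fill i a - fill i b"
  "collapse i (a - b) = collapse i a - collapse i b"
  "face i (frag_cmul n a) = frag_cmul n (face i a)" "fill i (frag_cmul n a) = frag_cmul n (fill i a)"
  "collapse i (frag_cmul n a) = frag_cmul n (collapse i a)"
  "finite X \<Longrightarrow> face i (sum h X) = (\<Sum>x\<in>X. face i (h x))"
  "finite X \<Longrightarrow> fill i (sum h X) = (\<Sum>x\<in>X. fill i (h x))"
  "finite X \<Longrightarrow> collapse i (sum h X) = (\<Sum>x\<in>X. collapse i (h x))"
  by (simp_all add: face_def fill_def collapse_def frag_extend_minus frag_extend_diff
      frag_extend_cmul frag_extend_sum Fun.comp_def)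

text \<open>The last fact bounds the dimension: colours are numbers below \<open>k\<close>.\<close>

lemma cellsD:
  assumes "(\<kappa>, I) \<in> cells v"
  shows "\<kappa> \<in> mor \<Lambda>" "src \<Lambda> \<kappa> = v" "I \<subseteq> Poly_Mapping.keys (d \<kappa>)" "finite I" "i \<in> I \<Longrightarrow> Suc 0 \<le> deg \<kappa> i"
    "I \<subseteq> {..<k}"
proof -
  show *: "\<kappa> \<in> mor \<Lambda>" "src \<Lambda> \<kappa> = v" "I \<subseteq> Poly_Mapping.keys (d \<kappa>)" using assms by (auto simp: cells_def)
  then show "finite I" using finite_keys finite_subset by blast
  show "i \<in> I \<Longrightarrow> Suc 0 \<le> deg \<kappa> i" using *(3) by (auto simp: in_keys_iff Suc_le_eq)
  show "I \<subseteq> {..<k}" using * degree[OF *(1)] by (auto simp: multidegrees_def)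
qed

lemma cells_subset: "\<lbrakk>(\<kappa>, I) \<in> cells v; J \<subseteq> I\<rbrakk> \<Longrightarrow> (\<kappa>, J) \<in> cells v"
  by (auto simp: cells_def)

lemma cells_strip:
  assumes "(\<kappa>, I) \<in> cells v" "t \<le> deg \<kappa> i" "i \<in> J \<Longrightarrow> t < deg \<kappa> i" "J \<subseteq> insert i I"
  shows "(strip i t \<kappa>, J) \<in> cells v"
proof -
  note \<kappa> = cellsD[OF assms(1)]
  have "j \<in> Poly_Mapping.keys (d (strip i t \<kappa>))" if "j \<in> J" for j
    using strip_mor(3)[OF \<kappa>(1) assms(2), of j] \<kappa>(3) assms(3,4) that by (auto simp: in_keys_iff)
  then show ?thesis using strip_mor(1,2)[OF \<kappa>(1) assms(2)] \<kappa>(2) by (auto simp: cells_def)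
qed

lemma face_keys:
  assumes "Poly_Mapping.keys c \<subseteq> S"
    and "\<And>\<kappa> I. \<lbrakk>(\<kappa>, I) \<in> S; i \<in> I\<rbrakk> \<Longrightarrow> (\<kappa>, I - {i}) \<in> T \<and> (strip i (Suc 0) \<kappa>, I - {i}) \<in> T"
  shows "Poly_Mapping.keys (face i c) \<subseteq> T"
  unfolding face_def
proof (rule keys_frag_extend_subset[OF _ assms(1)], clarify del: subsetI)
  fix \<kappa> I assume "(\<kappa>, I) \<in> S"
  then show "Poly_Mapping.keys (if i \<in> I then frag_cmul (position_sign i I)
      (frag_of (\<kappa>, I - {i}) - frag_of (strip i 1 \<kappa>, I - {i})) else 0) \<subseteq> T"
    using assms(2)[of \<kappa> I] by (cases "i \<in> I") (simp_all add: keys_cmul_subset keys_diff_subset)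
qed

lemma fill_keys:
  assumes "Poly_Mapping.keys c \<subseteq> S"
    and "\<And>\<kappa> I t. \<lbrakk>(\<kappa>, I) \<in> S; i \<notin> I; t < deg \<kappa> i\<rbrakk> \<Longrightarrow> (strip i t \<kappa>, insert i I) \<in> T"
  shows "Poly_Mapping.keys (fill i c) \<subseteq> T"
  unfolding fill_def
proof (rule keys_frag_extend_subset[OF _ assms(1)], clarify del: subsetI)
  fix \<kappa> I assume "(\<kappa>, I) \<in> S"
  then show "Poly_Mapping.keys (if i \<in> I then 0 else frag_cmul (position_sign i I)
      (\<Sum>t<deg \<kappa> i. frag_of (strip i t \<kappa>, insert i I))) \<subseteq> T"
    using assms(2)[of \<kappa> I] by (cases "i \<in> I") (auto intro!: keys_cmul_subset keys_sum_subset)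
qed

lemma collapse_keys:
  assumes "Poly_Mapping.keys c \<subseteq> S"
    and "\<And>\<kappa> I. \<lbrakk>(\<kappa>, I) \<in> S; i \<notin> I\<rbrakk> \<Longrightarrow> (strip i (deg \<kappa> i) \<kappa>, I) \<in> T"
  shows "Poly_Mapping.keys (collapse i c) \<subseteq> T"
  unfolding collapse_def
proof (rule keys_frag_extend_subset[OF _ assms(1)], clarify del: subsetI)
  fix \<kappa> I assume "(\<kappa>, I) \<in> S"
  then show "Poly_Mapping.keys (if i \<in> I then 0 else frag_of (strip i (deg \<kappa> i) \<kappa>, I)) \<subseteq> T"
    using assms(2)[of \<kappa> I] by (cases "i \<in> I") simp_all
qed

lemma face_cell:
  assumes "(\<kappa>, I) \<in> cells v" "i \<in> I"
  shows "(\<kappa>, I - {i}) \<in> cells v \<and> (strip i (Suc 0) \<kappa>, I - {i}) \<in> cells v"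
  using cells_subset[OF assms(1)] cells_strip[OF assms(1) cellsD(5)[OF assms], of "I - {i}"] by auto

lemma fill_cell:
  assumes "(\<kappa>, I) \<in> cells v" "t < deg \<kappa> i"
  shows "(strip i t \<kappa>, insert i I) \<in> cells v"
  using assms by (intro cells_strip) auto

lemma collapse_cell:
  assumes "(\<kappa>, I) \<in> cells v" "i \<notin> I"
  shows "(strip i (deg \<kappa> i) \<kappa>, I) \<in> cells v"
  using assms by (intro cells_strip) auto

text \<open>Removing the smaller colour \<open>i\<close> from \<open>I\<close> flips the sign of \<open>j\<close>, whereas removing \<open>j\<close> does not affect that
  of \<open>i\<close>.\<close>

lemma face_face:
  assumes "(\<kappa>, I) \<in> cells v" "i < j"
  shows "face i (face j (frag_of (\<kappa>, I))) = - face j (face i (frag_of (\<kappa>, I)))"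
proof (cases "i \<in> I \<and> j \<in> I")
  case True
  note c = cellsD[OF assms(1)]
  have "strip i (Suc 0) (strip j (Suc 0) \<kappa>) = strip j (Suc 0) (strip i (Suc 0) \<kappa>)"
    using strip_commute[OF c(1) c(5) c(5)] True assms(2) by simp
  moreover have "I - {j} - {i} = I - {i} - {j}" by auto
  ultimately show ?thesis
    using True assms(2) c(4)
    by (simp add: face_of cube_ops_linear position_sign_remove frag_cmul_diff mult.commute
        minus_frag_cmul[symmetric] del: minus_frag_cmul)
next
  case False
  then show ?thesis
    using assms(2) by (cases "i \<in> I"; cases "j \<in> I") (simp_all add: face_of cube_ops_linear)
qed

lemma face_fill:
  assumes "(\<kappa>, I) \<in> cells v" "i \<noteq> j"
  shows "face i (fill j (frag_of (\<kappa>, I))) = - fill j (face i (frag_of (\<kappa>, I)))"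
proof (cases "i \<in> I \<and> j \<notin> I")
  case True
  note c = cellsD[OF assms(1)]
  have i: "Suc 0 \<le> deg \<kappa> i" using c(5) True by blast
  have "strip i (Suc 0) (strip j t \<kappa>) = strip j t (strip i (Suc 0) \<kappa>)" if "t < deg \<kappa> j" for t
    using strip_commute[OF c(1) i _ assms(2)] that by simp
  moreover have "insert j I - {i} = insert j (I - {i})" using assms(2) by auto
  moreover have "deg (strip i (Suc 0) \<kappa>) j = deg \<kappa> j" using strip_mor(3)[OF c(1) i] assms(2) by simp
  ultimately show ?thesis
    using True assms(2) c(4)
    by (simp add: face_of fill_of cube_ops_linear position_sign_remove position_sign_insert
        frag_cmul_diff mult.commute sum_subtractf
        minus_frag_cmul[symmetric] del: minus_frag_cmul flip: frag_cmul_sum)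
next
  case False
  then show ?thesis
    using assms(2) by (cases "i \<in> I"; cases "j \<in> I") (simp_all add: face_of fill_of cube_ops_linear)
qed

lemma face_collapse:
  assumes "(\<kappa>, I) \<in> cells v" "i \<noteq> j"
  shows "face i (collapse j (frag_of (\<kappa>, I))) = collapse j (face i (frag_of (\<kappa>, I)))"
proof (cases "i \<in> I \<and> j \<notin> I")
  case True
  note c = cellsD[OF assms(1)]
  have i: "Suc 0 \<le> deg \<kappa> i" using c(5) True by blast
  have "strip i (Suc 0) (strip j (deg \<kappa> j) \<kappa>) = strip j (deg \<kappa> j) (strip i (Suc 0) \<kappa>)"
    using strip_commute[OF c(1) i _ assms(2)] by simp
  moreover have "deg (strip i (Suc 0) \<kappa>) j = deg \<kappa> j" using strip_mor(3)[OF c(1) i] assms(2) by simp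
  ultimately show ?thesis
    using True assms(2) by (simp add: face_of collapse_of cube_ops_linear)
next
  case False
  then show ?thesis
    using assms(2) by (cases "i \<in> I"; cases "j \<in> I") (simp_all add: face_of collapse_of cube_ops_linear)
qed

text \<open>For \<open>i \<notin> I\<close> the boundary of the path from \<open>\<kappa>\<close> to its collapse telescopes. For \<open>i \<in> I\<close> the path from
  \<open>\<kappa>\<close> exceeds the path from the second face by its first cube, which is \<open>(\<kappa>, I)\<close>.\<close>

lemma fill_homotopy:
  assumes "(\<kappa>, I) \<in> cells v"
  shows "face i (fill i (frag_of (\<kappa>, I))) + fill i (face i (frag_of (\<kappa>, I)))
    = frag_of (\<kappa>, I) - collapse i (frag_of (\<kappa>, I))"
proof (cases "i \<in> I")
  case True
  note c = cellsD[OF assms(1)]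
  have i: "Suc 0 \<le> deg \<kappa> i" using c(5) True by blast
  let ?f = "\<lambda>t. frag_of (strip i t \<kappa>, I)"
  have deg: "deg \<kappa> i = Suc (deg (strip i (Suc 0) \<kappa>) i)"
    using i by (simp add: strip_mor(3)[OF c(1) i])
  have "strip i t (strip i (Suc 0) \<kappa>) = strip i (Suc t) \<kappa>" if "t < deg (strip i (Suc 0) \<kappa>) i" for t
    using strip_strip[OF c(1), of "Suc 0" t i] that deg by simp
  then have "fill i (face i (frag_of (\<kappa>, I))) = (\<Sum>t<deg \<kappa> i. ?f t) - (\<Sum>t<deg (strip i (Suc 0) \<kappa>) i. ?f (Suc t))"
    using True c(4)
    by (simp add: face_of fill_of cube_ops_linear position_sign_remove insert_absorb frag_cmul_diff)
  also have "\<dots> = ?f 0" by (simp add: deg sum.lessThan_Suc_shift del: sum.lessThan_Suc)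
  finally show ?thesis using True c(1) by (simp add: fill_of collapse_of cube_ops_linear strip_0)
next
  case False
  note c = cellsD[OF assms(1)]
  let ?f = "\<lambda>t. frag_of (strip i t \<kappa>, I)"
  have "strip i (Suc 0) (strip i t \<kappa>) = strip i (Suc t) \<kappa>" if "t < deg \<kappa> i" for t
    using strip_strip[OF c(1), of t "Suc 0" i] that by simp
  then have "face i (fill i (frag_of (\<kappa>, I))) = (\<Sum>t<deg \<kappa> i. ?f t - ?f (Suc t))"
    using False c(4)
    by (simp add: face_of fill_of cube_ops_linear position_sign_insert insert_absorb
        flip: frag_cmul_sum)
  also have "\<dots> = ?f 0 - ?f (deg \<kappa> i)" by (rule sum_lessThan_telescope')
  finally show ?thesis using False c(1) by (simp add: face_of collapse_of cube_ops_linear strip_0)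
qed

lemma multicomplex_cubes: "multicomplex {c. Poly_Mapping.keys c \<subseteq> cells v} face fill collapse"
proof -
  note add = additive_cube_ops
  note lin = additive.add[OF add(1)] additive.add[OF add(2)] additive.add[OF add(3)] additive_def
    cube_ops_linear
  have eq: "f c = g c" if "additive f" "additive g" "Poly_Mapping.keys c \<subseteq> cells v"
    "\<And>\<kappa> I. (\<kappa>, I) \<in> cells v \<Longrightarrow> f (frag_of (\<kappa>, I)) = g (frag_of (\<kappa>, I))" for f g :: "_ \<Rightarrow> ('m \<times> nat set) \<Rightarrow>\<^sub>0 int" and c
    using additive_eq_on_frags[OF that(1-3)] that(4) by (auto simp: split_paired_all)
  have closed: "Poly_Mapping.keys (face i c) \<subseteq> cells v" "Poly_Mapping.keys (fill i c) \<subseteq> cells v"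
    "Poly_Mapping.keys (collapse i c) \<subseteq> cells v" if "Poly_Mapping.keys c \<subseteq> cells v" for c i
    using face_keys[OF that face_cell] fill_keys[OF that fill_cell] collapse_keys[OF that collapse_cell]
    by simp_all
  show ?thesis
  proof
    fix c :: "('m \<times> nat set) \<Rightarrow>\<^sub>0 int" and i j :: nat
    assume "c \<in> {c. Poly_Mapping.keys c \<subseteq> cells v}"
    then have c: "Poly_Mapping.keys c \<subseteq> cells v" by simp
    show "face i (face i c) = 0"
    proof (rule eq[OF _ _ c])
      show "face i (face i (frag_of (\<kappa>, I))) = 0" for \<kappa> I
        by (cases "i \<in> I") (simp_all add: face_of cube_ops_linear)
    qed (simp_all add: lin)
    show "face i (collapse i c) = 0"
    proof (rule eq[OF _ _ c])
      show "face i (collapse i (frag_of (\<kappa>, I))) = 0" for \<kappa> I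
        by (cases "i \<in> I") (simp_all add: face_of collapse_of cube_ops_linear)
    qed (simp_all add: lin)
    show "collapse i (face i c) = 0"
    proof (rule eq[OF _ _ c])
      fix \<kappa> I assume z: "(\<kappa>, I) \<in> cells v"
      note \<kappa> = cellsD[OF z]
      show "collapse i (face i (frag_of (\<kappa>, I))) = 0"
      proof (cases "i \<in> I")
        case True
        then have "strip i (deg (strip i (Suc 0) \<kappa>) i) (strip i (Suc 0) \<kappa>) = strip i (deg \<kappa> i) \<kappa>"
          using strip_strip[OF \<kappa>(1), of "Suc 0" "deg \<kappa> i - 1" i] strip_mor(3)[OF \<kappa>(1) \<kappa>(5)[OF True]] \<kappa>(5)[OF True]
          by simp
        then show ?thesis using True by (simp add: face_of collapse_of cube_ops_linear)
      qed (simp add: face_of cube_ops_linear)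
    qed (simp_all add: lin)
    show "face i (fill i c) + fill i (face i c) = c - collapse i c"
    proof (rule eq[OF _ _ c])
      show "face i (fill i (frag_of (\<kappa>, I))) + fill i (face i (frag_of (\<kappa>, I)))
          = frag_of (\<kappa>, I) - collapse i (frag_of (\<kappa>, I))" if "(\<kappa>, I) \<in> cells v" for \<kappa> I
        using that by (rule fill_homotopy)
    qed (simp_all add: lin algebra_simps)
    assume "i \<noteq> j"
    show "face i (face j c) = - face j (face i c)"
    proof (rule eq[OF _ _ c])
      fix \<kappa> I assume z: "(\<kappa>, I) \<in> cells v"
      show "face i (face j (frag_of (\<kappa>, I))) = - face j (face i (frag_of (\<kappa>, I)))"
        using face_face[OF z, of i j] face_face[OF z, of j i] \<open>i \<noteq> j\<close> by (cases "i < j") auto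
    qed (simp_all add: lin)
    show "face i (fill j c) = - fill j (face i c)"
    proof (rule eq[OF _ _ c])
      show "face i (fill j (frag_of (\<kappa>, I))) = - fill j (face i (frag_of (\<kappa>, I)))" if "(\<kappa>, I) \<in> cells v" for \<kappa> I
        using that \<open>i \<noteq> j\<close> by (rule face_fill)
    qed (simp_all add: lin)
    show "face i (collapse j c) = collapse j (face i c)"
    proof (rule eq[OF _ _ c])
      show "face i (collapse j (frag_of (\<kappa>, I))) = collapse j (face i (frag_of (\<kappa>, I)))" if "(\<kappa>, I) \<in> cells v" for \<kappa> I
        using that \<open>i \<noteq> j\<close> by (rule face_collapse)
    qed (simp_all add: lin)
  next
    fix a b :: "('m \<times> nat set) \<Rightarrow>\<^sub>0 int"
    assume "a \<in> {c. Poly_Mapping.keys c \<subseteq> cells v}" "b \<in> {c. Poly_Mapping.keys c \<subseteq> cells v}"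
    then show "a + b \<in> {c. Poly_Mapping.keys c \<subseteq> cells v}" using keys_add[of a b] by blast
  qed (simp_all add: lin closed)
qed

end

section \<open>The cubical resolution\<close>

lemma right_module_constant_int: "right_module \<Lambda> constant_int_module"
  by (simp add: right_module_def constant_int_module_def abelian_integer_group hom_def)

context k_graph
begin

definition translate :: "'m \<Rightarrow> (('m \<times> nat set) \<Rightarrow>\<^sub>0 int) \<Rightarrow> (('m \<times> nat set) \<Rightarrow>\<^sub>0 int)"
  where "translate \<mu> = frag_extend (\<lambda>(\<kappa>, I). frag_of (comp \<Lambda> \<kappa> \<mu>, I))"

definition cube_module :: "nat \<Rightarrow> ('o, 'm, ('m \<times> nat set) \<Rightarrow>\<^sub>0 int) cat_module"
  where "cube_module n = \<lparr>grp = (\<lambda>v. free_Abelian_group (cubes n v)), act = translate\<rparr>"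

lemma grp_cube_module [simp]: "grp (cube_module n) v = free_Abelian_group (cubes n v)"
  by (simp add: cube_module_def)

lemma act_cube_module [simp]: "act (cube_module n) = translate"
  by (simp add: cube_module_def)

lemma cubesD:
  assumes "(\<kappa>, I) \<in> cubes n v"
  shows "(\<kappa>, I) \<in> cells v" "card I = n"
  using assms by (auto simp: cubes_def)

lemma cubes_translate:
  assumes "(\<kappa>, I) \<in> cubes n (rng \<Lambda> \<mu>)" "\<mu> \<in> mor \<Lambda>"
  shows "(comp \<Lambda> \<kappa> \<mu>, I) \<in> cubes n (src \<Lambda> \<mu>)"
  using assms cellsD[OF cubesD(1)[OF assms(1)]] cubesD(2)[OF assms(1)]
  by (auto simp: cubes_def cells_def comp_mor src_comp degree_comp in_keys_iff lookup_add)

lemma translate_hom: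
  assumes "\<mu> \<in> mor \<Lambda>"
  shows "translate \<mu> \<in> hom (free_Abelian_group (cubes n (rng \<Lambda> \<mu>))) (free_Abelian_group (cubes n (src \<Lambda> \<mu>)))"
  unfolding translate_def using assms by (intro frag_extend_hom) (auto simp: cubes_translate)

lemma additive_translate: "additive (translate \<mu>)"
  by (simp add: translate_def additive_frag_extend)

lemma translate_of [simp]: "translate \<mu> (frag_of (\<kappa>, I)) = frag_of (comp \<Lambda> \<kappa> \<mu>, I)"
  by (simp add: translate_def)

lemma right_module_cube: "right_module \<Lambda> (cube_module n)"
  unfolding right_module_def
proof (intro conjI ballI impI)
  fix v x assume v: "v \<in> obj \<Lambda>" and x: "x \<in> carrier (grp (cube_module n) v)"
  have "translate (idn \<Lambda> v) x = x"
  proof (rule additive_eq_on_frags[OF additive_translate])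
    show "Poly_Mapping.keys x \<subseteq> cubes n v" using x by simp
    show "translate (idn \<Lambda> v) (frag_of z) = frag_of z" if "z \<in> cubes n v" for z
      using that comp_idn_right by (cases z) (auto simp: cubes_def cells_def)
  qed (simp add: additive_def)
  then show "act (cube_module n) (idn \<Lambda> v) x = x" by simp
next
  fix \<mu> \<nu> x assume A: "\<mu> \<in> mor \<Lambda>" "\<nu> \<in> mor \<Lambda>" "src \<Lambda> \<mu> = rng \<Lambda> \<nu>"
    "x \<in> carrier (grp (cube_module n) (rng \<Lambda> \<mu>))"
  have "translate (comp \<Lambda> \<mu> \<nu>) x = translate \<nu> (translate \<mu> x)"
  proof (rule additive_eq_on_frags[OF additive_translate])
    show "additive (\<lambda>x. translate \<nu> (translate \<mu> x))"
      by (simp add: additive_def additive.add[OF additive_translate])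
    show "Poly_Mapping.keys x \<subseteq> cubes n (rng \<Lambda> \<mu>)" using A(4) by simp
    show "translate (comp \<Lambda> \<mu> \<nu>) (frag_of z) = translate \<nu> (translate \<mu> (frag_of z))"
      if "z \<in> cubes n (rng \<Lambda> \<mu>)" for z
      using that A cellsD[OF cubesD(1)] by (cases z) (auto simp: comp_assoc)
  qed
  then show "act (cube_module n) (comp \<Lambda> \<mu> \<nu>) x = act (cube_module n) \<nu> (act (cube_module n) \<mu> x)"
    by simp
qed (simp_all add: abelian_free_Abelian_group translate_hom)

lemma carrier_cube_above:
  assumes "k < n"
  shows "carrier (grp (cube_module n) v) = {\<one>\<^bsub>grp (cube_module n) v\<^esub>}"
proof -
  have "card I \<le> k" if "(\<kappa>, I) \<in> cells v" for \<kappa> I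
    using card_mono[OF _ cellsD(6)[OF that]] by simp
  then have "cubes n v = {}" using assms by (force simp: cubes_def)
  then show ?thesis by auto
qed

text \<open>The degree of a cube with edges of the colours \<open>I\<close>.\<close>

definition corner :: "nat set \<Rightarrow> nat \<Rightarrow>\<^sub>0 nat"
  where "corner I = (\<Sum>i\<in>I. Poly_Mapping.single i 1)"

lemma lookup_corner: "finite I \<Longrightarrow> Poly_Mapping.lookup (corner I) j = (if j \<in> I then 1 else 0)"
  by (simp add: corner_def lookup_sum lookup_single when_def)

lemma fits_corner:
  assumes "(\<kappa>, I) \<in> cells v"
  shows "fits (corner I) \<kappa>"
  using cellsD[OF assms] by (auto simp: fits_def lookup_corner)

text \<open>The module is free on the cubes \<open>(x, I)\<close> with \<open>d x = corner I\<close>. To split a surjection \<open>f\<close> onto it, choose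
  preimages \<open>y\<close> of these and send \<open>(x\<lambda>, I)\<close> to the translate of \<open>y (x, I)\<close> by \<open>\<lambda>\<close>; this respects the
  action, because \<open>x\<lambda>\<close> and \<open>x\<lambda>\<mu>\<close> have the same head \<open>x\<close>.\<close>

lemma projective_cube_module: "projective \<Lambda> (cube_module n)"
  unfolding projective_def epis_split_def
proof (intro conjI right_module_cube allI impI, elim conjE)
  fix Q :: "('o, 'm, ('m \<times> (('m \<times> nat set) \<Rightarrow>\<^sub>0 int)) \<Rightarrow>\<^sub>0 int) cat_module" and f
  assume Q: "right_module \<Lambda> Q" and f: "f \<in> module_maps \<Lambda> Q (cube_module n)"
    and sur: "module_surjective \<Lambda> Q (cube_module n) f"
  have sc: "small_category \<Lambda>" by (rule small_category_axioms)
  note fn = natural_homD[OF module_maps_natural[OF f]]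
  \<comment> \<open>the section is determined by the choices for the cubes \<open>(x, I)\<close> with \<open>d x = corner I\<close>\<close>
  have "\<exists>y. y \<in> carrier (grp Q (src \<Lambda> (fst z))) \<and> f (src \<Lambda> (fst z)) y = frag_of z"
    if "z \<in> cubes n v" for z v
  proof -
    have v: "src \<Lambda> (fst z) = v" "v \<in> obj \<Lambda>"
      using cellsD[OF cubesD(1), of "fst z" "snd z" n v] that src_obj by auto
    then have "frag_of z \<in> f v ` carrier (grp Q v)"
      using sur that by (simp add: module_surjective_def)
    then show ?thesis using v by auto
  qed
  then obtain y where y: "\<And>z v. z \<in> cubes n v \<Longrightarrow> y z \<in> carrier (grp Q (src \<Lambda> (fst z)))"
    and fy: "\<And>z v. z \<in> cubes n v \<Longrightarrow> f (src \<Lambda> (fst z)) (y z) = frag_of z"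
    by metis
  define g where "g z = act Q (tail (corner (snd z)) (fst z)) (y (head (corner (snd z)) (fst z), snd z))" for z
  have root: "(head (corner I) \<kappa>, I) \<in> cubes n (src \<Lambda> (head (corner I) \<kappa>))"
    if "(\<kappa>, I) \<in> cubes n v" for \<kappa> I v
    using fits_factor[OF fits_corner[OF cubesD(1)[OF that]]] cubesD(2)[OF that]
      cellsD(4)[OF cubesD(1)[OF that]]
    by (auto simp: cubes_def cells_def in_keys_iff lookup_corner)
  have gQ: "g (\<kappa>, I) \<in> carrier (grp Q v)" and fg: "f v (g (\<kappa>, I)) = frag_of (\<kappa>, I)"
    if z: "(\<kappa>, I) \<in> cubes n v" for \<kappa> I v
  proof -
    note F = fits_factor[OF fits_corner[OF cubesD(1)[OF z]]]
    have v: "src \<Lambda> (tail (corner I) \<kappa>) = v" using F(6) cellsD(2)[OF cubesD(1)[OF z]] by simp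
    have y': "y (head (corner I) \<kappa>, I) \<in> carrier (grp Q (rng \<Lambda> (tail (corner I) \<kappa>)))"
      using y[OF root[OF z]] F(3) by simp
    show "g (\<kappa>, I) \<in> carrier (grp Q v)"
      using right_moduleD(4)[OF Q F(2) y'] v by (simp add: g_def)
    show "f v (g (\<kappa>, I)) = frag_of (\<kappa>, I)"
      using fn(4)[OF F(2) y'] fy[OF root[OF z]] F(3,5) v by (simp add: g_def)
  qed
  have "\<exists>h. v \<in> obj \<Lambda> \<longrightarrow> h \<in> hom (free_Abelian_group (cubes n v)) (grp Q v) \<and>
      (\<forall>z\<in>cubes n v. h (frag_of z) = g z)" for v
  proof (cases "v \<in> obj \<Lambda>")
    case True
    have "g ` cubes n v \<subseteq> carrier (grp Q v)" using gQ by auto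
    then show ?thesis
      using comm_group.free_Abelian_group_universal[OF right_moduleD(1)[OF Q True]] by metis
  qed auto
  then obtain h where h: "\<And>v. v \<in> obj \<Lambda> \<Longrightarrow> h v \<in> hom (free_Abelian_group (cubes n v)) (grp Q v)"
    and hg: "\<And>v z. \<lbrakk>v \<in> obj \<Lambda>; z \<in> cubes n v\<rbrakk> \<Longrightarrow> h v (frag_of z) = g z"
    by metis
  have "natural_hom \<Lambda> (cube_module n) Q h"
    unfolding natural_hom_def
  proof (intro conjI ballI)
    fix \<mu> c assume m: "\<mu> \<in> mor \<Lambda>" and c: "c \<in> carrier (grp (cube_module n) (rng \<Lambda> \<mu>))"
    have "(h (src \<Lambda> \<mu>) \<circ> translate \<mu>) c = (act Q \<mu> \<circ> h (rng \<Lambda> \<mu>)) c"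
    proof (rule hom_free_eq[OF Group.hom_compose[OF translate_hom[OF m] h]
          Group.hom_compose[OF h right_moduleD(3)[OF Q m]]])
      fix z assume z: "z \<in> cubes n (rng \<Lambda> \<mu>)"
      obtain \<kappa> I where zz: "z = (\<kappa>, I)" by (cases z)
      note zc = z[unfolded zz]
      note F = fits_factor[OF fits_corner[OF cubesD(1)[OF zc]]]
      have s: "src \<Lambda> \<kappa> = rng \<Lambda> \<mu>" using cellsD(2)[OF cubesD(1)[OF zc]] .
      have y': "y (head (corner I) \<kappa>, I) \<in> carrier (grp Q (rng \<Lambda> (tail (corner I) \<kappa>)))"
        using y[OF root[OF zc]] F(3) by simp
      have "g (comp \<Lambda> \<kappa> \<mu>, I) = act Q \<mu> (g (\<kappa>, I))"
        using fits_comp(2,3)[OF fits_corner[OF cubesD(1)[OF zc]] m s]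
          right_moduleD(7)[OF Q F(2) m _ y'] F(6) s
        by (simp add: g_def)
      then show "(h (src \<Lambda> \<mu>) \<circ> translate \<mu>) (frag_of z) = (act Q \<mu> \<circ> h (rng \<Lambda> \<mu>)) (frag_of z)"
        using hg[OF src_obj[OF m] cubes_translate[OF zc m]] hg[OF rng_obj[OF m] zc] by (simp add: zz)
    qed (use m c src_obj rng_obj in \<open>auto intro: right_moduleD(2)[OF Q]\<close>)
    then show "h (src \<Lambda> \<mu>) (act (cube_module n) \<mu> c) = act Q \<mu> (h (rng \<Lambda> \<mu>) c)" by simp
  qed (simp add: h)
  note gm = natural_module_maps[OF this sc right_module_cube]
  have "f v (h v c) = c" if v: "v \<in> obj \<Lambda>" and c: "c \<in> carrier (grp (cube_module n) v)" for v c
  proof -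
    have "(f v \<circ> h v) c = id c"
    proof (rule hom_free_eq[OF Group.hom_compose[OF h[OF v] fn(1)[OF v]]])
      show "(f v \<circ> h v) (frag_of z) = id (frag_of z)" if "z \<in> cubes n v" for z
        using that hg[OF v that] fg by (cases z) simp
    qed (use c in \<open>auto simp: hom_def\<close>)
    then show ?thesis by simp
  qed
  with gm show "\<exists>g\<in>module_maps \<Lambda> (cube_module n) Q.
      \<forall>v\<in>obj \<Lambda>. \<forall>x\<in>carrier (grp (cube_module n) v). f v (g v x) = x"
    by (intro bexI[of _ "\<lambda>v\<in>obj \<Lambda>. \<lambda>x\<in>carrier (grp (cube_module n) v). h v x"]) auto
qed

abbreviation cube_boundary :: "(('m \<times> nat set) \<Rightarrow>\<^sub>0 int) \<Rightarrow> (('m \<times> nat set) \<Rightarrow>\<^sub>0 int)"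
  where "cube_boundary \<equiv> partial_boundary face k"

text \<open>The sum of the coefficients, obtained by mapping all generators to a single one.\<close>

definition augmentation :: "(('m \<times> nat set) \<Rightarrow>\<^sub>0 int) \<Rightarrow> int"
  where "augmentation c = Poly_Mapping.lookup (frag_extend (\<lambda>_. frag_of ()) c) ()"

lemma additive_augmentation: "additive augmentation"
  by (simp add: additive_def augmentation_def frag_extend_add lookup_add)

lemma augmentation_of: "augmentation (frag_cmul n (frag_of z)) = n"
  by (simp add: augmentation_def frag_extend_cmul)

lemma boundary_keys:
  assumes "Poly_Mapping.keys c \<subseteq> cubes (Suc n) v"
  shows "Poly_Mapping.keys (partial_boundary face j c) \<subseteq> cubes n v"
proof (induction j)
  case (Suc j)
  have "Poly_Mapping.keys (face j c) \<subseteq> cubes n v"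
    by (rule face_keys[OF assms]) (use face_cell in \<open>force simp: cubes_def dest: cellsD(4)\<close>)
  with Suc show ?case
    using keys_add[of "partial_boundary face j c" "face j c"] by auto
qed simp

lemma homotopy_keys:
  assumes "Poly_Mapping.keys c \<subseteq> cubes n v"
  shows "Poly_Mapping.keys (partial_homotopy fill collapse j c) \<subseteq> cubes (Suc n) v"
proof (induction j)
  case (Suc j)
  have col: "Poly_Mapping.keys (partial_collapse collapse j a) \<subseteq> cubes (Suc n) v"
    if "Poly_Mapping.keys a \<subseteq> cubes (Suc n) v" for j a
    using that
  proof (induction j arbitrary: a)
    case (Suc j)
    have "Poly_Mapping.keys (collapse j a) \<subseteq> cubes (Suc n) v"
      by (rule collapse_keys[OF Suc.prems]) (use collapse_cell in \<open>auto simp: cubes_def\<close>)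
    then show ?case using Suc.IH by simp
  qed simp
  have "Poly_Mapping.keys (fill j c) \<subseteq> cubes (Suc n) v"
    by (rule fill_keys[OF assms]) (use fill_cell in \<open>auto simp: cubes_def dest: cellsD(4)\<close>)
  from col[OF this, of j] Suc show ?case
    using keys_add[of "partial_homotopy fill collapse j c" "partial_collapse collapse j (fill j c)"]
    by auto
qed simp

lemma boundary_translate:
  assumes "Poly_Mapping.keys c \<subseteq> cells (rng \<Lambda> \<mu>)" "\<mu> \<in> mor \<Lambda>"
  shows "partial_boundary face j (translate \<mu> c) = translate \<mu> (partial_boundary face j c)"
proof (induction j)
  case (Suc j)
  have "face j (translate \<mu> c) = translate \<mu> (face j c)"
  proof (rule additive_eq_on_frags[OF _ _ assms(1)])
    fix z assume "z \<in> cells (rng \<Lambda> \<mu>)"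
    then obtain \<kappa> I where z: "z = (\<kappa>, I)" "(\<kappa>, I) \<in> cells (rng \<Lambda> \<mu>)" by (cases z) auto
    note c = cellsD[OF z(2)]
    show "face j (translate \<mu> (frag_of z)) = translate \<mu> (face j (frag_of z))"
    proof (cases "j \<in> I")
      case True
      then have "strip j (Suc 0) (comp \<Lambda> \<kappa> \<mu>) = comp \<Lambda> (strip j (Suc 0) \<kappa>) \<mu>"
        using strip_comp[OF c(1) c(5) assms(2) c(2)] by simp
      with True show ?thesis
        by (simp add: z(1) face_of translate_def frag_extend_cmul frag_extend_diff)
    qed (simp add: z(1) face_of additive.zero[OF additive_translate])
  qed (simp_all add: additive_def additive.add[OF additive_translate] additive.add[OF additive_cube_ops(1)])
  with Suc show ?case by (simp add: additive.add[OF additive_translate])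
qed (simp add: additive.zero[OF additive_translate])

lemma augmentation_translate: "augmentation (translate \<mu> c) = augmentation c"
proof (rule additive_eq_on_frags[of "\<lambda>c. augmentation (translate \<mu> c)" augmentation c UNIV])
  show "augmentation (translate \<mu> (frag_of z)) = augmentation (frag_of z)" for z
    by (cases z) (simp add: augmentation_def)
qed (simp_all add: additive_augmentation,
    simp add: additive_def additive.add[OF additive_translate] additive.add[OF additive_augmentation])

lemma augmentation_boundary: "augmentation (partial_boundary face j c) = 0"
proof (induction j)
  case (Suc j)
  have "augmentation (face j c) = 0"
  proof (rule additive_eq_on_frags[of "\<lambda>c. augmentation (face j c)" "\<lambda>c. 0" c UNIV])
    fix z :: "'m \<times> nat set"
    obtain \<kappa> I where z: "z = (\<kappa>, I)" by (cases z)
    show "augmentation (face j (frag_of z)) = 0"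
      by (cases "j \<in> I") (simp_all add: z face_of augmentation_def frag_extend_cmul frag_extend_diff)
  qed (simp_all add: additive_def additive.add[OF additive_cube_ops(1)] additive.add[OF additive_augmentation])
  with Suc show ?case by (simp add: additive.add[OF additive_augmentation])
qed (simp add: additive.zero[OF additive_augmentation])

lemma collapse_positive:
  assumes "i < j" "i \<in> I"
  shows "partial_collapse collapse j (frag_of (\<kappa>, I)) = 0"
  using assms(1)
proof (induction j arbitrary: \<kappa>)
  case (Suc j)
  have zero: "partial_collapse collapse j 0 = 0" for j
    by (induction j) (simp_all add: cube_ops_linear)
  show ?case
  proof (cases "j \<in> I")
    case False
    then have "i < j" using Suc.prems assms(2) less_Suc_eq by blast
    with False show ?thesis using Suc.IH by (simp add: collapse_of)
  qed (simp add: collapse_of zero)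
qed simp

text \<open>The bound on the degrees keeps a colour at \<open>0\<close> once it has been removed.\<close>

lemma collapse_vertex:
  assumes "\<kappa> \<in> mor \<Lambda>"
  shows "\<exists>\<nu>\<in>mor \<Lambda>. partial_collapse collapse j (frag_of (\<kappa>, {})) = frag_of (\<nu>, {}) \<and> src \<Lambda> \<nu> = src \<Lambda> \<kappa>
    \<and> (\<forall>i. deg \<nu> i \<le> deg \<kappa> i) \<and> (\<forall>i<j. deg \<nu> i = 0)"
  using assms
proof (induction j arbitrary: \<kappa>)
  case (Suc j)
  let ?\<kappa> = "strip j (deg \<kappa> j) \<kappa>"
  note s = strip_mor[OF Suc.prems order_refl, of j]
  obtain \<nu> where \<nu>: "\<nu> \<in> mor \<Lambda>" "partial_collapse collapse j (frag_of (?\<kappa>, {})) = frag_of (\<nu>, {})"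
    "src \<Lambda> \<nu> = src \<Lambda> ?\<kappa>" "\<And>i. deg \<nu> i \<le> deg ?\<kappa> i" "\<And>i. i < j \<Longrightarrow> deg \<nu> i = 0"
    using Suc.IH[OF s(1)] by blast
  have "deg \<nu> i \<le> deg \<kappa> i" "i < Suc j \<Longrightarrow> deg \<nu> i = 0" for i
    using \<nu>(4,5)[of i] s(3)[of i] by (auto split: if_splits)
  with \<nu>(1-3) s(2) show ?case by (intro bexI[of _ \<nu>]) (auto simp: collapse_of)
qed auto

lemma collapse_total:
  assumes "\<kappa> \<in> mor \<Lambda>"
  shows "partial_collapse collapse k (frag_of (\<kappa>, {})) = frag_of (idn \<Lambda> (src \<Lambda> \<kappa>), {})"
proof -
  obtain \<nu> where \<nu>: "\<nu> \<in> mor \<Lambda>" "partial_collapse collapse k (frag_of (\<kappa>, {})) = frag_of (\<nu>, {})"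
    "src \<Lambda> \<nu> = src \<Lambda> \<kappa>" "\<And>i. i < k \<Longrightarrow> deg \<nu> i = 0"
    using collapse_vertex[OF assms, of k] by blast
  have "deg \<nu> i = 0" for i
    using degree[OF \<nu>(1)] \<nu>(4)[of i] by (cases "i < k") (auto simp: multidegrees_def in_keys_iff)
  then have "d \<nu> = 0" by (intro poly_mapping_eqI) simp
  then have "\<nu> = idn \<Lambda> (src \<Lambda> \<nu>)" using tail_degree[OF \<nu>(1)] tail_0[OF \<nu>(1)] by simp
  with \<nu> show ?thesis by simp
qed

text \<open>Collapsing all colours kills every cube of positive dimension and takes each \<open>(\<kappa>, {})\<close> to the
  identity of the source, so the total collapse is the augmentation followed by the inclusion of the
  identity of \<open>v\<close>.\<close>

lemma homotopy_cube:
  assumes "Poly_Mapping.keys c \<subseteq> cubes n v"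
  shows "cube_boundary (partial_homotopy fill collapse k c) + partial_homotopy fill collapse k (cube_boundary c)
    = c - (if n = 0 then frag_cmul (augmentation c) (frag_of (idn \<Lambda> v, {})) else 0)"
proof -
  interpret multicomplex "{c. Poly_Mapping.keys c \<subseteq> cells v}" face fill collapse
    by (rule multicomplex_cubes)
  have cells: "Poly_Mapping.keys c \<subseteq> cells v" using assms by (auto simp: cubes_def)
  have "partial_collapse collapse k c
      = (if n = 0 then frag_cmul (augmentation c) (frag_of (idn \<Lambda> v, {})) else 0)"
  proof (rule additive_eq_on_frags[OF additive_collapse _ assms])
    show "additive (\<lambda>c. if n = 0 then frag_cmul (augmentation c) (frag_of (idn \<Lambda> v, {})) else 0)"
      by (simp add: additive_def additive.add[OF additive_augmentation] frag_cmul_distrib)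
    fix z assume "z \<in> cubes n v"
    then obtain \<kappa> I where z: "z = (\<kappa>, I)" "(\<kappa>, I) \<in> cubes n v" by (cases z) auto
    note c = cellsD[OF cubesD(1)[OF z(2)]] and n = cubesD(2)[OF z(2)]
    show "partial_collapse collapse k (frag_of z)
        = (if n = 0 then frag_cmul (augmentation (frag_of z)) (frag_of (idn \<Lambda> v, {})) else 0)"
    proof (cases "n = 0")
      case True
      then have "I = {}" using n c(4) by simp
      then show ?thesis
        using True collapse_total[OF c(1)] c(2) augmentation_of[of 1 z] by (simp add: z(1))
    next
      case False
      then obtain i where "i \<in> I" using n by (metis card.empty ex_in_conv)
      then show ?thesis using False c(6) collapse_positive[of i k I \<kappa>] by (auto simp: z(1))
    qed
  qed
  then show ?thesis using homotopy_formula[of c k] cells by simp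
qed

lemma cubes_cells: "Poly_Mapping.keys c \<subseteq> cubes n v \<Longrightarrow> Poly_Mapping.keys c \<subseteq> cells v"
  by (auto simp: cubes_def)

lemma cube_boundary_natural: "natural_hom \<Lambda> (cube_module (Suc n)) (cube_module n) (\<lambda>v. cube_boundary)"
  unfolding natural_hom_def
proof (intro conjI ballI)
  show "cube_boundary \<in> hom (grp (cube_module (Suc n)) v) (grp (cube_module n) v)" for v
    using boundary_keys additive.add[OF multicomplex.additive_boundary[OF multicomplex_cubes]]
    by (intro homI) auto
  show "cube_boundary (act (cube_module (Suc n)) \<mu> c) = act (cube_module n) \<mu> (cube_boundary c)"
    if "\<mu> \<in> mor \<Lambda>" "c \<in> carrier (grp (cube_module (Suc n)) (rng \<Lambda> \<mu>))" for \<mu> c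
    using boundary_translate[OF cubes_cells that(1)] that(2) by simp
qed

lemma augmentation_natural: "natural_hom \<Lambda> (cube_module 0) constant_int_module (\<lambda>v. augmentation)"
  unfolding natural_hom_def
proof (intro conjI ballI)
  show "augmentation \<in> hom (grp (cube_module 0) v) (grp constant_int_module v)" for v
    by (intro homI) (simp_all add: constant_int_module_def additive.add[OF additive_augmentation])
qed (simp add: augmentation_translate constant_int_module_def)

lemma cube_exact:
  "cube_boundary ` carrier (free_Abelian_group (cubes (Suc (Suc n)) v))
    = kernel (free_Abelian_group (cubes (Suc n) v)) (free_Abelian_group (cubes n v)) cube_boundary"
proof -
  interpret multicomplex "{c. Poly_Mapping.keys c \<subseteq> cells v}" face fill collapse
    by (rule multicomplex_cubes)
  show ?thesis
  proof (intro equalityI subsetI)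
    fix b assume "b \<in> cube_boundary ` carrier (free_Abelian_group (cubes (Suc (Suc n)) v))"
    then obtain c where c: "Poly_Mapping.keys c \<subseteq> cubes (Suc (Suc n)) v" "b = cube_boundary c" by auto
    then show "b \<in> kernel (free_Abelian_group (cubes (Suc n) v)) (free_Abelian_group (cubes n v)) cube_boundary"
      using boundary_squared[of c k] cubes_cells[OF c(1)] boundary_keys[OF c(1)] by (simp add: kernel_def)
  next
    fix c assume "c \<in> kernel (free_Abelian_group (cubes (Suc n) v)) (free_Abelian_group (cubes n v)) cube_boundary"
    then have c: "Poly_Mapping.keys c \<subseteq> cubes (Suc n) v" "cube_boundary c = 0" by (auto simp: kernel_def)
    then have "c = cube_boundary (partial_homotopy fill collapse k c)"
      using homotopy_cube[OF c(1)] additive.zero[OF additive_homotopy] by simp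
    then show "c \<in> cube_boundary ` carrier (free_Abelian_group (cubes (Suc (Suc n)) v))"
      by (rule image_eqI) (simp add: homotopy_keys[OF c(1)])
  qed
qed

text \<open>In degree \<open>0\<close> the homotopy formula has a third term, which vanishes on the kernel of the
  augmentation.\<close>

lemma cube_exact_augmentation:
  "cube_boundary ` carrier (free_Abelian_group (cubes (Suc 0) v))
    = kernel (free_Abelian_group (cubes 0 v)) integer_group augmentation"
proof -
  interpret multicomplex "{c. Poly_Mapping.keys c \<subseteq> cells v}" face fill collapse
    by (rule multicomplex_cubes)
  show ?thesis
  proof (intro equalityI subsetI)
    fix b assume "b \<in> cube_boundary ` carrier (free_Abelian_group (cubes (Suc 0) v))"
    then obtain c where c: "Poly_Mapping.keys c \<subseteq> cubes (Suc 0) v" "b = cube_boundary c" by auto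
    then show "b \<in> kernel (free_Abelian_group (cubes 0 v)) integer_group augmentation"
      using boundary_keys[OF c(1)] by (simp add: kernel_def augmentation_boundary)
  next
    fix c assume "c \<in> kernel (free_Abelian_group (cubes 0 v)) integer_group augmentation"
    then have c: "Poly_Mapping.keys c \<subseteq> cubes 0 v" "augmentation c = 0" by (auto simp: kernel_def)
    have "face j c = 0" for j
    proof (rule additive_eq_on_frags[OF additive_cube_ops(1) _ c(1), of "\<lambda>_. 0"])
      fix z assume z: "z \<in> cubes 0 v"
      then have "snd z = {}" using cellsD(4)[of "fst z" "snd z" v] by (simp add: cubes_def)
      then show "face j (frag_of z) = 0" by (cases z) (simp add: face_of)
    qed (simp add: additive_def)
    then have "partial_boundary face j c = 0" for j by (induction j) simp_all
    then have "c = cube_boundary (partial_homotopy fill collapse k c)"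
      using homotopy_cube[OF c(1)] c(2) additive.zero[OF additive_homotopy] by simp
    then show "c \<in> cube_boundary ` carrier (free_Abelian_group (cubes (Suc 0) v))"
      by (rule image_eqI) (simp add: homotopy_keys[OF c(1)])
  qed
qed

lemma cube_resolution:
  "projective_resolution \<Lambda> cube_module
    (\<lambda>n. \<lambda>v\<in>obj \<Lambda>. \<lambda>c\<in>carrier (grp (cube_module (Suc n)) v). cube_boundary c)
    (\<lambda>v\<in>obj \<Lambda>. \<lambda>c\<in>carrier (grp (cube_module 0) v). augmentation c) constant_int_module"
proof -
  have sc: "small_category \<Lambda>" by (rule small_category_axioms)
  have sur: "augmentation ` carrier (free_Abelian_group (cubes 0 v)) = UNIV" if v: "v \<in> obj \<Lambda>" for v
  proof -
    have "(idn \<Lambda> v, {}) \<in> cubes 0 v" using v by (simp add: cubes_def cells_def idn_mor src_idn)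
    then have "frag_cmul n (frag_of (idn \<Lambda> v, {})) \<in> carrier (free_Abelian_group (cubes 0 v))" for n
      by (simp add: keys_cmul_subset)
    then have "n \<in> augmentation ` carrier (free_Abelian_group (cubes 0 v))" for n
      using augmentation_of[of n] image_eqI by metis
    then show ?thesis by blast
  qed
  have im: "(\<lambda>c\<in>A. f c) ` A = f ` A" for f :: "_ \<Rightarrow> 'z" and A :: "(('m \<times> nat set) \<Rightarrow>\<^sub>0 int) set"
    by auto
  have ker: "kernel G G' (\<lambda>c\<in>carrier G. f c) = kernel G G' f" for f :: "_ \<Rightarrow> 'z" and G :: "(('m \<times> nat set) \<Rightarrow>\<^sub>0 int) monoid" and G'
    by (auto simp: kernel_def)
  show ?thesis
    unfolding projective_resolution_def
  proof (intro conjI allI ballI projective_cube_module)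
    show "(\<lambda>v\<in>obj \<Lambda>. \<lambda>c\<in>carrier (grp (cube_module (Suc n)) v). cube_boundary c)
        \<in> module_maps \<Lambda> (cube_module (Suc n)) (cube_module n)" for n
      using natural_module_maps[OF cube_boundary_natural sc right_module_cube] .
    show "(\<lambda>v\<in>obj \<Lambda>. \<lambda>c\<in>carrier (grp (cube_module 0) v). augmentation c)
        \<in> module_maps \<Lambda> (cube_module 0) constant_int_module"
      using natural_module_maps[OF augmentation_natural sc right_module_cube] .
  qed (auto simp: im ker cube_exact cube_exact_augmentation sur module_surjective_def constant_int_module_def
      simp del: carrier_free_Abelian_group_iff)
qed

end

section \<open>Vanishing above degree \<open>k\<close>\<close>

theorem proposition6p3:
  fixes k n :: nat
    and \<Lambda> :: "('o, 'm) category"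
    and d :: "'m \<Rightarrow> nat \<Rightarrow>\<^sub>0 nat"
    and N :: "('o, 'm, 'a) cat_module"
    and M :: "('o, 'm, 'b) cat_module"
    and R :: "nat \<Rightarrow> ('o, 'm, 'r) cat_module"
    and bd :: "nat \<Rightarrow> 'o \<Rightarrow> 'r \<Rightarrow> 'r"
    and \<epsilon> :: "'o \<Rightarrow> 'r \<Rightarrow> int"
  assumes "k_graph k \<Lambda> d"
    and "left_module \<Lambda> N"
    and "right_module \<Lambda> M"
    and "projective_resolution \<Lambda> R bd \<epsilon> constant_int_module"
    and "k < n"
  shows "trivial_group (cat_homology \<Lambda> R bd N n) \<and> trivial_group (cat_cohomology \<Lambda> R bd M n)"
proof -
  interpret k_graph k \<Lambda> d by fact
  have sc: "small_category \<Lambda>" by (rule small_category_axioms)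
  obtain m where n: "n = Suc m" using \<open>k < n\<close> by (cases n) auto
  obtain h where h: "\<And>n. natural_hom \<Lambda> (R n) (R (Suc n)) (h n)"
    and hb: "\<And>n v x. \<lbrakk>k < Suc n; v \<in> obj \<Lambda>; x \<in> carrier (grp (R (Suc n)) v)\<rbrakk>
      \<Longrightarrow> bd (Suc n) v (h (Suc n) v x) \<otimes>\<^bsub>grp (R (Suc n)) v\<^esub> h n v (bd n v x) = x"
    using contraction_above[OF sc right_module_constant_int assms(4) cube_resolution
        carrier_cube_above] by blast
  note hm = hb[OF \<open>k < n\<close>[unfolded n]]
  show ?thesis
    using homology_vanishes[OF sc assms(2,4) h h hm] cohomology_vanishes[OF sc assms(4,3) h h hm]
    by (simp add: n)
qed

end
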